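(* Consider the dynamic $K$-armed multi-player bandit over $T$ rounds in which at most $x$ players enter and leave during the $T$ rounds. Let the arms be indexed so that $\mu_1\ge\dots\ge\mu_K$, let $\Delta_m=\min_{i\in[K-1]}(\mu_i-\mu_{i+1})$, and let $\delta\in(0,1)$ and $0<\epsilon<\Delta_m$. Let all players run the Dynamic Trekking (DT) algorithm with learning phase of length $T_0=T_0(\delta/T)$ and epochs of length $$T_{ep}=\sqrt{\frac{TK(T_0+T_{tr})}{2x}}.$$ Then, with high probability (at least $1-\delta$), the expected regret and the number of collisions of DT satisfy $$R\le\tilde{O}(\sqrt{xT})\qquad\text{and}\qquad C\le\tilde{O}(\sqrt{xT}),$$ where $\tilde{O}$ hides logarithmic factors (in $T$).
   Context: **Model.** There are $K>1$ arms. Playing arm $k$ without collision gives a reward drawn independently from a stationary distribution supported in $[0,1]$ with mean $\mu_k$; rewards are independent across players. In round $t$ there are $N_t\le K$ players present. Players do not know how many players are present and cannot communicate. In each round each present player selects one arm; if an arm is selected by exactly one player she receives its reward, otherwise all players selecting it observe a collision and receive zero reward. Let $I_{j,t}$ be the arm selected by player $j$ in round $t$ and $\eta_{j,t}=1$ if some other player selects the same arm in round $t$, $\eta_{j,t}=0$ otherwise. With $K_t^*$ the set of the $N_t$ arms with highest means, the (expected, i.e. measured with the means) regret and number of collisions are $$R=\sum_{t=1}^T\sum_{k\in K_t^*}\mu_k-\sum_{t=1}^T\sum_{j\in[N_t]}\mu_{I_{j,t}}(1-\eta_{j,t}),\qquad C=\sum_{t=1}^T\sum_{j\in[N_t]}\eta_{j,t}.$$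 $\log$ is the natural logarithm and rounding of non-integer numbers of rounds is ignored. **Standing assumptions for DT.** The number of players entering and leaving (the total number of entries and departures) is at most $x$, where $x$ is bounded or at most sublinear in $T$. All players share a global clock. No new player enters during the learning and trekking phase of an epoch; players may leave at any time. The implicit constants may depend on $K,\epsilon,\delta$ but not on $T$ or $x$. **DT algorithm.** Time is divided into epochs of length $T_{ep}$ (if $T_{ep}$ given by the formula is smaller than $T_0$, one sets $T_{ep}=T_0$). At the start of each epoch (global time $\equiv 0 \bmod T_{ep}$) all present players restart: they run the learning phase for $T_0$ rounds and then the trekking phase, until the end of the epoch. A player who enters in the middle of an epoch plays at most one arm in each of the remaining rounds of that epoch and joins the algorithm at the next epoch. *Learning phase* ($T_0$ rounds). A player selects an arm uniformly at random from $[K]$ in each round until the first round in which she observes no collision; from then on she selects in each round the arm with index one higher (modulo $K$) than the previous one. At the end she computes the empirical mean of the rewards observed on each arm in collision-free rounds and re-indexes the arms in decreasing order of empirical mean. If her arm in the last round of the phase has new index $1$ she plays it until the end of the epoch (she is locked on it); otherwise she enters the trekking phase. *Trekking phase*, one of two variants (the same for all players). TrekU: the arm played at the end of learning is her reserved arm. A player with reserved arm $i\ge2$ plays arm $i-1$ in the next $i-1$ rounds; if she observes a collision in one of them she returns to arm $i$ and stays on it (locked); if not, her reserved arm becomes $i-1$ and she continues likewise; if her reserved arm becomes $1$, she locks on it. TrekD: a player whose arm at the end of learning has index $i$ has back-off time $K-i+1$. She plays arm $1$ for up to $K-i+1$ rounds; as soon as a play is collision-free she locks on the arm; if all $K-i+1$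 plays collide she moves to arm $2$ and proceeds likewise, then to arm $3$, and so on until she locks. **Constants.** $T_0(\delta)=\left\lceil \frac{\log(\delta/2K)}{\log(1-1/4K)}\right\rceil+\frac{2K}{\epsilon^2}\log\left(\frac{4K^2}{\delta}\right)$. $T_{tr}$ is a constant not depending on $T$ which upper bounds the number of rounds needed by the trekking phase for all players to settle: with $N$ players it is $(K^2-(N-1)^2)/2+1$ for TrekU and $(N-1)(K-1)+1$ for TrekD, and in the dynamic case it bounds these for all possible numbers $N\le K$ of players. *)

theory Defs
  imports "HOL-Probability.Probability"
begin

text \<open>
  Arms are labelled 1, ..., K, players by natural numbers, and rounds are 0, 1, 2, ..., so that
  epochs start at the multiples of the epoch length. The labels are what the players know; no order
  of the means along the labels is assumed here.
\<close>

subsection \<open>Rewards and the sample space\<close>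

definition arm_mean :: "(nat \<Rightarrow> real measure) \<Rightarrow> nat \<Rightarrow> real" where
  "arm_mean D k = (\<integral>y. y \<partial>D k)"

definition reward_laws :: "nat \<Rightarrow> (nat \<Rightarrow> real measure) \<Rightarrow> bool" where
  "reward_laws K D \<longleftrightarrow>
     (\<forall>k\<in>{1..K}. prob_space (D k) \<and> sets (D k) = sets borel \<and> (AE y in D k. 0 \<le> y \<and> y \<le> 1))"

text \<open>
  A sample point consists of the uniform arm that player j draws in round t, at index (j, t) (used
  only while j is hopping at random), and the reward that j receives if she plays arm k in round t
  without collision, at index (j, t, k). All of these are independent.
\<close>

type_synonym sample = "(nat \<times> nat \<Rightarrow> nat) \<times> (nat \<times> nat \<times> nat \<Rightarrow> real)"

definition sample_space :: "nat \<Rightarrow> (nat \<Rightarrow> real measure) \<Rightarrow> sample measure" where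
  "sample_space K D =
     (\<Pi>\<^sub>M jt\<in>UNIV. measure_pmf (pmf_of_set {1..K})) \<Otimes>\<^sub>M
     (\<Pi>\<^sub>M (j, t, k)\<in>UNIV \<times> UNIV \<times> {1..K}. D k)"

subsection \<open>Players' local states\<close>

datatype trek_variant = TrekU | TrekD

text \<open>
  In \<open>Hop_Seq a h\<close>, \<open>a\<close> is the arm played in the previous round and \<open>h\<close> lists
  the (round, arm) pairs of the player's collision-free plays in this learning phase. In the
  trekking states \<open>r\<close> lists the arms in decreasing order of the player's own empirical means,
  so that the arm with new index \<open>i\<close> is \<open>r ! (i - 1)\<close>. In \<open>Trek_Up r i c\<close>, \<open>i\<close> is the index of the
  reserved arm and \<open>c\<close> the number of plays already made on index \<open>i - 1\<close>; in
  \<open>Trek_Down r b m c\<close>, \<open>b\<close> is the back-off time, \<open>m\<close> the index of the arm being tried and \<open>c\<close> the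
  number of plays already made on it. \<open>Waiting\<close> is the state of a player who entered in the middle
  of the current epoch, and of absent players.
\<close>

datatype local_state =
    Waiting
  | Hop_Random
  | Hop_Seq nat "(nat \<times> nat) list"
  | Trek_Up "nat list" nat nat
  | Trek_Down "nat list" nat nat nat
  | Locked nat

definition empirical_mean :: "(nat \<Rightarrow> nat \<Rightarrow> real) \<Rightarrow> (nat \<times> nat) list \<Rightarrow> nat \<Rightarrow> real" where
  "empirical_mean X h k =
     (let ts = [t. (t, a) \<leftarrow> h, a = k] in (\<Sum>t\<leftarrow>ts. X t k) / real (length ts))"

definition empirical_order :: "nat \<Rightarrow> (nat \<Rightarrow> real) \<Rightarrow> nat list" where
  "empirical_order K m = sort_key (\<lambda>k. - m k) [1..<Suc K]"

definition start_trek :: "nat \<Rightarrow> trek_variant \<Rightarrow> nat list \<Rightarrow> nat \<Rightarrow> local_state" where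
  "start_trek K V r a =
     (let i = (THE i. i \<in> {1..K} \<and> r ! (i - 1) = a)
      in if i = 1 then Locked a
         else case V of TrekU \<Rightarrow> Trek_Up r i 0 | TrekD \<Rightarrow> Trek_Down r (K - i + 1) 1 0)"

text \<open>
  The state after playing arm \<open>a\<close> in round \<open>t\<close>, where \<open>col\<close> tells whether there was a collision. A
  player in \<open>Trek_Down\<close> who exhausts her back-off time even on the last arm starts again from index
  1; this choice is immaterial as it can happen only when the players' empirical orders differ or
  the learning phase ends with two players on the same arm.
\<close>

fun observe :: "nat \<Rightarrow> nat \<Rightarrow> nat \<Rightarrow> bool \<Rightarrow> local_state \<Rightarrow> local_state" where
  "observe K t a col Waiting = Waiting"
| "observe K t a col Hop_Random = (if col then Hop_Random else Hop_Seq a [(t, a)])"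
| "observe K t a col (Hop_Seq _ h) = Hop_Seq a (if col then h else (t, a) # h)"
| "observe K t a col (Trek_Up r i c) =
     (if col then Locked (r ! (i - 1))
      else if Suc c < i - 1 then Trek_Up r i (Suc c)
      else if i - 1 = 1 then Locked (r ! 0)
      else Trek_Up r (i - 1) 0)"
| "observe K t a col (Trek_Down r b m c) =
     (if \<not> col then Locked (r ! (m - 1))
      else if Suc c < b then Trek_Down r b m (Suc c)
      else Trek_Down r b (m mod K + 1) 0)"
| "observe K t a col (Locked k) = Locked k"

fun finish_learning ::
  "nat \<Rightarrow> trek_variant \<Rightarrow> (nat \<Rightarrow> nat \<Rightarrow> real) \<Rightarrow> nat \<Rightarrow> local_state \<Rightarrow> local_state" where
  "finish_learning K V X a Hop_Random =
     start_trek K V (empirical_order K (empirical_mean X [])) a"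
| "finish_learning K V X a (Hop_Seq b h) =
     start_trek K V (empirical_order K (empirical_mean X h)) a"
| "finish_learning K V X a q = q"

fun select_arm :: "nat \<Rightarrow> nat \<Rightarrow> nat option \<Rightarrow> local_state \<Rightarrow> nat option" where
  "select_arm K u w Waiting = w"
| "select_arm K u w Hop_Random = Some u"
| "select_arm K u w (Hop_Seq a h) = Some (a mod K + 1)"
| "select_arm K u w (Trek_Up r i c) = Some (r ! (i - 2))"
| "select_arm K u w (Trek_Down r b m c) = Some (r ! (m - 1))"
| "select_arm K u w (Locked a) = Some a"

subsection \<open>The algorithm in the dynamic environment\<close>

text \<open>
  \<open>L\<close> is the length of the learning phase, \<open>E\<close> the length of an epoch. Player \<open>j\<close> is present in the
  rounds \<open>arr j, ..., dep j - 1\<close>; labels with \<open>dep j \<le> arr j\<close> are unused. \<open>W j t \<omega>\<close> is the arm (if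
  any) that \<open>j\<close> plays in round \<open>t\<close> if she is then waiting for the next epoch.
\<close>

locale dynamic_trekking =
  fixes K :: nat and V :: trek_variant and L E :: nat
    and arr dep :: "nat \<Rightarrow> nat" and W :: "nat \<Rightarrow> nat \<Rightarrow> sample \<Rightarrow> nat option"
begin

definition present :: "nat \<Rightarrow> nat set" where
  "present t = {j. arr j \<le> t \<and> t < dep j}"

definition play :: "sample \<Rightarrow> nat \<Rightarrow> (nat \<Rightarrow> local_state) \<Rightarrow> nat \<Rightarrow> nat option" where
  "play \<omega> t q j = (if j \<in> present t then select_arm K (fst \<omega> (j, t)) (W j t \<omega>) (q j) else None)"

definition collides :: "(nat \<Rightarrow> nat option) \<Rightarrow> nat \<Rightarrow> bool" where
  "collides I j \<longleftrightarrow> I j \<noteq> None \<and> (\<exists>i. i \<noteq> j \<and> I i = I j)"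

definition step :: "sample \<Rightarrow> nat \<Rightarrow> (nat \<Rightarrow> local_state) \<Rightarrow> nat \<Rightarrow> local_state" where
  "step \<omega> t q j =
     (case play \<omega> t q j of
        None \<Rightarrow> q j
      | Some a \<Rightarrow>
          (let q' = observe K t a (collides (play \<omega> t q) j) (q j)
           in if t mod E = L - 1 then finish_learning K V (\<lambda>s k. snd \<omega> (j, s, k)) a q' else q'))"

primrec states :: "sample \<Rightarrow> nat \<Rightarrow> nat \<Rightarrow> local_state" where
  "states \<omega> 0 = (\<lambda>j. if j \<in> present 0 then Hop_Random else Waiting)"
| "states \<omega> (Suc t) =
     (\<lambda>j. if j \<notin> present (Suc t) then Waiting
          else if E dvd Suc t then Hop_Random
          else step \<omega> t (states \<omega> t) j)"

definition arm_played :: "sample \<Rightarrow> nat \<Rightarrow> nat \<Rightarrow> nat option" where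
  "arm_played \<omega> t = play \<omega> t (states \<omega> t)"

definition collision :: "sample \<Rightarrow> nat \<Rightarrow> nat \<Rightarrow> nat" where
  "collision \<omega> t j = of_bool (collides (arm_played \<omega> t) j)"

text \<open>
  Here \<open>\<sigma> 1, ..., \<sigma> K\<close> is an enumeration of the arms by decreasing mean.
\<close>

definition regret :: "(nat \<Rightarrow> real) \<Rightarrow> (nat \<Rightarrow> nat) \<Rightarrow> nat \<Rightarrow> sample \<Rightarrow> real" where
  "regret \<mu> \<sigma> T \<omega> =
     (\<Sum>t<T. \<Sum>k\<in>\<sigma> ` {1..card (present t)}. \<mu> k) -
     (\<Sum>t<T. \<Sum>j\<in>present t.
        case arm_played \<omega> t j of None \<Rightarrow> 0 | Some a \<Rightarrow> \<mu> a * (1 - real (collision \<omega> t j)))"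

definition collisions :: "nat \<Rightarrow> sample \<Rightarrow> nat" where
  "collisions T \<omega> = (\<Sum>t<T. \<Sum>j\<in>present t. collision \<omega> t j)"

text \<open>Players present from round 0 on do not count as entering.\<close>

definition entries :: "nat \<Rightarrow> nat set" where
  "entries T = {j. arr j < dep j \<and> 0 < arr j \<and> arr j < T}"

definition departures :: "nat \<Rightarrow> nat set" where
  "departures T = {j. arr j < dep j \<and> dep j < T}"

text \<open>
  Besides the bounds on the players, this says that nobody enters during the first \<open>L + Ttr\<close> rounds
  (learning and trekking) of an epoch, except at its very start, where the entrant joins the epoch.
\<close>

definition admissible_schedule :: "real \<Rightarrow> nat \<Rightarrow> nat \<Rightarrow> bool" where
  "admissible_schedule Ttr T x \<longleftrightarrow>
     (\<forall>t<T. finite (present t) \<and> card (present t) \<le> K) \<and>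
     card (entries T) + card (departures T) \<le> x \<and>
     (\<forall>j\<in>entries T. arr j mod E = 0 \<or> real L + Ttr \<le> real (arr j mod E))"

text \<open>
  Waiting players behave arbitrarily. Since each choice may depend on the whole sample point, whose
  uniform draws for the rounds after the horizon are otherwise unused, this includes randomised and
  history-dependent behaviour.
\<close>

definition admissible_waiting :: "(nat \<Rightarrow> real measure) \<Rightarrow> bool" where
  "admissible_waiting D \<longleftrightarrow>
     (\<forall>j t. W j t \<in> sample_space K D \<rightarrow>\<^sub>M count_space UNIV \<and>
            (\<forall>\<omega>. W j t \<omega> \<in> insert None (Some ` {1..K})))"

end

subsection \<open>Lengths of phases and epochs\<close>

definition T0 :: "nat \<Rightarrow> real \<Rightarrow> real \<Rightarrow> real" where
  "T0 K \<epsilon> \<delta> =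
     real_of_int \<lceil>ln (\<delta> / (2 * real K)) / ln (1 - 1 / (4 * real K))\<rceil>
     + 2 * real K / \<epsilon>\<^sup>2 * ln (4 * (real K)\<^sup>2 / \<delta>)"

definition trek_bound :: "trek_variant \<Rightarrow> nat \<Rightarrow> nat \<Rightarrow> real" where
  "trek_bound V K N =
     (case V of
        TrekU \<Rightarrow> ((real K)\<^sup>2 - (real N - 1)\<^sup>2) / 2 + 1
      | TrekD \<Rightarrow> (real N - 1) * (real K - 1) + 1)"

text \<open>Numbers of rounds are rounded up to integers.\<close>

definition learning_length :: "nat \<Rightarrow> real \<Rightarrow> real \<Rightarrow> nat \<Rightarrow> nat" where
  "learning_length K \<epsilon> \<delta> T = nat \<lceil>T0 K \<epsilon> (\<delta> / real T)\<rceil>"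

definition epoch_length :: "nat \<Rightarrow> real \<Rightarrow> real \<Rightarrow> real \<Rightarrow> nat \<Rightarrow> nat \<Rightarrow> nat" where
  "epoch_length K \<epsilon> \<delta> Ttr T x =
     (let \<tau> = T0 K \<epsilon> (\<delta> / real T)
      in nat \<lceil>max \<tau> (sqrt (real T * real K * (\<tau> + Ttr) / (2 * real x)))\<rceil>)"

end

theory Submission
  imports Defs
begin

text \<open>
  Call an epoch undisturbed if the set of present players does not change during it; at most \<open>x\<close>
  epochs are disturbed. In an undisturbed epoch all players start hopping together. A hopping player
  finds a free arm with probability at least \<open>1 / K\<close> in each round, so after the first part of the
  learning phase all players hop sequentially without collisions except with small probability, and
  then sample every arm equally often. Since the rounds of these samples are functions of the uniform
  draws alone, Hoeffding's inequality applies conditionally on the draws and all players learn the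
  same correct order. Trekking then settles the \<open>N\<close> players on the \<open>N\<close> best arms within \<open>K\<^sup>2\<close> rounds, after
  which there is neither regret nor collision. Hence, with probability at least \<open>1 - \<delta>\<close>, only the
  \<open>(T / E + 1) (L + K\<^sup>2)\<close> initial rounds of the epochs and the \<open>x E\<close> rounds of disturbed epochs are
  lossy, each costing at most \<open>K\<close>, and the choice of \<open>E\<close> balances the two terms.
\<close>

subsection \<open>Balancing the epoch length\<close>

text \<open>The confidence \<open>\<delta> / T\<close> in the learning length pays for a union bound
  over the epochs, of which at most \<open>T\<close> start before the horizon. Within one epoch this
  budget is shared by at most \<open>K\<close> players, each of whom may fail to leave random
  hopping or may misjudge one of \<open>K\<close> arms. Only complete sweeps over the arms are
  counted as samples; the loss from an incomplete sweep is covered by the slack between the true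
  success rate \<open>1 / K\<close> of hopping and the rate \<open>1 / (4 K)\<close> built into
  \<open>T0\<close>.

  Waiting choices may depend on the whole sample point, rewards included, which could tie the
  sampling rounds to the rewards. In an undisturbed epoch everybody present restarted at its first
  round, so nobody waits; this is why a disturbed epoch is given up as a whole, and why learning is
  studied through \<open>hop_states\<close>, a copy of the dynamics driven by the draws alone.

  Once all orders agree and all arms differ, trekking is deterministic; invariants bound its
  duration by \<open>K * K\<close> for both variants. In the balance, \<open>T / E\<close> is at
  most \<open>sqrt (x T)\<close>, while \<open>x E\<close> carries the logarithm.\<close>

lemma T0_bounds:
  assumes "K > 1" "0 < \<delta>" "\<delta> < 1" "0 < \<epsilon>"
  shows "\<exists>a\<ge>0. \<forall>T::nat\<ge>2. T0 K \<epsilon> (\<delta> / real T) \<le> a * ln (real T) \<and> 1 \<le> T0 K \<epsilon> (\<delta> / real T)"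
proof -
  define l where "l = - ln (1 - 1 / (4 * real K))"
  define C where "C = 4 * (real K)\<^sup>2 / \<delta>"
  have K: "real K \<ge> 2" using assms by simp
  have l: "l > 0" unfolding l_def using K by (simp add: field_simps)
  have "1 * 1 \<le> real K * real K" using K by (intro mult_mono) auto
  hence "4 * (real K)\<^sup>2 \<ge> 1" by (simp add: power2_eq_square)
  hence C: "C > 1" unfolding C_def using assms K
    by (smt (verit) less_divide_eq_1_pos)
  have "2 * real K \<le> 4 * (real K)\<^sup>2"
    using mult_mono[of 1 "real K" "2 * real K" "4 * real K"] K by (simp add: power2_eq_square)
  hence C': "2 * real K / \<delta> \<le> C" "2 * real K / \<delta> > 1"
    unfolding C_def using K assms by (auto intro: divide_right_mono simp: less_divide_eq_1_pos)
  \<comment> \<open>Since \<open>ln T\<close> is at least \<open>ln 2\<close>, the constant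
    \<open>ln C\<close> is at most a multiple of \<open>ln T\<close>; \<open>b\<close> is chosen so
    that \<open>ln (C * T)\<close> is at most \<open>b * ln T\<close>.\<close>
  define b where "b = ln C / ln 2 + 1"
  have b: "b > 0" unfolding b_def using C by (simp add: add_pos_pos)
  \<comment> \<open>The summands pay for the ratio of logarithms, for the 1 lost in rounding it up,
    and for the sampling term.\<close>
  define a where "a = b / l + 1 / ln 2 + 2 * real K / \<epsilon>\<^sup>2 * b"
  have "a \<ge> 0" unfolding a_def using b l assms by (intro add_nonneg_nonneg) auto
  moreover have "T0 K \<epsilon> (\<delta> / real T) \<le> a * ln (real T)" "1 \<le> T0 K \<epsilon> (\<delta> / real T)" if T: "T \<ge> 2" for T :: nat
  proof -
    have lnT: "ln 2 \<le> ln (real T)" using T by simp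
    have pT: "ln (real T) > 0" using lnT T by simp
    have CT: "ln (C * real T) \<le> b * ln (real T)"
    proof -
      have "ln (C * real T) = ln C + ln (real T)" using C T by (simp add: ln_mult)
      also have "ln C \<le> ln C / ln 2 * ln (real T)" using C lnT by (simp add: field_simps)
      finally show ?thesis by (simp add: b_def algebra_simps)
    qed
    have e1: "ln (\<delta> / real T / (2 * real K)) = - ln (2 * real K / \<delta> * real T)"
      using assms T by (simp add: ln_div ln_mult)
    have "2 * real K / \<delta> * real T > 1"
      using mult_strict_mono[of 1 "2 * real K / \<delta>" 1 "real T"] C' T by simp
    hence g1: "ln (2 * real K / \<delta> * real T) > 0" by simp
    have "ln (2 * real K / \<delta> * real T) \<le> ln (C * real T)"
      using C' T C assms K by (intro ln_mono mult_right_mono) (auto simp: mult_pos_pos)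
    hence "ln (2 * real K / \<delta> * real T) / l \<le> b * ln (real T) / l"
      using CT l by (intro divide_right_mono) auto
    moreover have q: "ln (\<delta> / real T / (2 * real K)) / ln (1 - 1 / (4 * real K)) = ln (2 * real K / \<delta> * real T) / l"
      unfolding e1 l_def by simp
    moreover have "1 \<le> 1 / ln 2 * ln (real T)" using lnT by (simp add: field_simps)
    moreover have "real_of_int \<lceil>z\<rceil> \<le> z + 1" for z :: real by linarith
    ultimately have n: "real_of_int \<lceil>ln (\<delta> / real T / (2 * real K)) / ln (1 - 1 / (4 * real K))\<rceil> \<le> b / l * ln (real T) + 1 / ln 2 * ln (real T)"
      by (smt (verit) times_divide_eq_left)
    have e2: "4 * (real K)\<^sup>2 / (\<delta> / real T) = C * real T" unfolding C_def by simp
    have "2 * real K / \<epsilon>\<^sup>2 * ln (C * real T) \<le> 2 * real K / \<epsilon>\<^sup>2 * (b * ln (real T))"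
      using CT by (intro mult_left_mono) auto
    thus "T0 K \<epsilon> (\<delta> / real T) \<le> a * ln (real T)"
      using n unfolding T0_def e2 a_def by (simp add: algebra_simps)
    have "ln (2 * real K / \<delta> * real T) / l > 0" using g1 l by simp
    hence "1 \<le> \<lceil>ln (\<delta> / real T / (2 * real K)) / ln (1 - 1 / (4 * real K))\<rceil>" unfolding q by simp
    moreover have "C * real T > 1" using mult_strict_mono[of 1 C 1 "real T"] C T by simp
    ultimately show "1 \<le> T0 K \<epsilon> (\<delta> / real T)" unfolding T0_def e2
      by (smt (verit) ln_gt_zero mult_nonneg_nonneg divide_nonneg_nonneg of_nat_0_le_iff zero_le_power2 of_int_1_le_iff)
  qed
  ultimately show ?thesis by blast
qed

text \<open>With \<open>q = sqrt (x T)\<close>, \<open>r\<close> the unrounded epoch length and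
  \<open>H\<close> a multiple of \<open>ln T\<close> dominating \<open>\<tau> + 1 + S + Ttr\<close>,
  the number of epochs is at most \<open>2 * q\<close> and \<open>x * r\<close> is at most
  \<open>q * K * H\<close>. The trivial bound \<open>B \<le> T\<close> is kept as a hypothesis for
  the regime where \<open>x\<close> exceeds \<open>T\<close>.\<close>

lemma epoch_length_tradeoff:
  assumes "K > 1" "0 < \<delta>" "\<delta> < 1" "0 < \<epsilon>" "0 \<le> Ttr"
  shows "\<exists>c\<ge>0. \<forall>(T::nat) (x::nat) (B::real). T \<ge> 2 \<longrightarrow> x \<ge> 1 \<longrightarrow> B \<le> real T \<longrightarrow>
     B \<le> (real T / real (epoch_length K \<epsilon> \<delta> Ttr T x) + 1) * (real (learning_length K \<epsilon> \<delta> T) + real S)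
         + real x * real (epoch_length K \<epsilon> \<delta> Ttr T x) \<longrightarrow>
     B \<le> c * sqrt (real x * real T) * ln (real T)"
proof -
  obtain a where a: "a \<ge> 0" and aT: "\<And>T::nat. T \<ge> 2 \<Longrightarrow> T0 K \<epsilon> (\<delta> / real T) \<le> a * ln (real T)"
     "\<And>T::nat. T \<ge> 2 \<Longrightarrow> 1 \<le> T0 K \<epsilon> (\<delta> / real T)"
    using T0_bounds[OF assms(1-4)] by blast
  define h where "h = a + (1 + real S + Ttr) / ln 2"
  have "h \<ge> 0" using a assms unfolding h_def by auto
  have "B \<le> (real K + 3) * h * sqrt (real x * real T) * ln (real T)"
    if T: "T \<ge> 2" and x: "x \<ge> 1" and BT: "B \<le> real T" and B: "B \<le> (real T / real (epoch_length K \<epsilon> \<delta> Ttr T x) + 1) * (real (learning_length K \<epsilon> \<delta> T) + real S)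
         + real x * real (epoch_length K \<epsilon> \<delta> Ttr T x)"
    for T x :: nat and B :: real
  proof -
    define \<tau> where "\<tau> = T0 K \<epsilon> (\<delta> / real T)"
    define H where "H = h * ln (real T)"
    define q where "q = sqrt (real x * real T)"
    define E where "E = epoch_length K \<epsilon> \<delta> Ttr T x"
    define L where "L = learning_length K \<epsilon> \<delta> T"
    define r where "r = sqrt (real T * real K * (\<tau> + Ttr) / (2 * real x))"
    have K: "real K \<ge> 2" using assms by simp
    have \<tau>: "1 \<le> \<tau>" "\<tau> \<le> a * ln (real T)" using aT[OF T] unfolding \<tau>_def by auto
    have lnT: "ln 2 \<le> ln (real T)" using T by simp
    have "1 + real S + Ttr \<le> (1 + real S + Ttr) / ln 2 * ln (real T)"
      using mult_left_mono[OF lnT, of "1 + real S + Ttr"] assms by (simp add: pos_le_divide_eq)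
    hence H: "\<tau> + 1 + S + Ttr \<le> H" unfolding H_def h_def using \<tau> by (simp add: algebra_simps)
    hence H1: "1 \<le> H" using \<tau> assms by simp
    have "1 * 1 \<le> real x * real T" using x T by (intro mult_mono) auto
    hence q: "1 \<le> q" unfolding q_def by simp
    have E: "real E \<ge> r" "real E \<le> \<tau> + 1 + r" "real E \<ge> 1"
    proof -
      have "r \<ge> 0" unfolding r_def using \<tau> assms by simp
      have e: "E = nat \<lceil>max \<tau> r\<rceil>" unfolding E_def epoch_length_def r_def \<tau>_def by (simp add: Let_def)
      show "real E \<ge> r" "real E \<le> \<tau> + 1 + r" "real E \<ge> 1" unfolding e using \<tau> \<open>r \<ge> 0\<close> by linarith+
    qed
    have L: "real L \<le> \<tau> + 1" unfolding L_def learning_length_def using \<tau> unfolding \<tau>_def by linarith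
    have r0: "r > 0" unfolding r_def using \<tau> assms T x by simp
    \<comment> \<open>Squared, this says that \<open>K * (\<tau> + Ttr) / 2\<close> is at least 1,
      which follows from \<open>K \<ge> 2\<close> and \<open>\<tau> \<ge> 1\<close>.\<close>
    have rq: "real T \<le> q * r"
    proof -
      have "2 * 1 \<le> real K * (\<tau> + Ttr)" using K \<tau> assms by (intro mult_mono) auto
      hence "real T * real T * 1 \<le> real T * real T * (real K * (\<tau> + Ttr) / 2)" by (intro mult_left_mono) auto
      also have "\<dots> = (real x * real T) * (real T * real K * (\<tau> + Ttr) / (2 * real x))" using x by simp
      finally have "sqrt (real T * real T * 1) \<le> sqrt ((real x * real T) * (real T * real K * (\<tau> + Ttr) / (2 * real x)))"
        by (rule real_sqrt_le_mono)
      thus ?thesis unfolding q_def r_def real_sqrt_mult[symmetric] by (simp only: mult_1_right real_sqrt_abs2 abs_of_nat)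
    qed
    have "real T / real E \<le> real T / r" using E r0 by (intro divide_left_mono) auto
    also have "\<dots> \<le> q" using rq r0 by (simp add: field_simps)
    finally have TE: "real T / real E + 1 \<le> 2 * q" using q by simp
    \<comment> \<open>The root of \<open>K * (\<tau> + Ttr) / 2\<close> is bounded by
      \<open>K * H\<close> itself: as \<open>K * H\<close> is at least 1, squaring it only
      helps.\<close>
    have xr: "real x * r \<le> q * (real K * H)"
    proof -
      have "(\<tau> + Ttr) / 2 \<le> H" using H \<tau> assms by simp
      hence "real K * ((\<tau> + Ttr) / 2) \<le> real K * H" by (intro mult_left_mono) auto
      hence "real K * (\<tau> + Ttr) / 2 \<le> real K * H" by simp
      also have "real K * H = real K * H * 1" by simp
      also have "\<dots> \<le> real K * H * (real K * H)"
        using K H1 mult_mono[of 1 "real K" 1 H] by (intro mult_left_mono) auto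
      finally have 1: "real K * (\<tau> + Ttr) / 2 \<le> (real K * H)\<^sup>2" by (simp add: power2_eq_square)
      have "real x * r = sqrt ((real x)\<^sup>2) * r" by simp
      also have "\<dots> = sqrt ((real x)\<^sup>2 * (real T * real K * (\<tau> + Ttr) / (2 * real x)))"
        unfolding r_def by (simp only: real_sqrt_mult)
      also have "(real x)\<^sup>2 * (real T * real K * (\<tau> + Ttr) / (2 * real x)) = (real x * real T) * (real K * (\<tau> + Ttr) / 2)"
        using x by (simp add: power2_eq_square)
      also have "sqrt \<dots> \<le> sqrt ((real x * real T) * (real K * H)\<^sup>2)"
        using 1 by (intro real_sqrt_le_mono mult_left_mono) auto
      also have "\<dots> = q * (real K * H)" unfolding q_def using H1 by (simp add: real_sqrt_mult)
      finally show ?thesis .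
    qed
    \<comment> \<open>For \<open>x \<le> T\<close> one has \<open>x \<le> q\<close>, which controls
      the part \<open>\<tau> + 1\<close> of \<open>E\<close>; the terms \<open>2 q H\<close>,
      \<open>q H\<close> and \<open>q K H\<close> add up to the factor \<open>K + 3\<close>. For
      \<open>x > T\<close> already \<open>T \<le> q\<close>.\<close>
    have Bq: "B \<le> (real K + 3) * H * q"
    proof (cases "x \<le> T")
      case True
      have "real x * real x \<le> real x * real T" using True by (intro mult_left_mono) auto
      hence "sqrt (real x * real x) \<le> sqrt (real x * real T)" by (intro real_sqrt_le_mono)
      hence xq: "real x \<le> q" unfolding q_def by simp
      have "(real T / real E + 1) * (real L + real S) \<le> 2 * q * H"
        using TE L H q assms by (intro mult_mono) auto
      moreover have "real x * real E \<le> real x * (H + r)"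
        using E H assms by (intro mult_left_mono) auto
      moreover have "real x * H \<le> q * H" using xq H1 by (intro mult_right_mono) auto
      ultimately show ?thesis using B xr unfolding E_def L_def by (simp add: algebra_simps)
    next
      case False
      hence "real T * real T \<le> real x * real T" by (intro mult_right_mono) auto
      hence "sqrt (real T * real T) \<le> sqrt (real x * real T)" by (intro real_sqrt_le_mono)
      hence "B \<le> 1 * q" using BT unfolding q_def by simp
      also have "1 * q \<le> ((real K + 3) * H) * q"
        using K H1 q mult_mono[of 1 "real K + 3" 1 H] by (intro mult_right_mono) auto
      finally show ?thesis .
    qed
    thus ?thesis unfolding H_def q_def by (simp add: mult_ac)
  qed
  thus ?thesis using \<open>h \<ge> 0\<close> by (intro exI[of _ "(real K + 3) * h"]) auto
qed

section \<open>Counting disturbed epochs and potentially lossy rounds\<close>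

context dynamic_trekking
begin

text \<open>Both rounds must lie in the same epoch: a change across an epoch boundary is harmless,
  because everybody present then restarts.\<close>

definition changing_epochs :: "nat \<Rightarrow> nat set" where
  "changing_epochs T = {e. \<exists>t. t div E = e \<and> Suc t div E = e \<and> Suc t < T \<and> present t \<noteq> present (Suc t)}"

text \<open>A disturbed epoch is charged to a player whose arrival or departure falls into it.
  Finiteness of the sets of entries and departures has to come first, as \<open>card\<close> is 0 on
  infinite sets; it holds because each such player is present in some round before
  \<open>T\<close>.\<close>

lemma card_changing_epochs:
  assumes fin: "\<And>t. t < T \<Longrightarrow> finite (present t)"
    and le: "card (entries T) + card (departures T) \<le> x"
  shows "finite (changing_epochs T)" "card (changing_epochs T) \<le> x"
proof -
  have "entries T \<union> departures T \<subseteq> (\<Union>t<T. present t)"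
    unfolding entries_def departures_def present_def by force
  hence f: "finite (entries T)" "finite (departures T)"
    using fin finite_subset by (metis Un_subset_iff finite_UN finite_lessThan lessThan_iff)+
  have sub: "changing_epochs T \<subseteq> (\<lambda>j. arr j div E) ` entries T \<union> (\<lambda>j. dep j div E) ` departures T"
  proof
    fix e assume "e \<in> changing_epochs T"
    then obtain t j where t: "Suc t div E = e" "Suc t < T" and j: "j \<in> present t \<longleftrightarrow> j \<notin> present (Suc t)"
      unfolding changing_epochs_def by blast
    show "e \<in> (\<lambda>j. arr j div E) ` entries T \<union> (\<lambda>j. dep j div E) ` departures T"
    proof (cases "j \<in> present t")
      case True
      with j have "dep j = Suc t" "arr j < dep j" unfolding present_def by auto
      thus ?thesis using t unfolding departures_def by (intro UnI2 image_eqI[of _ _ j]) auto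
    next
      case False
      with j have "arr j = Suc t" "arr j < dep j" unfolding present_def by auto
      thus ?thesis using t unfolding entries_def by (intro UnI1 image_eqI[of _ _ j]) auto
    qed
  qed
  show "finite (changing_epochs T)" using sub f by (meson finite_UnI finite_imageI finite_subset)
  have "card (changing_epochs T) \<le> card ((\<lambda>j. arr j div E) ` entries T \<union> (\<lambda>j. dep j div E) ` departures T)"
    using sub f by (intro card_mono) auto
  also have "\<dots> \<le> card ((\<lambda>j. arr j div E) ` entries T) + card ((\<lambda>j. dep j div E) ` departures T)"
    by (rule card_Un_le)
  also have "\<dots> \<le> x" using card_image_le[OF f(1)] card_image_le[OF f(2)] le by (meson add_mono order_trans)
  finally show "card (changing_epochs T) \<le> x" .
qed

lemma present_const:
  assumes "e \<notin> changing_epochs T" "e * E + s < T" "s < E"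
  shows "present (e * E + s) = present (e * E)"
  using assms(2,3)
proof (induction s)
  case (Suc s)
  have "present (e * E + s) = present (Suc (e * E + s))"
  proof (rule ccontr)
    assume "\<not> ?thesis"
    moreover have "(e * E + s) div E = e" "Suc (e * E + s) div E = e"
      using Suc.prems by (auto simp: div_nat_eqI)
    ultimately show False using assms(1) Suc.prems unfolding changing_epochs_def by auto
  qed
  with Suc show ?case by simp
qed simp

definition unsettled_rounds :: "nat \<Rightarrow> nat \<Rightarrow> nat set" where
  "unsettled_rounds S T = {t. t < T \<and> (t mod E < L + S \<or> t div E \<in> changing_epochs T)}"

text \<open>Quotient and remainder by \<open>E\<close> embed these rounds into two rectangles. The
  summand 1 next to \<open>T / E\<close> is the last, possibly incomplete, epoch.\<close>

lemma card_unsettled_rounds: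
  assumes "E > 0" "finite (changing_epochs T)" "card (changing_epochs T) \<le> x"
  shows "real (card (unsettled_rounds S T)) \<le> (real T / real E + 1) * (real L + real S) + real x * real E"
proof -
  let ?f = "\<lambda>t. (t div E, t mod E)"
  have inj: "inj ?f" by (rule injI) (metis div_mult_mod_eq prod.inject)
  have sub: "?f ` unsettled_rounds S T \<subseteq> {..T div E} \<times> {..<L + S} \<union> changing_epochs T \<times> {..<E}"
  proof (rule image_subsetI)
    fix t assume t: "t \<in> unsettled_rounds S T"
    hence "t div E \<le> T div E" unfolding unsettled_rounds_def by (simp add: div_le_mono)
    thus "?f t \<in> {..T div E} \<times> {..<L + S} \<union> changing_epochs T \<times> {..<E}"
      using t assms(1) unfolding unsettled_rounds_def by auto
  qed
  have "card (unsettled_rounds S T) = card (?f ` unsettled_rounds S T)"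
    by (rule card_image[symmetric, OF inj_on_subset[OF inj subset_UNIV]])
  also have "\<dots> \<le> card ({..T div E} \<times> {..<L + S} \<union> changing_epochs T \<times> {..<E})"
    using sub assms by (intro card_mono) auto
  also have "\<dots> \<le> (T div E + 1) * (L + S) + card (changing_epochs T) * E"
    by (rule order_trans[OF card_Un_le]) (simp only: card_cartesian_product card_atMost card_lessThan Suc_eq_plus1)
  also have "\<dots> \<le> (T div E + 1) * (L + S) + x * E"
    using assms by simp
  finally have "real (card (unsettled_rounds S T)) \<le> real ((T div E + 1) * (L + S) + x * E)"
    by linarith
  also have "\<dots> = (real (T div E) + 1) * (real L + real S) + real x * real E" by (simp only: of_nat_add of_nat_mult of_nat_1)
  also have "\<dots> \<le> (real T / real E + 1) * (real L + real S) + real x * real E"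
    by (intro add_mono mult_right_mono) (auto simp: of_nat_div_le_of_nat)
  finally show ?thesis .
qed

end

subsection \<open>Measurability\<close>

text \<open>With countably many states, arms and flags, a function of several random ones is
  measurable as soon as it is so with these arguments frozen; the measurability proofs freeze them
  one at a time.\<close>

instance local_state :: countable
  by countable_datatype

abbreviation draw_space :: "nat \<Rightarrow> (nat \<times> nat \<Rightarrow> nat) measure" where
  "draw_space K \<equiv> \<Pi>\<^sub>M jt\<in>UNIV. measure_pmf (pmf_of_set {1..K})"

abbreviation reward_space :: "nat \<Rightarrow> (nat \<Rightarrow> real measure) \<Rightarrow> (nat \<times> nat \<times> nat \<Rightarrow> real) measure" where
  "reward_space K D \<equiv> \<Pi>\<^sub>M (j, t, k)\<in>UNIV \<times> UNIV \<times> {1..K}. D k"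

lemma measurable_draw: "(\<lambda>u. u jt) \<in> draw_space K \<rightarrow>\<^sub>M count_space UNIV"
proof -
  have "(\<lambda>u. u jt) \<in> draw_space K \<rightarrow>\<^sub>M measure_pmf (pmf_of_set {1..K})"
    by (rule measurable_component_singleton) simp
  thus ?thesis by (simp cong: measurable_cong_sets)
qed

lemma measurable_reward:
  assumes "reward_laws K D"
  shows "(\<lambda>X. X (j, t, k)) \<in> borel_measurable (reward_space K D)"
proof (cases "k \<in> {1..K}")
  case True
  have "(\<lambda>X. X (j, t, k)) \<in> reward_space K D \<rightarrow>\<^sub>M (\<lambda>(j, t, k). D k) (j, t, k)"
    using True by (intro measurable_component_singleton) auto
  hence "(\<lambda>X. X (j, t, k)) \<in> reward_space K D \<rightarrow>\<^sub>M D k" by simp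
  moreover have "sets (D k) = sets borel" using assms True unfolding reward_laws_def by blast
  ultimately show ?thesis by (simp cong: measurable_cong_sets)
next
  case False
  \<comment> \<open>Points of the product space are extensional, so a coordinate outside the index
    set is constant.\<close>
  have "X (j, t, k) = undefined" if "X \<in> space (reward_space K D)" for X
    using PiE_arb[OF that[unfolded space_PiM], of "(j, t, k)"] False by simp
  hence "(\<lambda>X. X (j, t, k)) \<in> borel_measurable (reward_space K D) \<longleftrightarrow> (\<lambda>X. undefined :: real) \<in> borel_measurable (reward_space K D)"
    by (intro measurable_cong)
  thus ?thesis by simp
qed

text \<open>Insertion sort looks at the real keys only through comparisons of two of them, and its
  partial results range over a countable type.\<close>

lemma measurable_sort_key:
  fixes f :: "'a \<Rightarrow> 'b::countable \<Rightarrow> real"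
  assumes "\<And>k. (\<lambda>x. f x k) \<in> borel_measurable M"
  shows "(\<lambda>x. sort_key (f x) ks) \<in> M \<rightarrow>\<^sub>M count_space UNIV"
proof (induction ks)
  case (Cons k ks)
  have "(\<lambda>x. insort_key (f x) k l) \<in> M \<rightarrow>\<^sub>M count_space UNIV" for l
  proof (induction l)
    case (Cons y ys)
    have "(\<lambda>x. y # insort_key (f x) k ys) \<in> M \<rightarrow>\<^sub>M count_space UNIV"
      using Cons by (rule measurable_compose) simp
    moreover have "Measurable.pred M (\<lambda>x. f x k \<le> f x y)"
      using assms[of k] assms[of y] by measurable
    ultimately show ?case by simp
  qed simp
  from measurable_compose_countable[OF this Cons] show ?case by simp
qed simp

lemma measurable_empirical_mean:
  assumes "\<And>s k. (\<lambda>x. X x s k) \<in> borel_measurable M"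
  shows "(\<lambda>x. empirical_mean (X x) h k) \<in> borel_measurable M"
proof -
  have "(\<lambda>x. \<Sum>t\<leftarrow>ts. X x t k) \<in> borel_measurable M" for ts
    using assms by (induction ts) auto
  thus ?thesis unfolding empirical_mean_def Let_def by (intro borel_measurable_divide) auto
qed

lemma measurable_finish_learning:
  assumes "\<And>s k. (\<lambda>x. X x s k) \<in> borel_measurable M"
  shows "(\<lambda>x. finish_learning K V (X x) a q) \<in> M \<rightarrow>\<^sub>M count_space UNIV"
proof -
  have "(\<lambda>x. start_trek K V (empirical_order K (empirical_mean (X x) h)) a) \<in> M \<rightarrow>\<^sub>M count_space UNIV" for h
  proof -
    have "(\<lambda>x. empirical_order K (empirical_mean (X x) h)) \<in> M \<rightarrow>\<^sub>M count_space UNIV"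
      unfolding empirical_order_def
      using measurable_empirical_mean[OF assms] by (intro measurable_sort_key) auto
    thus ?thesis by (rule measurable_compose) simp
  qed
  thus ?thesis by (cases q) auto
qed

lemma measurable_collides:
  assumes "\<And>i. (\<lambda>x. I x i) \<in> M \<rightarrow>\<^sub>M count_space UNIV"
  shows "Measurable.pred M (\<lambda>x. dynamic_trekking.collides (I x) j)"
proof -
  have 1: "Measurable.pred M (\<lambda>x. P (I x i))" for i P
    using assms by (rule measurable_compose) simp
  have "Measurable.pred M (\<lambda>x. I x i = I x j)" for i
    by (rule measurable_compose_countable[where g = "\<lambda>x. I x j" and f = "\<lambda>a x. I x i = a"]) (rule 1, rule assms)
  thus ?thesis unfolding dynamic_trekking.collides_def using 1[of "\<lambda>a. a \<noteq> None" j] by simp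
qed

text \<open>The plays of one round with the present players, draws and waiting choices as explicit
  arguments, so that learning and trekking can be analysed for a fixed set \<open>P\<close> without
  the locale.\<close>

definition plays :: "nat \<Rightarrow> nat set \<Rightarrow> (nat \<Rightarrow> nat) \<Rightarrow> (nat \<Rightarrow> nat option) \<Rightarrow> (nat \<Rightarrow> local_state) \<Rightarrow> nat \<Rightarrow> nat option" where
  "plays K P u w q j = (if j \<in> P then select_arm K (u j) (w j) (q j) else None)"

context dynamic_trekking
begin

context
  fixes D :: "nat \<Rightarrow> real measure"
  assumes D: "reward_laws K D" and W: "admissible_waiting D"
begin

lemma measurable_play:
  assumes "(\<lambda>\<omega>. q \<omega> j) \<in> sample_space K D \<rightarrow>\<^sub>M count_space UNIV"
  shows "(\<lambda>\<omega>. play \<omega> t (q \<omega>) j) \<in> sample_space K D \<rightarrow>\<^sub>M count_space UNIV"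
proof -
  have u: "(\<lambda>\<omega>. fst \<omega> (j, t)) \<in> sample_space K D \<rightarrow>\<^sub>M count_space UNIV"
    unfolding sample_space_def by (rule measurable_compose[OF measurable_fst measurable_draw])
  have w: "W j t \<in> sample_space K D \<rightarrow>\<^sub>M count_space UNIV" using W unfolding admissible_waiting_def by blast
  have "(\<lambda>\<omega>. select_arm K (fst \<omega> (j, t)) (W j t \<omega>) (q \<omega> j)) \<in> sample_space K D \<rightarrow>\<^sub>M count_space UNIV"
  proof (rule measurable_compose_countable[OF _ u])
    fix a
    show "(\<lambda>\<omega>. select_arm K a (W j t \<omega>) (q \<omega> j)) \<in> sample_space K D \<rightarrow>\<^sub>M count_space UNIV"
    proof (rule measurable_compose_countable[OF _ w])
      show "(\<lambda>\<omega>. select_arm K a b (q \<omega> j)) \<in> sample_space K D \<rightarrow>\<^sub>M count_space UNIV" for b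
        using assms by (rule measurable_compose) simp
    qed
  qed
  thus ?thesis unfolding play_def by simp
qed

lemma measurable_step:
  assumes q: "\<And>j. (\<lambda>\<omega>. q \<omega> j) \<in> sample_space K D \<rightarrow>\<^sub>M count_space UNIV"
  shows "(\<lambda>\<omega>. step \<omega> t (q \<omega>) j) \<in> sample_space K D \<rightarrow>\<^sub>M count_space UNIV"
proof -
  let ?M = "sample_space K D"
  \<comment> \<open>The body of \<open>step\<close> with the play, the collision flag and the old
    state as separate discrete arguments; once these are frozen, only the rewards remain
    random.\<close>
  let ?F = "\<lambda>I c s \<omega>. case I of None \<Rightarrow> s | Some a \<Rightarrow>
    (let q' = observe K t a c s in if t mod E = L - 1 then finish_learning K V (\<lambda>s k. snd \<omega> (j, s, k)) a q' else q')"
  have p: "(\<lambda>\<omega>. play \<omega> t (q \<omega>) i) \<in> ?M \<rightarrow>\<^sub>M count_space UNIV" for i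
    by (rule measurable_play[OF q])
  have X: "(\<lambda>\<omega>. snd \<omega> (j, s, k)) \<in> borel_measurable ?M" for s k
    unfolding sample_space_def by (rule measurable_compose[OF measurable_snd measurable_reward[OF D]])
  have F: "(\<lambda>\<omega>. ?F I c s \<omega>) \<in> ?M \<rightarrow>\<^sub>M count_space UNIV" for I c s
    using measurable_finish_learning[where X = "\<lambda>\<omega> s k. snd \<omega> (j, s, k)", OF X]
    by (cases I) (simp_all add: Let_def)
  have "(\<lambda>\<omega>. ?F (play \<omega> t (q \<omega>) j) (collides (play \<omega> t (q \<omega>)) j) (q \<omega> j) \<omega>) \<in> ?M \<rightarrow>\<^sub>M count_space UNIV"
  proof (rule measurable_compose_countable[where g = "\<lambda>\<omega>. play \<omega> t (q \<omega>) j", OF _ p])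
    fix I
    show "(\<lambda>\<omega>. ?F I (collides (play \<omega> t (q \<omega>)) j) (q \<omega> j) \<omega>) \<in> ?M \<rightarrow>\<^sub>M count_space UNIV"
    proof (rule measurable_compose_countable[where g = "\<lambda>\<omega>. collides (play \<omega> t (q \<omega>)) j", OF _ measurable_collides[OF p]])
      fix c
      show "(\<lambda>\<omega>. ?F I c (q \<omega> j) \<omega>) \<in> ?M \<rightarrow>\<^sub>M count_space UNIV"
        by (rule measurable_compose_countable[where g = "\<lambda>\<omega>. q \<omega> j", OF F q])
    qed
  qed
  thus ?thesis unfolding step_def .
qed

lemma measurable_states: "(\<lambda>\<omega>. states \<omega> t j) \<in> sample_space K D \<rightarrow>\<^sub>M count_space UNIV"
proof (induction t arbitrary: j)
  case (Suc t)
  show ?case using measurable_step[where q = "\<lambda>\<omega>. states \<omega> t", OF Suc, of t j] by simp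
qed simp

lemma measurable_arm_played: "(\<lambda>\<omega>. arm_played \<omega> t j) \<in> sample_space K D \<rightarrow>\<^sub>M count_space UNIV"
  unfolding arm_played_def by (rule measurable_play[where q = "\<lambda>\<omega>. states \<omega> t", OF measurable_states])

lemma measurable_collision: "(\<lambda>\<omega>. collision \<omega> t j) \<in> sample_space K D \<rightarrow>\<^sub>M count_space UNIV"
  unfolding collision_def
  by (rule measurable_compose[OF measurable_collides[OF measurable_arm_played]]) simp

lemma measurable_regret: "regret \<mu> \<sigma> T \<in> borel_measurable (sample_space K D)"
proof -
  have "(\<lambda>\<omega>. case arm_played \<omega> t j of None \<Rightarrow> 0 | Some a \<Rightarrow> \<mu> a * (1 - real (collision \<omega> t j)))
    \<in> borel_measurable (sample_space K D)" for t j
  proof (rule measurable_compose_countable[OF _ measurable_arm_played])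
    fix I
    show "(\<lambda>\<omega>. case I of None \<Rightarrow> 0 | Some a \<Rightarrow> \<mu> a * (1 - real (collision \<omega> t j)))
      \<in> borel_measurable (sample_space K D)"
      by (rule measurable_compose[OF measurable_collision]) simp
  qed
  thus ?thesis unfolding regret_def by (intro borel_measurable_diff borel_measurable_sum) auto
qed

lemma measurable_collisions: "(\<lambda>\<omega>. real (collisions T \<omega>)) \<in> borel_measurable (sample_space K D)"
proof -
  have "(\<lambda>\<omega>. real (collision \<omega> t j)) \<in> borel_measurable (sample_space K D)" for t j
    by (rule measurable_compose[OF measurable_collision]) simp
  thus ?thesis unfolding collisions_def of_nat_sum by (intro borel_measurable_sum)
qed

end

end

subsection \<open>The learning phase\<close>

text \<open>Learning of a fixed set \<open>P\<close> from round \<open>t0\<close> on, as a function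
  of the draws \<open>u\<close> only. The states of players outside \<open>P\<close> are meaningless
  (they arise from \<open>the None\<close>), so later facts about arms and collisions concern
  members of \<open>P\<close>.\<close>

primrec hop_states :: "nat \<Rightarrow> nat set \<Rightarrow> nat \<Rightarrow> (nat \<times> nat \<Rightarrow> nat) \<Rightarrow> nat \<Rightarrow> nat \<Rightarrow> local_state" where
  "hop_states K P t0 u 0 = (\<lambda>j. Hop_Random)"
| "hop_states K P t0 u (Suc s) =
    (let I = plays K P (\<lambda>j. u (j, t0 + s)) (\<lambda>_. None) (hop_states K P t0 u s)
     in (\<lambda>j. observe K (t0 + s) (the (I j)) (dynamic_trekking.collides I j) (hop_states K P t0 u s j)))"

definition hop_plays :: "nat \<Rightarrow> nat set \<Rightarrow> nat \<Rightarrow> (nat \<times> nat \<Rightarrow> nat) \<Rightarrow> nat \<Rightarrow> nat \<Rightarrow> nat option" where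
  "hop_plays K P t0 u s = plays K P (\<lambda>j. u (j, t0 + s)) (\<lambda>_. None) (hop_states K P t0 u s)"

lemma hop_states_Suc:
  "hop_states K P t0 u (Suc s) j =
     observe K (t0 + s) (the (hop_plays K P t0 u s j)) (dynamic_trekking.collides (hop_plays K P t0 u s) j)
       (hop_states K P t0 u s j)"
  by (simp add: hop_plays_def Let_def)

declare hop_states.simps(2) [simp del]

lemma hop_states_cases:
  obtains (random) "hop_states K P t0 u s j = Hop_Random"
    | (seq) a h where "hop_states K P t0 u s j = Hop_Seq a h"
proof -
  have "hop_states K P t0 u s j = Hop_Random \<or> (\<exists>a h. hop_states K P t0 u s j = Hop_Seq a h)"
    by (induction s) (auto simp: hop_states_Suc split: if_split_asm)
  thus ?thesis using that by blast
qed

lemma hop_plays_eq: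
  assumes "j \<in> P"
  shows "hop_plays K P t0 u s j = Some (case hop_states K P t0 u s j of Hop_Seq a h \<Rightarrow> a mod K + 1 | _ \<Rightarrow> u (j, t0 + s))"
  using assms by (cases K P t0 u s j rule: hop_states_cases) (auto simp: hop_plays_def plays_def)

lemma hop_plays_outside: "j \<notin> P \<Longrightarrow> hop_plays K P t0 u s j = None"
  by (simp add: hop_plays_def plays_def)

lemma hop_states_seq_Suc:
  assumes "j \<in> P" "hop_states K P t0 u s j = Hop_Seq a h"
  shows "hop_states K P t0 u (Suc s) j = Hop_Seq (a mod K + 1)
     (if dynamic_trekking.collides (hop_plays K P t0 u s) j then h else (t0 + s, a mod K + 1) # h)"
  using assms by (simp add: hop_states_Suc hop_plays_eq)

lemma hop_states_last_arm:
  assumes "j \<in> P" "hop_states K P t0 u (Suc s) j = Hop_Seq a h"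
  shows "hop_plays K P t0 u s j = Some a"
  using assms by (cases K P t0 u s j rule: hop_states_cases)
    (auto simp: hop_states_Suc hop_plays_eq split: if_splits)

lemma hop_arm_range:
  assumes "K > 0" "\<And>jt. u jt \<in> {1..K}" "j \<in> P" "hop_states K P t0 u s j = Hop_Seq a h"
  shows "a \<in> {1..K}"
proof (cases s)
  case (Suc s')
  hence "hop_plays K P t0 u s' j = Some a" using hop_states_last_arm assms by blast
  moreover have "b mod K + 1 \<in> {1..K}" for b using assms(1) by (simp add: Suc_le_eq)
  ultimately show ?thesis using assms(2)[of "(j, t0 + s')"] hop_plays_eq[OF assms(3), of K t0 u s']
    by (auto split: local_state.splits)
qed (use assms in simp)

text \<open>A player turns sequential only through a collision-free play, hence on an arm that no
  other player of \<open>P\<close> occupies. From then on sequential players all shift by one modulo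
  \<open>K\<close>, which is injective on the arms. They may still be hit by random hoppers, but
  never by each other.\<close>

lemma hop_arms_distinct:
  assumes K: "K > 0" and u: "\<And>jt. u jt \<in> {1..K}" and jl: "j \<in> P" "l \<in> P" "j \<noteq> l"
    and "hop_states K P t0 u s j = Hop_Seq a h" "hop_states K P t0 u s l = Hop_Seq b h'"
  shows "a \<noteq> b"
  using assms(6,7)
proof (induction s arbitrary: a h b h')
  case (Suc s)
  let ?I = "hop_plays K P t0 u s"
  have I: "?I j = Some a" "?I l = Some b" using hop_states_last_arm jl Suc.prems by blast+
  have col: "dynamic_trekking.collides ?I j \<and> dynamic_trekking.collides ?I l" if "a = b"
    using that I jl unfolding dynamic_trekking.collides_def by auto
  show ?case
  proof (cases K P t0 u s j rule: hop_states_cases)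
    case random
    thus ?thesis using Suc.prems(1) col by (auto simp: hop_states_Suc)
  next
    case j: (seq a0 h0)
    show ?thesis
    proof (cases K P t0 u s l rule: hop_states_cases)
      case random
      thus ?thesis using Suc.prems(2) col by (auto simp: hop_states_Suc)
    next
      case l: (seq b0 h1)
      have "a0 \<noteq> b0" by (rule Suc.IH[OF j l])
      moreover have "a0 \<in> {1..K}" "b0 \<in> {1..K}"
        using hop_arm_range[OF K u jl(1) j] hop_arm_range[OF K u jl(2) l] by auto
      ultimately have "a0 mod K \<noteq> b0 mod K"
        by (metis K atLeastAtMost_iff le_neq_implies_less mod_less mod_self not_one_le_zero)
      thus ?thesis using hop_states_seq_Suc[OF jl(1) j] hop_states_seq_Suc[OF jl(2) l] Suc.prems by auto
    qed
  qed
qed simp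

definition hop_history :: "local_state \<Rightarrow> (nat \<times> nat) list" where
  "hop_history q = (case q of Hop_Seq a h \<Rightarrow> h | _ \<Rightarrow> [])"

text \<open>Distinct rounds make the samples distinct coordinates of the reward space, as
  independence requires.\<close>

lemma hop_history_times:
  "distinct (map fst (hop_history (hop_states K P t0 u s j))) \<and> fst ` set (hop_history (hop_states K P t0 u s j)) \<subseteq> {..<t0 + s}"
proof (induction s)
  case (Suc s)
  show ?case
  proof (cases K P t0 u s j rule: hop_states_cases)
    case random
    thus ?thesis by (simp add: hop_states_Suc hop_history_def)
  next
    case (seq a h)
    hence "distinct (map fst h)" "\<forall>x\<in>set h. fst x < t0 + s" using Suc.IH by (auto simp: hop_history_def)
    thus ?thesis using seq by (auto simp: hop_states_Suc hop_history_def)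
  qed
qed (simp add: hop_history_def)

definition sample_times :: "(nat \<times> nat) list \<Rightarrow> nat \<Rightarrow> nat list" where
  "sample_times h k = [t. (t, a) \<leftarrow> h, a = k]"

lemma set_sample_times: "set (sample_times h k) = {t. (t, k) \<in> set h}"
  by (induction h) (auto simp: sample_times_def)

lemma distinct_sample_times: "distinct (map fst h) \<Longrightarrow> distinct (sample_times h k)"
proof (induction h)
  case (Cons p h)
  have "set (sample_times h k) \<subseteq> fst ` set h" by (force simp: set_sample_times)
  moreover have "sample_times (p # h) k = (if snd p = k then [fst p] else []) @ sample_times h k"
    by (auto simp: sample_times_def split: prod.splits)
  ultimately show ?case using Cons by auto
qed (simp add: sample_times_def)

text \<open>Two colliding sequential players would be sequential on the same arm one round later,
  contrary to \<open>hop_arms_distinct\<close>.\<close>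

lemma hop_no_collision:
  assumes K: "K > 0" and u: "\<And>jt. u jt \<in> {1..K}"
    and n: "\<forall>l\<in>P. hop_states K P t0 u s l \<noteq> Hop_Random" and j: "j \<in> P"
  shows "\<not> dynamic_trekking.collides (hop_plays K P t0 u s) j"
proof
  assume "dynamic_trekking.collides (hop_plays K P t0 u s) j"
  then obtain l where l: "l \<noteq> j" "hop_plays K P t0 u s l = hop_plays K P t0 u s j"
    unfolding dynamic_trekking.collides_def by auto
  hence lP: "l \<in> P" using hop_plays_outside[of l P] hop_plays_eq[OF j] by force
  obtain a h b h' where ab: "hop_states K P t0 u s j = Hop_Seq a h" "hop_states K P t0 u s l = Hop_Seq b h'"
    using n j lP by (metis hop_states_cases)
  have "a mod K + 1 = b mod K + 1" using l(2) hop_plays_eq[OF j] hop_plays_eq[OF lP] ab by simp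
  moreover have "a mod K + 1 \<noteq> b mod K + 1"
    using hop_arms_distinct[OF K u j lP l(1)[symmetric] hop_states_seq_Suc[OF j ab(1)] hop_states_seq_Suc[OF lP ab(2)]] .
  ultimately show False by simp
qed

text \<open>Without random hoppers every play is collision-free and therefore recorded, so the
  trajectory has a closed form. The condition \<open>a \<ge> 1\<close> keeps the truncated
  subtraction in \<open>a + r - 1\<close> exact for \<open>r = 0\<close>.\<close>

lemma hop_states_cyclic:
  assumes K: "K > 0" and u: "\<And>jt. u jt \<in> {1..K}"
    and n: "\<forall>l\<in>P. hop_states K P t0 u n l \<noteq> Hop_Random" and j: "j \<in> P"
  shows "\<exists>a\<ge>1. \<exists>h. hop_states K P t0 u (n + r) j = Hop_Seq ((a + r - 1) mod K + 1) h \<and>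
     (\<forall>i<r. (t0 + n + i, (a + i) mod K + 1) \<in> set h)"
proof -
  have seq: "hop_states K P t0 u (n + r) l \<noteq> Hop_Random" if "l \<in> P" for l r
  proof (induction r)
    case (Suc r)
    then obtain a h where "hop_states K P t0 u (n + r) l = Hop_Seq a h" by (metis hop_states_cases)
    thus ?case using hop_states_seq_Suc[OF that] by simp
  qed (use n that in simp)
  obtain a h0 where a: "hop_states K P t0 u n j = Hop_Seq a h0" using n j by (metis hop_states_cases)
  have ar: "a \<in> {1..K}" by (rule hop_arm_range[OF K u j a])
  have "\<exists>h. hop_states K P t0 u (n + r) j = Hop_Seq ((a + r - 1) mod K + 1) h \<and>
     (\<forall>i<r. (t0 + n + i, (a + i) mod K + 1) \<in> set h)"
  proof (induction r)
    case 0
    have "a - 1 < K" using ar by auto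
    hence "(a - 1) mod K + 1 = a" using ar by simp
    thus ?case using a by simp
  next
    case (Suc r)
    then obtain h where h: "hop_states K P t0 u (n + r) j = Hop_Seq ((a + r - 1) mod K + 1) h"
      "\<forall>i<r. (t0 + n + i, (a + i) mod K + 1) \<in> set h" by blast
    have "((a + r - 1) mod K + 1) mod K = (a + r) mod K"
      using ar by (simp add: mod_Suc_eq)
    hence "hop_states K P t0 u (n + Suc r) j = Hop_Seq ((a + r) mod K + 1) ((t0 + (n + r), (a + r) mod K + 1) # h)"
      using hop_states_seq_Suc[OF j h(1)] hop_no_collision[OF K u _ j, where s = "n + r"] seq by auto
    thus ?case using h(2) by (auto simp: less_Suc_eq add.assoc)
  qed
  thus ?thesis using ar by auto
qed

text \<open>Each of the \<open>r div K\<close> complete sweeps visits arm \<open>k\<close> once, at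
  the same offset.\<close>

lemma hop_samples:
  assumes K: "K > 0" and u: "\<And>jt. u jt \<in> {1..K}"
    and n: "\<forall>l\<in>P. hop_states K P t0 u n l \<noteq> Hop_Random" and j: "j \<in> P" and k: "k \<in> {1..K}"
  shows "r div K \<le> length (sample_times (hop_history (hop_states K P t0 u (n + r) j)) k)"
proof -
  obtain a h where h: "hop_states K P t0 u (n + r) j = Hop_Seq ((a + r - 1) mod K + 1) h"
     "\<forall>i<r. (t0 + n + i, (a + i) mod K + 1) \<in> set h" using hop_states_cyclic[OF K u n j] by blast
  \<comment> \<open>The offset solves \<open>(a + i0) mod K = k - 1\<close>; the summand
    \<open>K - a mod K\<close> acts as \<open>- a\<close> within the naturals.\<close>
  define i0 where "i0 = (k - 1 + (K - a mod K)) mod K"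
  have i0: "i0 < K" unfolding i0_def using K by simp
  have "(a + i0) mod K = (a mod K + (k - 1 + (K - a mod K))) mod K"
    unfolding i0_def mod_add_left_eq mod_add_right_eq ..
  also have "a mod K + (k - 1 + (K - a mod K)) = (k - 1) + K" using less_imp_le[OF mod_less_divisor[OF K, of a]] by linarith
  also have "\<dots> mod K = k - 1"
  proof -
    have "k - 1 < K" using k by auto
    thus ?thesis by simp
  qed
  finally have ai: "(a + i0) mod K = k - 1" .
  let ?f = "\<lambda>q. t0 + n + (q * K + i0)"
  have "?f ` {..<r div K} \<subseteq> set (sample_times h k)"
  proof (rule image_subsetI)
    fix q assume "q \<in> {..<r div K}"
    hence "Suc q * K \<le> r div K * K" by (intro mult_le_mono) auto
    also have "\<dots> \<le> r" by simp
    finally have "q * K + i0 < r" using i0 by simp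
    hence "(?f q, (a + (q * K + i0)) mod K + 1) \<in> set h" using h(2) by blast
    moreover have "(a + (q * K + i0)) mod K + 1 = k"
    proof -
      have "(a + (q * K + i0)) mod K = (a + i0 + q * K) mod K" by (simp add: algebra_simps)
      thus ?thesis using ai k by simp
    qed
    ultimately show "?f q \<in> set (sample_times h k)" by (simp add: set_sample_times)
  qed
  hence "card (?f ` {..<r div K}) \<le> card (set (sample_times h k))" by (intro card_mono) auto
  moreover have "inj_on ?f {..<r div K}" using K by (auto simp: inj_on_def)
  ultimately have "r div K \<le> card (set (sample_times h k))" by (simp add: card_image)
  also have "\<dots> \<le> length (sample_times h k)" by (rule card_length)
  finally show ?thesis using h(1) by (simp add: hop_history_def)
qed

subsection \<open>Probability bounds for the learning phase\<close>

text \<open>The states are adapted: those at time \<open>s\<close> ignore the draws from round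
  \<open>s\<close> on. This permits redrawing an arm of round \<open>s\<close> with the past
  fixed.\<close>

lemma hop_states_cong:
  assumes "\<And>i s'. s' < s \<Longrightarrow> u (i, t0 + s') = u' (i, t0 + s')"
  shows "hop_states K P t0 u s = hop_states K P t0 u' s"
  using assms
proof (induction s)
  case (Suc s)
  hence "hop_states K P t0 u s = hop_states K P t0 u' s" by simp
  moreover from this have "hop_plays K P t0 u s = hop_plays K P t0 u' s"
    using Suc.prems by (simp add: hop_plays_def)
  ultimately show ?case by (intro ext) (simp only: hop_states_Suc)
qed simp

lemma measurable_hop_states:
  "(\<lambda>u. hop_states K P t0 u s j) \<in> draw_space K \<rightarrow>\<^sub>M count_space UNIV"
proof (induction s arbitrary: j)
  case (Suc s)
  have p: "(\<lambda>u. hop_plays K P t0 u s i) \<in> draw_space K \<rightarrow>\<^sub>M count_space UNIV" for i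
  proof -
    have "(\<lambda>u. select_arm K (u (i, t0 + s)) None (hop_states K P t0 u s i)) \<in> draw_space K \<rightarrow>\<^sub>M count_space UNIV"
    proof (rule measurable_compose_countable[OF _ Suc])
      fix q show "(\<lambda>u. select_arm K (u (i, t0 + s)) None q) \<in> draw_space K \<rightarrow>\<^sub>M count_space UNIV"
        by (rule measurable_compose[OF measurable_draw]) simp
    qed
    thus ?thesis unfolding hop_plays_def plays_def by simp
  qed
  let ?F = "\<lambda>I c q. observe K (t0 + s) (the I) c q"
  have "(\<lambda>u. ?F (hop_plays K P t0 u s j) (dynamic_trekking.collides (hop_plays K P t0 u s) j) (hop_states K P t0 u s j))
    \<in> draw_space K \<rightarrow>\<^sub>M count_space UNIV"
  proof (rule measurable_compose_countable[where g = "\<lambda>u. hop_plays K P t0 u s j", OF _ p])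
    fix I show "(\<lambda>u. ?F I (dynamic_trekking.collides (hop_plays K P t0 u s) j) (hop_states K P t0 u s j))
      \<in> draw_space K \<rightarrow>\<^sub>M count_space UNIV"
    proof (rule measurable_compose_countable[where g = "\<lambda>u. dynamic_trekking.collides (hop_plays K P t0 u s) j", OF _ measurable_collides[OF p]])
      fix c show "(\<lambda>u. ?F I c (hop_states K P t0 u s j)) \<in> draw_space K \<rightarrow>\<^sub>M count_space UNIV"
        using Suc by (rule measurable_compose) simp
    qed
  qed
  thus ?case by (simp add: hop_states_Suc)
qed simp

lemma prob_space_draw_space: "prob_space (draw_space K)"
  by (intro prob_space_PiM measure_pmf.prob_space_axioms)

lemma space_PiM_pmf [simp]: "space (\<Pi>\<^sub>M i\<in>UNIV. measure_pmf (p i)) = UNIV"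
  by (simp add: space_PiM)

lemma hop_random_sets: "{u. hop_states K P t0 u s j = Hop_Random} \<in> sets (draw_space K)"
proof -
  have "(\<lambda>u. hop_states K P t0 u s j) -` {Hop_Random} \<inter> space (draw_space K) \<in> sets (draw_space K)"
    by (rule measurable_sets[OF measurable_hop_states]) simp
  thus ?thesis by (simp add: vimage_def)
qed

text \<open>
  Redrawing the arm of \<open>j\<close> in round \<open>s\<close> preserves the law of the draws, and at least one of the \<open>K\<close>
  arms is free of the at most \<open>K - 1\<close> other players.
\<close>

lemma hop_random_decay:
  assumes K: "K > 0" and P: "finite P" "card P \<le> K" and j: "j \<in> P"
  shows "measure (draw_space K) {u. hop_states K P t0 u s j = Hop_Random} \<le> (1 - 1 / real K) ^ s"
proof (induction s)
  case 0
  show ?case using prob_space.prob_le_1[OF prob_space_draw_space] by simp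
next
  case (Suc s)
  let ?M = "draw_space K"
  let ?p = "measure_pmf (pmf_of_set {1..K})"
  let ?A = "\<lambda>s. {u. hop_states K P t0 u s j = Hop_Random}"
  let ?f = "\<lambda>(x, X :: nat \<times> nat \<Rightarrow> nat). X((j, t0 + s) := x)"
  interpret M: prob_space ?M by (rule prob_space_draw_space)
  interpret pair_sigma_finite ?p ?M ..
  have fM: "?f \<in> ?p \<Otimes>\<^sub>M ?M \<rightarrow>\<^sub>M ?M"
    by (intro measurable_PiM_single') (auto simp: case_prod_beta fun_upd_def intro!: measurable_If)
  have "distr (?p \<Otimes>\<^sub>M ?M) (\<Pi>\<^sub>M jt\<in>insert (j, t0 + s) UNIV. ?p) ?f = (\<Pi>\<^sub>M jt\<in>insert (j, t0 + s) UNIV. ?p)"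
    by (rule distr_pair_PiM_eq_PiM) (rule measure_pmf.prob_space_axioms)+
  hence distr: "distr (?p \<Otimes>\<^sub>M ?M) ?M ?f = ?M" by simp
  have q: "0 \<le> 1 - 1 / real K" using K by simp
  have redraw: "emeasure ?p {x. X((j, t0 + s) := x) \<in> ?A (Suc s)} \<le> ennreal (1 - 1 / real K) * indicator (?A s) X" for X
  proof -
    have st: "hop_states K P t0 (X((j, t0 + s) := x)) s = hop_states K P t0 X s" for x
      by (rule hop_states_cong) auto
    show ?thesis
    proof (cases K P t0 X s j rule: hop_states_cases)
      case random
      \<comment> \<open>The arms of the other players in this round do not change when
        \<open>j\<close> redraws hers, so \<open>j\<close> stays random only by drawing one of these
        at most \<open>K - 1\<close> arms.\<close>
      let ?O = "(\<lambda>i. the (hop_plays K P t0 X s i)) ` (P - {j})"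
      have "x \<in> ?O" if "X((j, t0 + s) := x) \<in> ?A (Suc s)" for x
      proof -
        let ?X = "X((j, t0 + s) := x)"
        have "dynamic_trekking.collides (hop_plays K P t0 ?X s) j"
          using that random st[of x] by (auto simp: hop_states_Suc split: if_splits)
        then obtain i where i: "i \<noteq> j" "hop_plays K P t0 ?X s i = hop_plays K P t0 ?X s j"
          unfolding dynamic_trekking.collides_def by auto
        have "hop_plays K P t0 ?X s j = Some x" using hop_plays_eq[OF j, of K t0 ?X s] st[of x] random by simp
        moreover have "hop_plays K P t0 ?X s i = hop_plays K P t0 X s i"
          using i(1) st[of x] by (simp add: hop_plays_def plays_def)
        ultimately have "hop_plays K P t0 X s i = Some x" using i by simp
        moreover from this have "i \<in> P" using hop_plays_outside[of i P K t0 X s] by auto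
        ultimately show ?thesis using i(1) by (intro image_eqI[of _ _ i]) auto
      qed
      hence "emeasure ?p {x. X((j, t0 + s) := x) \<in> ?A (Suc s)} \<le> emeasure ?p ?O"
        by (intro emeasure_mono) auto
      also have "\<dots> = ennreal (card ({1..K} \<inter> ?O) / card {1..K})"
        using K by (subst measure_pmf.emeasure_eq_measure, subst measure_pmf_of_set) auto
      also have "\<dots> \<le> ennreal (1 - 1 / real K)"
      proof -
        have "card ({1..K} \<inter> ?O) \<le> card ?O" using P by (intro card_mono) auto
        also have "\<dots> \<le> card (P - {j})" using P by (intro card_image_le) auto
        also have "\<dots> = card P - 1" using j P by simp
        finally have "real (card ({1..K} \<inter> ?O)) \<le> real K - 1" using P K by linarith
        hence "card ({1..K} \<inter> ?O) / card {1..K} \<le> (real K - 1) / real K" by (auto intro: divide_right_mono)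
        also have "\<dots> = 1 - 1 / real K" using K by (simp add: field_simps)
        finally show ?thesis by (rule ennreal_leI)
      qed
      finally show ?thesis using random by simp
    next
      case (seq a h)
      hence "hop_states K P t0 (X((j, t0 + s) := x)) (Suc s) j \<noteq> Hop_Random" for x
        using st[of x] by (simp add: hop_states_Suc)
      thus ?thesis by simp
    qed
  qed
  have "emeasure ?M (?A (Suc s)) = emeasure (distr (?p \<Otimes>\<^sub>M ?M) ?M ?f) (?A (Suc s))" by (simp only: distr)
  also have "\<dots> = emeasure (?p \<Otimes>\<^sub>M ?M) (?f -` ?A (Suc s) \<inter> space (?p \<Otimes>\<^sub>M ?M))"
    using fM hop_random_sets by (rule emeasure_distr)
  also have "\<dots> = (\<integral>\<^sup>+X. emeasure ?p ((\<lambda>x. (x, X)) -` (?f -` ?A (Suc s) \<inter> space (?p \<Otimes>\<^sub>M ?M))) \<partial>?M)"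
    by (rule emeasure_pair_measure_alt2) (rule measurable_sets[OF fM hop_random_sets])
  also have "\<dots> = (\<integral>\<^sup>+X. emeasure ?p {x. X((j, t0 + s) := x) \<in> ?A (Suc s)} \<partial>?M)"
    by (intro nn_integral_cong arg_cong[where f = "emeasure ?p"]) (auto simp: space_pair_measure)
  also have "\<dots> \<le> (\<integral>\<^sup>+X. ennreal (1 - 1 / real K) * indicator (?A s) X \<partial>?M)"
    by (intro nn_integral_mono redraw)
  also have "\<dots> = ennreal (1 - 1 / real K) * emeasure ?M (?A s)"
    using hop_random_sets by (rule nn_integral_cmult_indicator)
  also have "\<dots> = ennreal ((1 - 1 / real K) * measure ?M (?A s))"
    using q by (simp add: M.emeasure_eq_measure ennreal_mult del: One_nat_def)
  finally have "measure ?M (?A (Suc s)) \<le> (1 - 1 / real K) * measure ?M (?A s)"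
    using q by (simp add: M.emeasure_eq_measure del: One_nat_def)
  also have "\<dots> \<le> (1 - 1 / real K) * (1 - 1 / real K) ^ s"
    using Suc q by (intro mult_left_mono)
  finally show ?case by simp
qed

section \<open>Concentration of the empirical means\<close>

lemma prob_space_reward_space:
  assumes "reward_laws K D"
  shows "prob_space (reward_space K D)"
  using assms unfolding reward_laws_def by (intro prob_space_PiM) auto

lemma reward_concentration:
  assumes D: "reward_laws K D" and k: "k \<in> {1..K}" and ts: "distinct ts" and e: "e \<ge> 0"
  shows "measure (reward_space K D)
     {X \<in> space (reward_space K D). e \<le> \<bar>(\<Sum>t\<leftarrow>ts. X (j, t, k)) / real (length ts) - arm_mean D k\<bar>}
     \<le> 2 * exp (- 2 * real (length ts) * e\<^sup>2)"
proof (cases "ts = []")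
  case True
  interpret prob_space "reward_space K D" using D by (rule prob_space_reward_space)
  have "prob A \<le> 2" for A using prob_le_1[of A] by linarith
  thus ?thesis using True by simp
next
  case False
  let ?M = "reward_space K D"
  let ?D = "\<lambda>(j, t, k). D k"
  interpret prob_space ?M using D by (rule prob_space_reward_space)
  have pD: "prob_space (D l)" "sets (D l) = sets borel" "AE y in D l. 0 \<le> y \<and> y \<le> 1" if "l \<in> {1..K}" for l
    using D that unfolding reward_laws_def by auto
  have rv [measurable]: "(\<lambda>X. X (j, t, k)) \<in> borel_measurable ?M" for t by (rule measurable_reward[OF D])
  have dist: "distr ?M borel (\<lambda>X. X (j, t, k)) = D k" for t
  proof -
    have "distr ?M borel (\<lambda>X. X (j, t, k)) = distr ?M (?D (j, t, k)) (\<lambda>X. X (j, t, k))"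
      using pD(2)[OF k] by (intro distr_cong) auto
    also have "\<dots> = ?D (j, t, k)"
      using k pD(1) by (intro distr_PiM_component) auto
    finally show ?thesis by simp
  qed
  have indep: "indep_vars (\<lambda>_. borel) (\<lambda>t X. X (j, t, k)) (set ts)"
  proof (subst indep_vars_iff_distr_eq_PiM')
    \<comment> \<open>Independence is read off the product: restricting it along the injection of
      \<open>t\<close> into the index \<open>(j, t, k)\<close> again gives a product
      measure.\<close>
    have "distr ?M (\<Pi>\<^sub>M t\<in>set ts. ?D (j, t, k)) (\<lambda>X. \<lambda>t\<in>set ts. X (j, t, k)) = (\<Pi>\<^sub>M t\<in>set ts. ?D (j, t, k))"
      using k pD(1) by (intro distr_PiM_reindex) (auto simp: inj_on_def)
    moreover have "sets (\<Pi>\<^sub>M t\<in>set ts. ?D (j, t, k)) = sets (\<Pi>\<^sub>M t\<in>set ts. borel)"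
      using pD(2)[OF k] by (intro sets_PiM_cong) auto
    ultimately show "distr ?M (\<Pi>\<^sub>M t\<in>set ts. borel) (\<lambda>X. \<lambda>t\<in>set ts. X (j, t, k)) =
        (\<Pi>\<^sub>M t\<in>set ts. distr ?M borel (\<lambda>X. X (j, t, k)))"
      by (simp add: dist del: One_nat_def cong: distr_cong)
  qed (use False rv in auto)
  have AE: "AE X in ?M. X (j, hd ts, k) \<in> {0..1}"
  proof -
    have "AE y in ?D (j, hd ts, k). y \<in> {0..1}" using pD(3)[OF k] by (simp only: prod.case atLeastAtMost_iff)
    thus ?thesis using k pD(1) by (intro AE_PiM_component) auto
  qed
  interpret H: Hoeffding_ineq_iid ?M "set ts" "\<lambda>t X. X (j, t, k)" "\<lambda>X. X (j, hd ts, k)" 0 1 "arm_mean D k"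
  proof unfold_locales
    have "arm_mean D k = (\<integral>y. y \<partial>distr ?M borel (\<lambda>X. X (j, hd ts, k)))" unfolding arm_mean_def dist ..
    also have "\<dots> = expectation (\<lambda>X. X (j, hd ts, k))" by (rule integral_distr) (use rv in auto)
    finally show "arm_mean D k \<equiv> expectation (\<lambda>X. X (j, hd ts, k))" by simp
  qed (use indep AE rv in \<open>simp_all add: dist del: One_nat_def\<close>)
  have c: "card (set ts) = length ts" using ts by (rule distinct_card)
  have "prob {X \<in> space ?M. e \<le> \<bar>(\<Sum>t\<in>set ts. X (j, t, k)) / real (card (set ts)) - arm_mean D k\<bar>}
     \<le> 2 * exp (- 2 * real (card (set ts)) * e\<^sup>2 / (1 - 0)\<^sup>2)"
    by (rule H.Hoeffding_ineq_abs_ge'[OF e]) (use False in auto)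
  thus ?thesis using ts by (simp add: c sum_list_distinct_conv_sum_set)
qed

lemma empirical_mean_sample_times:
  "empirical_mean X h k = (\<Sum>t\<leftarrow>sample_times h k. X t k) / real (length (sample_times h k))"
  unfolding empirical_mean_def sample_times_def Let_def ..

text \<open>
  The rounds in which an arm is sampled depend only on the draws, which are independent of the
  rewards; hence the concentration bound for fixed rounds survives.
\<close>

lemma adaptive_concentration:
  assumes D: "reward_laws K D" and k: "k \<in> {1..K}" and e: "e \<ge> 0"
    and H: "H \<in> draw_space K \<rightarrow>\<^sub>M count_space UNIV" and G: "Measurable.pred (draw_space K) G"
    and GH: "\<And>u. G u \<Longrightarrow> distinct (sample_times (H u) k) \<and> n \<le> length (sample_times (H u) k)"
  shows "{\<omega> \<in> space (sample_space K D). G (fst \<omega>) \<and>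
      e \<le> \<bar>empirical_mean (\<lambda>t k. snd \<omega> (j, t, k)) (H (fst \<omega>)) k - arm_mean D k\<bar>} \<in> sets (sample_space K D)" (is "?A \<in> _")
    and "measure (sample_space K D) {\<omega> \<in> space (sample_space K D). G (fst \<omega>) \<and>
      e \<le> \<bar>empirical_mean (\<lambda>t k. snd \<omega> (j, t, k)) (H (fst \<omega>)) k - arm_mean D k\<bar>} \<le> 2 * exp (- 2 * real n * e\<^sup>2)"
proof -
  let ?M = "sample_space K D"
  interpret M1: prob_space "draw_space K" by (rule prob_space_draw_space)
  interpret M2: prob_space "reward_space K D" using D by (rule prob_space_reward_space)
  interpret pair_prob_space "draw_space K" "reward_space K D" ..
  have X: "(\<lambda>\<omega>. snd \<omega> (j, s, k)) \<in> borel_measurable ?M" for s k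
    unfolding sample_space_def by (rule measurable_compose[OF measurable_snd measurable_reward[OF D]])
  have H': "(\<lambda>\<omega>. H (fst \<omega>)) \<in> ?M \<rightarrow>\<^sub>M count_space UNIV"
    unfolding sample_space_def by (rule measurable_compose[OF measurable_fst H])
  have G': "Measurable.pred ?M (\<lambda>\<omega>. G (fst \<omega>))"
    unfolding sample_space_def by (rule measurable_compose[OF measurable_fst G])
  have "(\<lambda>\<omega>. empirical_mean (\<lambda>t k. snd \<omega> (j, t, k)) (H (fst \<omega>)) k) \<in> borel_measurable ?M"
    by (rule measurable_compose_countable[OF _ H'])
      (rule measurable_empirical_mean[where X = "\<lambda>\<omega> t k. snd \<omega> (j, t, k)", OF X])
  with G' show A: "?A \<in> sets ?M" by measurable
  have "emeasure ?M ?A = (\<integral>\<^sup>+u. emeasure (reward_space K D) (Pair u -` ?A) \<partial>draw_space K)"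
    using A unfolding sample_space_def by (rule M2.emeasure_pair_measure_alt)
  also have "\<dots> \<le> (\<integral>\<^sup>+u. ennreal (2 * exp (- 2 * real n * e\<^sup>2)) \<partial>draw_space K)"
  proof (rule nn_integral_mono)
    fix u
    show "emeasure (reward_space K D) (Pair u -` ?A) \<le> ennreal (2 * exp (- 2 * real n * e\<^sup>2))"
    proof (cases "G u")
      case True
      let ?ts = "sample_times (H u) k"
      have "Pair u -` ?A = {X \<in> space (reward_space K D). e \<le> \<bar>(\<Sum>t\<leftarrow>?ts. X (j, t, k)) / real (length ?ts) - arm_mean D k\<bar>}"
        using True by (auto simp: sample_space_def space_pair_measure empirical_mean_sample_times)
      hence "measure (reward_space K D) (Pair u -` ?A) \<le> 2 * exp (- 2 * real (length ?ts) * e\<^sup>2)"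
        using reward_concentration[OF D k _ e] GH[OF True] by simp
      also have "\<dots> \<le> 2 * exp (- 2 * real n * e\<^sup>2)"
        using GH[OF True] by (auto intro: mult_right_mono)
      finally show ?thesis unfolding M2.emeasure_eq_measure by (rule ennreal_leI)
    next
      case False
      hence "Pair u -` ?A = {}" by auto
      thus ?thesis by (simp only: emeasure_empty) simp
    qed
  qed
  also have "\<dots> = ennreal (2 * exp (- 2 * real n * e\<^sup>2))" using M1.emeasure_space_1 by (simp del: One_nat_def)
  finally show "measure ?M ?A \<le> 2 * exp (- 2 * real n * e\<^sup>2)"
    unfolding sample_space_def measure_def by (intro enn2real_leI) auto
qed

lemma prob_space_sample_space:
  assumes "reward_laws K D"
  shows "prob_space (sample_space K D)"
proof -
  interpret M1: prob_space "draw_space K" by (rule prob_space_draw_space)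
  interpret M2: prob_space "reward_space K D" using assms by (rule prob_space_reward_space)
  interpret pair_prob_space "draw_space K" "reward_space K D" ..
  show ?thesis unfolding sample_space_def by unfold_locales
qed

lemma measure_sample_space_fst:
  assumes D: "reward_laws K D" and A: "A \<in> sets (draw_space K)"
  shows "{\<omega> \<in> space (sample_space K D). fst \<omega> \<in> A} \<in> sets (sample_space K D)"
    and "measure (sample_space K D) {\<omega> \<in> space (sample_space K D). fst \<omega> \<in> A} = measure (draw_space K) A"
proof -
  interpret M1: prob_space "draw_space K" by (rule prob_space_draw_space)
  interpret M2: prob_space "reward_space K D" using D by (rule prob_space_reward_space)
  interpret pair_prob_space "draw_space K" "reward_space K D" ..
  have eq: "{\<omega> \<in> space (sample_space K D). fst \<omega> \<in> A} = A \<times> space (reward_space K D)"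
    by (auto simp: sample_space_def space_pair_measure)
  show "{\<omega> \<in> space (sample_space K D). fst \<omega> \<in> A} \<in> sets (sample_space K D)"
    unfolding eq unfolding sample_space_def using A by auto
  have "emeasure (sample_space K D) (A \<times> space (reward_space K D)) = emeasure (draw_space K) A"
    unfolding sample_space_def using A by (simp add: M2.emeasure_pair_measure_Times M2.emeasure_space_1 del: One_nat_def)
  thus "measure (sample_space K D) {\<omega> \<in> space (sample_space K D). fst \<omega> \<in> A} = measure (draw_space K) A"
    unfolding eq by (simp add: measure_def)
qed

text \<open>The carrier of the draw space contains all functions into the naturals, so draws outside
  the arms are excluded only almost surely; there are countably many coordinates, so one null set
  serves for all.\<close>

lemma draws_in_range:
  assumes "K > 0"
  shows "{u. \<exists>jt. u jt \<notin> {1..K}} \<in> null_sets (draw_space K)"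
proof -
  have "AE u in draw_space K. u jt \<in> {1..K}" for jt
    using assms by (intro AE_PiM_component measure_pmf.prob_space_axioms) (auto intro!: AE_pmfI)
  hence "AE u in draw_space K. \<forall>jt. u jt \<in> {1..K}" by (simp only: AE_all_countable) simp
  moreover have "{u. \<exists>jt. u jt \<notin> {1..K}} \<in> sets (draw_space K)"
  proof -
    have "Measurable.pred (draw_space K) (\<lambda>u. u jt \<notin> {1..K})" for jt
      by (rule measurable_compose[OF measurable_draw]) simp
    hence "Measurable.pred (draw_space K) (\<lambda>u. \<exists>jt. u jt \<notin> {1..K})" by measurable
    thus ?thesis by (simp add: pred_def)
  qed
  ultimately show ?thesis
    by (subst AE_iff_null_sets) (auto elim!: eventually_mono)
qed

subsection \<open>Trekking\<close>

text \<open>A bijection onto \<open>{1..card P}\<close>, rather than just an injection into the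
  indices, expresses at once that nobody collides and that the best arms are the ones in
  use.\<close>

definition settled :: "nat set \<Rightarrow> nat list \<Rightarrow> (nat \<Rightarrow> local_state) \<Rightarrow> bool" where
  "settled P r q \<longleftrightarrow> (\<exists>i. bij_betw i P {1..card P} \<and> (\<forall>j\<in>P. q j = Locked (r ! (i j - 1))))"

text \<open>Through this equivalence trekking can be followed on indices alone, without the arms
  they stand for.\<close>

lemma collides_nth_iff:
  assumes I: "\<And>j. I j = (if j \<in> P then Some (r ! (p j - 1)) else None)"
    and p: "\<And>j. j \<in> P \<Longrightarrow> p j \<in> {1..length r}" and r: "distinct r" and j: "j \<in> P"
  shows "dynamic_trekking.collides I j \<longleftrightarrow> (\<exists>l\<in>P. l \<noteq> j \<and> p l = p j)"
proof -
  have "r ! (p l - 1) = r ! (p j - 1) \<longleftrightarrow> p l = p j" if l: "l \<in> P" for l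
  proof -
    have "p l - 1 < length r" "p j - 1 < length r" "1 \<le> p l" "1 \<le> p j" using p[OF l] p[OF j] by auto
    thus ?thesis using r by (auto simp: nth_eq_iff_index_eq)
  qed
  thus ?thesis using j unfolding dynamic_trekking.collides_def I by auto
qed

text \<open>A finite downward closed set of positive integers is an initial segment, and injectivity
  fixes its length. The final indices of both trekking variants are of this kind.\<close>

lemma inj_on_downward_closed:
  assumes fin: "finite P" and inj: "inj_on i P" and pos: "\<And>j. j \<in> P \<Longrightarrow> 1 \<le> (i j :: nat)"
    and down: "\<And>j k. j \<in> P \<Longrightarrow> 1 \<le> k \<Longrightarrow> k < i j \<Longrightarrow> k \<in> i ` P"
  shows "bij_betw i P {1..card P}"
proof -
  have "i ` P = {1..card P}"
  proof (cases "P = {}")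
    case False
    hence M: "Max (i ` P) \<in> i ` P" using fin by simp
    then obtain j where j: "j \<in> P" "i j = Max (i ` P)" by auto
    have eq: "i ` P = {1..Max (i ` P)}"
    proof
      show "i ` P \<subseteq> {1..Max (i ` P)}" using fin pos by auto
      show "{1..Max (i ` P)} \<subseteq> i ` P"
      proof
        fix k assume "k \<in> {1..Max (i ` P)}"
        hence "1 \<le> k" "k < i j \<or> k = Max (i ` P)" using j by auto
        thus "k \<in> i ` P" using down[OF j(1)] M by auto
      qed
    qed
    have "card P = card (i ` P)" using card_image[OF inj] by simp
    also have "\<dots> = card {1..Max (i ` P)}" by (rule arg_cong[OF eq])
    finally show ?thesis using eq by simp
  qed simp
  thus ?thesis using inj by (simp add: bij_betw_def)
qed

section \<open>TrekU: dynamics and invariant\<close>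

definition up_state :: "nat list \<Rightarrow> nat \<Rightarrow> nat option \<Rightarrow> local_state" where
  "up_state r i d = (case d of None \<Rightarrow> Locked (r ! (i - 1)) | Some c \<Rightarrow> Trek_Up r i c)"

definition up_pos :: "nat \<Rightarrow> nat option \<Rightarrow> nat" where
  "up_pos i d = (case d of None \<Rightarrow> i | Some c \<Rightarrow> i - 1)"

text \<open>As all players share the order \<open>r\<close>, it can be factored out:
  \<open>(i, None)\<close> stands for being locked on index \<open>i\<close>, and
  \<open>(i, Some c)\<close> for reserving \<open>i\<close> after \<open>c\<close> probes of
  \<open>i - 1\<close>.\<close>

definition up_next :: "bool \<Rightarrow> nat \<Rightarrow> nat option \<Rightarrow> nat \<times> nat option" where
  "up_next col i d = (case d of None \<Rightarrow> (i, None) | Some c \<Rightarrow>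
     if col then (i, None) else if Suc c < i - 1 then (i, Some (Suc c))
     else if i - 1 = 1 then (1, None) else (i - 1, Some 0))"

lemma observe_up_state:
  "observe K t a col (up_state r i d) = up_state r (fst (up_next col i d)) (snd (up_next col i d))"
  by (auto simp: up_state_def up_next_def split: option.splits)

text \<open>
  The third conjunct makes sure that the player reserving index \<open>k\<close> decides before the player
  reserving index \<open>k + 1\<close> has finished probing \<open>k\<close>.
\<close>

definition up_inv :: "nat set \<Rightarrow> nat \<Rightarrow> nat \<Rightarrow> (nat \<Rightarrow> nat) \<Rightarrow> (nat \<Rightarrow> nat option) \<Rightarrow> bool" where
  "up_inv P K s i d \<longleftrightarrow>
     inj_on i P \<and>
     (\<forall>j\<in>P. i j \<in> {1..K} \<and> (\<forall>c. d j = Some c \<longrightarrow>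
        2 \<le> i j \<and> c < i j - 1 \<and> 2 * s + i j * (i j - 1) \<le> K * (K - 1) + 2 * c)) \<and>
     (\<forall>j\<in>P. \<forall>l\<in>P. \<forall>c c'. d j = Some c \<longrightarrow> d l = Some c' \<longrightarrow> i j = Suc (i l) \<longrightarrow> c \<le> c') \<and>
     (\<forall>j\<in>P. d j = None \<longrightarrow> (\<forall>k. 1 \<le> k \<longrightarrow> k < i j \<longrightarrow> (\<exists>l\<in>P. i l = k \<and> d l = None)))"

lemma up_invI:
  assumes "inj_on i P" "\<And>j. j \<in> P \<Longrightarrow> i j \<in> {1..K}"
    and "\<And>j c. j \<in> P \<Longrightarrow> d j = Some c \<Longrightarrow>
      2 \<le> i j \<and> c < i j - 1 \<and> 2 * s + i j * (i j - 1) \<le> K * (K - 1) + 2 * c"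
    and "\<And>j l c c'. j \<in> P \<Longrightarrow> l \<in> P \<Longrightarrow> d j = Some c \<Longrightarrow> d l = Some c' \<Longrightarrow> i j = Suc (i l) \<Longrightarrow> c \<le> c'"
    and "\<And>j k. j \<in> P \<Longrightarrow> d j = None \<Longrightarrow> 1 \<le> k \<Longrightarrow> k < i j \<Longrightarrow> \<exists>l\<in>P. i l = k \<and> d l = None"
  shows "up_inv P K s i d"
proof -
  have 2: "\<forall>j\<in>P. i j \<in> {1..K} \<and> (\<forall>c. d j = Some c \<longrightarrow>
        2 \<le> i j \<and> c < i j - 1 \<and> 2 * s + i j * (i j - 1) \<le> K * (K - 1) + 2 * c)"
    using assms(2,3) by simp
  have 3: "\<forall>j\<in>P. \<forall>l\<in>P. \<forall>c c'. d j = Some c \<longrightarrow> d l = Some c' \<longrightarrow> i j = Suc (i l) \<longrightarrow> c \<le> c'"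
    using assms(4) by blast
  have 4: "\<forall>j\<in>P. d j = None \<longrightarrow> (\<forall>k. 1 \<le> k \<longrightarrow> k < i j \<longrightarrow> (\<exists>l\<in>P. i l = k \<and> d l = None))"
    using assms(5) by blast
  show ?thesis unfolding up_inv_def by (intro conjI 2 3 4 assms(1))
qed

lemma up_invD:
  assumes "up_inv P K s i d"
  shows "inj_on i P" "j \<in> P \<Longrightarrow> i j \<in> {1..K}"
    and "j \<in> P \<Longrightarrow> d j = Some c \<Longrightarrow>
      2 \<le> i j \<and> c < i j - 1 \<and> 2 * s + i j * (i j - 1) \<le> K * (K - 1) + 2 * c"
    and "j \<in> P \<Longrightarrow> l \<in> P \<Longrightarrow> d j = Some c \<Longrightarrow> d l = Some c' \<Longrightarrow> i j = Suc (i l) \<Longrightarrow> c \<le> c'"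
    and "j \<in> P \<Longrightarrow> d j = None \<Longrightarrow> 1 \<le> k \<Longrightarrow> k < i j \<Longrightarrow> \<exists>l\<in>P. i l = k \<and> d l = None"
proof -
  note I = assms[unfolded up_inv_def]
  note I1 = I[THEN conjunct1] and I2 = I[THEN conjunct2, THEN conjunct1]
    and I3 = I[THEN conjunct2, THEN conjunct2, THEN conjunct1]
    and I4 = I[THEN conjunct2, THEN conjunct2, THEN conjunct2]
  show "inj_on i P" by (rule I1)
  show "j \<in> P \<Longrightarrow> i j \<in> {1..K}" using I2 by blast
  show "j \<in> P \<Longrightarrow> d j = Some c \<Longrightarrow>
      2 \<le> i j \<and> c < i j - 1 \<and> 2 * s + i j * (i j - 1) \<le> K * (K - 1) + 2 * c" using I2 by blast
  show "j \<in> P \<Longrightarrow> l \<in> P \<Longrightarrow> d j = Some c \<Longrightarrow> d l = Some c' \<Longrightarrow> i j = Suc (i l) \<Longrightarrow> c \<le> c'"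
    using I3 by blast
  show "j \<in> P \<Longrightarrow> d j = None \<Longrightarrow> 1 \<le> k \<Longrightarrow> k < i j \<Longrightarrow> \<exists>l\<in>P. i l = k \<and> d l = None"
    using I4 by blast
qed

text \<open>The inequality in the invariant is a time budget. A player reserving \<open>i\<close>
  with \<open>c\<close> probes made needs at most \<open>i (i - 1) / 2 - c\<close> more rounds, and
  elapsed plus remaining time never exceeds \<open>K (K - 1) / 2\<close>. The last conjunct states
  that a locked player has locked players on all better indices, so that the final indices have no
  gap.\<close>

lemma up_inv_step:
  fixes i :: "nat \<Rightarrow> nat" and d :: "nat \<Rightarrow> nat option"
  defines "col \<equiv> \<lambda>P j. \<exists>l\<in>P. l \<noteq> j \<and> up_pos (i l) (d l) = up_pos (i j) (d j)"
  assumes inv: "up_inv P K s i d"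
    and i': "\<And>j. i' j = fst (up_next (col P j) (i j) (d j))"
    and d': "\<And>j. d' j = snd (up_next (col P j) (i j) (d j))"
  shows "up_inv P K (Suc s) i' d'"
proof -
  have inj: "j = l" if "j \<in> P" "l \<in> P" "i j = i l" for j l
    using up_invD(1)[OF inv] that by (auto dest: inj_onD)
  have rng: "i j \<in> {1..K}" if "j \<in> P" for j using up_invD(2)[OF inv] that by blast
  have bnd: "2 \<le> i j" "c < i j - 1" "2 * s + i j * (i j - 1) \<le> K * (K - 1) + 2 * c"
    if "j \<in> P" "d j = Some c" for j c
    using up_invD(3)[OF inv] that by blast+
  have adj: "c \<le> c'" if "j \<in> P" "l \<in> P" "d j = Some c" "d l = Some c'" "i j = Suc (i l)" for j l c c'
    using up_invD(4)[OF inv] that by blast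
  have down: "\<exists>l\<in>P. i l = k \<and> d l = None" if "j \<in> P" "d j = None" "1 \<le> k" "k < i j" for j k
    using up_invD(5)[OF inv] that by blast
  \<comment> \<open>Two players probing the same index would reserve the same index, against
    injectivity; a probe can therefore only hit a locked player.\<close>
  have F1: "\<exists>l\<in>P. d l = None \<and> i l = i j - 1" if j: "j \<in> P" "d j = Some c" "col P j" for j c
  proof -
    obtain l where l: "l \<in> P" "l \<noteq> j" "up_pos (i l) (d l) = i j - 1"
      using j unfolding col_def by (auto simp: up_pos_def)
    have "d l = None"
    proof (rule ccontr)
      assume "d l \<noteq> None"
      then obtain c' where "d l = Some c'" by auto
      hence "i l = i j" using l bnd(1)[OF j(1,2)] bnd(1)[OF l(1)] by (auto simp: up_pos_def)
      thus False using inj l j by auto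
    qed
    thus ?thesis using l by (auto simp: up_pos_def)
  qed
  \<comment> \<open>A holder of index \<open>i j - 1\<close> who still treks needs one probe fewer
    than \<open>j\<close> and has made at least as many, so she cannot be undecided when
    \<open>j\<close> finishes; a locked holder would have caused a collision.\<close>
  have F2: "i l \<noteq> i j - 1" if j: "j \<in> P" "d j = Some c" "\<not> col P j" "\<not> Suc c < i j - 1" and l: "l \<in> P" for j c l
  proof
    assume e: "i l = i j - 1"
    have j2: "2 \<le> i j" using bnd j by blast
    hence lj: "l \<noteq> j" using e by auto
    show False
    proof (cases "d l")
      case None
      hence "col P j" using l lj j e unfolding col_def by (auto simp: up_pos_def)
      thus False using j by simp
    next
      case (Some c')
      have "c \<le> c'" using adj[OF j(1) l j(2) Some] e j2 by simp
      thus False using bnd(2)[OF l Some] e j by linarith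
    qed
  qed
  define mv where "mv = (\<lambda>j. \<exists>c. d j = Some c \<and> \<not> col P j \<and> \<not> Suc c < i j - 1)"
  have im: "i' j = (if mv j then i j - 1 else i j)" if "j \<in> P" for j
    using bnd(1)[OF that] unfolding i' mv_def up_next_def by (auto split: option.splits)
  have mvF: "i l \<noteq> i j - 1" "2 \<le> i j" if "mv j" "j \<in> P" "l \<in> P" for j l
    using that F2 bnd(1) unfolding mv_def by blast+
  have None': "d' j = None" "i' j = i j" if "d j = None" for j
    using that unfolding i' d' up_next_def by auto
  have Some': "\<exists>c0. d j = Some c0 \<and> \<not> col P j \<and> (if mv j then c = 0 \<and> Suc c0 = i j - 1 \<and> i j \<noteq> 2 else c = Suc c0 \<and> Suc c0 < i j - 1)"
    if "j \<in> P" "d' j = Some c" for j c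
    using bnd(1,2)[OF that(1)] that(2) unfolding d' mv_def up_next_def
    by (auto split: option.splits if_splits)
  have "inj_on i' P"
  proof (rule inj_onI)
    fix j l assume jl: "j \<in> P" "l \<in> P" "i' j = i' l"
    show "j = l"
    proof (cases "mv j"; cases "mv l")
      assume "mv j" "mv l" thus ?thesis
        using jl im inj mvF(2)[of j j] mvF(2)[of l l] by (metis Suc_diff_1 less_le_trans zero_less_numeral)
    next
      assume "mv j" "\<not> mv l" thus ?thesis using jl im mvF(1)[of j l] by auto
    next
      assume "\<not> mv j" "mv l" thus ?thesis using jl im mvF(1)[of l j] by auto
    next
      assume "\<not> mv j" "\<not> mv l" thus ?thesis using jl im inj by auto
    qed
  qed
  moreover have "i' j \<in> {1..K}" if j: "j \<in> P" for j
    using im[OF j] rng[OF j] mvF(2)[of j j] j by auto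
  moreover have "2 \<le> i' j \<and> c < i' j - 1 \<and> 2 * Suc s + i' j * (i' j - 1) \<le> K * (K - 1) + 2 * c"
    if j: "j \<in> P" "d' j = Some c" for j c
  proof -
    obtain c0 where c0: "d j = Some c0" "\<not> col P j"
      "if mv j then c = 0 \<and> Suc c0 = i j - 1 \<and> i j \<noteq> 2 else c = Suc c0 \<and> Suc c0 < i j - 1"
      using Some'[OF j] by blast
    show ?thesis
    proof (cases "mv j")
      case True
      \<comment> \<open>A player moving to index 1 locks, so one who goes on trekking comes from an
        index of at least 3. Her counter drops from \<open>i - 2\<close> to 0, which is exactly
        offset by \<open>i (i - 1) - (i - 1) (i - 2) = 2 (i - 1)\<close>.\<close>
      hence "Suc (Suc (Suc 0)) \<le> i j" using c0 bnd(1)[OF j(1) c0(1)] by auto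
      then obtain n where "i j = Suc (Suc (Suc n))" by (metis Suc_le_D Suc_le_mono)
      hence n: "i j = Suc (Suc (Suc n))" "c0 = Suc n" "c = 0" using c0 True by auto
      have "2 * s + i j * (i j - 1) \<le> K * (K - 1) + 2 * c0" using bnd(3)[OF j(1) c0(1)] .
      thus ?thesis using im[OF j(1)] True n by simp
    next
      case False
      thus ?thesis using im[OF j(1)] c0 bnd[OF j(1) c0(1)] by auto
    qed
  qed
  moreover have "c \<le> c'" if jl: "j \<in> P" "l \<in> P" "d' j = Some c" "d' l = Some c'" "i' j = Suc (i' l)" for j l c c'
  proof -
    obtain c0 where c0: "d j = Some c0" "if mv j then c = 0 else c = Suc c0"
      using Some'[OF jl(1,3)] by (auto split: if_splits)
    obtain c1 where c1: "d l = Some c1" "if mv l then c' = 0 else c' = Suc c1"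
      using Some'[OF jl(2,4)] by (auto split: if_splits)
    show ?thesis
    proof (cases "mv j")
      case False
      show ?thesis
      proof (cases "mv l")
        case True
        hence "i j = i l" using im jl False mvF(2)[OF True jl(2) jl(2)] by simp
        thus ?thesis using inj jl True False by auto
      next
        case F: False
        thus ?thesis using adj[OF jl(1,2) c0(1) c1(1)] im jl False c0 c1 by simp
      qed
    qed (use c0 in auto)
  qed
  moreover have "\<exists>l\<in>P. i' l = k \<and> d' l = None" if j: "j \<in> P" "d' j = None" "1 \<le> k" "k < i' j" for j k
  proof -
    have "\<exists>l\<in>P. i l = k \<and> d l = None"
    proof (cases "d j")
      case None
      thus ?thesis using down[OF j(1)] None'[OF None] j by simp
    next
      case (Some c)
      have c: "col P j \<and> i' j = i j"
        using j Some unfolding d' i' up_next_def by (auto split: if_splits)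
      then obtain l where l: "l \<in> P" "d l = None" "i l = i j - 1" using F1[OF j(1) Some] by blast
      show ?thesis
      proof (cases "k = i j - 1")
        case False
        hence "k < i l" using j c l by simp
        thus ?thesis using down[OF l(1,2)] j by simp
      qed (use l in auto)
    qed
    thus ?thesis using None' by metis
  qed
  ultimately show ?thesis by (rule up_invI)
qed

section \<open>TrekD: dynamics and invariant\<close>

definition down_state :: "nat list \<Rightarrow> nat \<Rightarrow> nat \<Rightarrow> nat option \<Rightarrow> local_state" where
  "down_state r b m d = (case d of None \<Rightarrow> Locked (r ! (m - 1)) | Some c \<Rightarrow> Trek_Down r b m c)"

definition down_next :: "nat \<Rightarrow> bool \<Rightarrow> nat \<Rightarrow> nat \<Rightarrow> nat option \<Rightarrow> nat \<times> nat option" where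
  "down_next K col b m d = (case d of None \<Rightarrow> (m, None) | Some c \<Rightarrow>
     if \<not> col then (m, None) else if Suc c < b then (m, Some (Suc c))
     else (m mod K + 1, Some 0))"

lemma observe_down_state:
  "observe K t a col (down_state r b m d) = down_state r b (fst (down_next K col b m d)) (snd (down_next K col b m d))"
  by (auto simp: down_state_def down_next_def split: option.splits)

text \<open>
  All players start trekking together, so a player with back-off time \<open>b\<close> reaches index \<open>m\<close> after
  exactly \<open>(m - 1) b\<close> rounds; distinct back-off times thus separate the arrivals at each index
  other than \<open>1\<close>, and the first to arrive finds it free.
\<close>

definition down_inv :: "nat set \<Rightarrow> nat \<Rightarrow> (nat \<Rightarrow> nat) \<Rightarrow> nat \<Rightarrow> (nat \<Rightarrow> nat) \<Rightarrow> (nat \<Rightarrow> nat option) \<Rightarrow> bool" where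
  "down_inv P K b s m d \<longleftrightarrow>
     (\<forall>j\<in>P. 1 \<le> m j \<and> (\<forall>c. d j = Some c \<longrightarrow> c < b j \<and> b j \<le> K \<and> (m j - 1) * b j + c = s)) \<and>
     (\<forall>j\<in>P. \<forall>l\<in>P. d j \<noteq> None \<longrightarrow> d l \<noteq> None \<longrightarrow> b j = b l \<longrightarrow> j = l) \<and>
     (\<forall>j\<in>P. \<forall>l\<in>P. d j = None \<longrightarrow> d l = None \<longrightarrow> m j = m l \<longrightarrow> j = l) \<and>
     (\<forall>j\<in>P. \<forall>k. 2 \<le> k \<longrightarrow> k < m j \<longrightarrow> (\<exists>l\<in>P. d l = None \<and> m l = k)) \<and>
     (\<forall>j\<in>P. \<forall>c. d j = Some (Suc c) \<longrightarrow> 2 \<le> m j \<longrightarrow> (\<exists>l\<in>P. d l = None \<and> m l = m j)) \<and>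
     (\<exists>j\<in>P. m j = 1)"

lemma down_invI:
  assumes "\<And>j. j \<in> P \<Longrightarrow> 1 \<le> m j"
    and "\<And>j c. j \<in> P \<Longrightarrow> d j = Some c \<Longrightarrow> c < b j \<and> b j \<le> K \<and> (m j - 1) * b j + c = s"
    and "\<And>j l. j \<in> P \<Longrightarrow> l \<in> P \<Longrightarrow> d j \<noteq> None \<Longrightarrow> d l \<noteq> None \<Longrightarrow> b j = b l \<Longrightarrow> j = l"
    and "\<And>j l. j \<in> P \<Longrightarrow> l \<in> P \<Longrightarrow> d j = None \<Longrightarrow> d l = None \<Longrightarrow> m j = m l \<Longrightarrow> j = l"
    and "\<And>j k. j \<in> P \<Longrightarrow> 2 \<le> k \<Longrightarrow> k < m j \<Longrightarrow> \<exists>l\<in>P. d l = None \<and> m l = k"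
    and "\<And>j c. j \<in> P \<Longrightarrow> d j = Some (Suc c) \<Longrightarrow> 2 \<le> m j \<Longrightarrow> \<exists>l\<in>P. d l = None \<and> m l = m j"
    and "\<exists>j\<in>P. m j = 1"
  shows "down_inv P K b s m d"
proof -
  have 1: "\<forall>j\<in>P. 1 \<le> m j \<and> (\<forall>c. d j = Some c \<longrightarrow> c < b j \<and> b j \<le> K \<and> (m j - 1) * b j + c = s)"
    using assms(1,2) by simp
  have 2: "\<forall>j\<in>P. \<forall>l\<in>P. d j \<noteq> None \<longrightarrow> d l \<noteq> None \<longrightarrow> b j = b l \<longrightarrow> j = l" using assms(3) by blast
  have 3: "\<forall>j\<in>P. \<forall>l\<in>P. d j = None \<longrightarrow> d l = None \<longrightarrow> m j = m l \<longrightarrow> j = l" using assms(4) by blast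
  have 4: "\<forall>j\<in>P. \<forall>k. 2 \<le> k \<longrightarrow> k < m j \<longrightarrow> (\<exists>l\<in>P. d l = None \<and> m l = k)" using assms(5) by blast
  have 5: "\<forall>j\<in>P. \<forall>c. d j = Some (Suc c) \<longrightarrow> 2 \<le> m j \<longrightarrow> (\<exists>l\<in>P. d l = None \<and> m l = m j)"
    using assms(6) by blast
  show ?thesis unfolding down_inv_def by (intro conjI 1 2 3 4 5 assms(7))
qed

lemma down_invD:
  assumes "down_inv P K b s m d"
  shows "j \<in> P \<Longrightarrow> 1 \<le> m j"
    and "j \<in> P \<Longrightarrow> d j = Some c \<Longrightarrow> c < b j \<and> b j \<le> K \<and> (m j - 1) * b j + c = s"
    and "j \<in> P \<Longrightarrow> l \<in> P \<Longrightarrow> d j \<noteq> None \<Longrightarrow> d l \<noteq> None \<Longrightarrow> b j = b l \<Longrightarrow> j = l"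
    and "j \<in> P \<Longrightarrow> l \<in> P \<Longrightarrow> d j = None \<Longrightarrow> d l = None \<Longrightarrow> m j = m l \<Longrightarrow> j = l"
    and "j \<in> P \<Longrightarrow> 2 \<le> k \<Longrightarrow> k < m j \<Longrightarrow> \<exists>l\<in>P. d l = None \<and> m l = k"
    and "j \<in> P \<Longrightarrow> d j = Some (Suc c) \<Longrightarrow> 2 \<le> m j \<Longrightarrow> \<exists>l\<in>P. d l = None \<and> m l = m j"
    and "\<exists>j\<in>P. m j = 1"
proof -
  note I = assms[unfolded down_inv_def]
  note I1 = I[THEN conjunct1] and I2 = I[THEN conjunct2, THEN conjunct1]
    and I3 = I[THEN conjunct2, THEN conjunct2, THEN conjunct1]
    and I4 = I[THEN conjunct2, THEN conjunct2, THEN conjunct2, THEN conjunct1]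
    and I5 = I[THEN conjunct2, THEN conjunct2, THEN conjunct2, THEN conjunct2, THEN conjunct1]
    and I6 = I[THEN conjunct2, THEN conjunct2, THEN conjunct2, THEN conjunct2, THEN conjunct2]
  show "j \<in> P \<Longrightarrow> 1 \<le> m j" using I1 by blast
  show "j \<in> P \<Longrightarrow> d j = Some c \<Longrightarrow> c < b j \<and> b j \<le> K \<and> (m j - 1) * b j + c = s" using I1 by blast
  show "j \<in> P \<Longrightarrow> l \<in> P \<Longrightarrow> d j \<noteq> None \<Longrightarrow> d l \<noteq> None \<Longrightarrow> b j = b l \<Longrightarrow> j = l" using I2 by blast
  show "j \<in> P \<Longrightarrow> l \<in> P \<Longrightarrow> d j = None \<Longrightarrow> d l = None \<Longrightarrow> m j = m l \<Longrightarrow> j = l" using I3 by blast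
  show "j \<in> P \<Longrightarrow> 2 \<le> k \<Longrightarrow> k < m j \<Longrightarrow> \<exists>l\<in>P. d l = None \<and> m l = k" using I4 by blast
  show "j \<in> P \<Longrightarrow> d j = Some (Suc c) \<Longrightarrow> 2 \<le> m j \<Longrightarrow> \<exists>l\<in>P. d l = None \<and> m l = m j" using I5 by blast
  show "\<exists>j\<in>P. m j = 1" by (rule I6)
qed

text \<open>Every index up to \<open>m j\<close> is the current index of some player: index 1 by the
  last conjunct, those in between through locked players, and \<open>m j\<close> through
  \<open>j\<close> herself.\<close>

lemma down_inv_le_card:
  assumes "down_inv P K b s m d" "finite P" "j \<in> P"
  shows "m j \<le> card P"
proof -
  have "{1..m j} \<subseteq> m ` P"
  proof
    fix k assume "k \<in> {1..m j}"
    then consider "k = 1" | "2 \<le> k" "k < m j" | "k = m j" by fastforce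
    thus "k \<in> m ` P"
    proof cases
      case 1
      thus ?thesis using down_invD(7)[OF assms(1)] by (metis imageI)
    next
      case 2
      thus ?thesis using down_invD(5)[OF assms(1,3)] by blast
    next
      case 3
      thus ?thesis using assms(3) by blast
    qed
  qed
  hence "card {1..m j} \<le> card (m ` P)" using assms by (intro card_mono) auto
  also have "\<dots> \<le> card P" using assms by (intro card_image_le)
  finally show ?thesis by simp
qed

text \<open>Index 1 differs from the others, since all players start there and may collide with
  nobody locked on it. It is kept occupied by the distinctness of the back-off times; at later
  indices, a collision always betrays a locked player.\<close>

lemma down_inv_step:
  fixes m :: "nat \<Rightarrow> nat" and d :: "nat \<Rightarrow> nat option"
  defines "col \<equiv> \<lambda>P j. \<exists>l\<in>P. l \<noteq> j \<and> m l = m j"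
  assumes inv: "down_inv P K b s m d" and P: "finite P" "card P \<le> K" and K: "K > 1"
    and m': "\<And>j. m' j = fst (down_next K (col P j) (b j) (m j) (d j))"
    and d': "\<And>j. d' j = snd (down_next K (col P j) (b j) (m j) (d j))"
  shows "down_inv P K b (Suc s) m' d'"
proof -
  have pos: "1 \<le> m j" if "j \<in> P" for j using down_invD(1)[OF inv] that by blast
  have bnd: "c < b j" "b j \<le> K" "(m j - 1) * b j + c = s" if "j \<in> P" "d j = Some c" for j c
    using down_invD(2)[OF inv] that by blast+
  have injb: "j = l" if "j \<in> P" "l \<in> P" "d j \<noteq> None" "d l \<noteq> None" "b j = b l" for j l
    using down_invD(3)[OF inv] that by blast
  have injm: "j = l" if "j \<in> P" "l \<in> P" "d j = None" "d l = None" "m j = m l" for j l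
    using down_invD(4)[OF inv] that by blast
  have down: "\<exists>l\<in>P. d l = None \<and> m l = k" if "j \<in> P" "2 \<le> k" "k < m j" for j k
    using down_invD(5)[OF inv] that by blast
  have stay: "\<exists>l\<in>P. d l = None \<and> m l = m j" if "j \<in> P" "d j = Some (Suc c)" "2 \<le> m j" for j c
    using down_invD(6)[OF inv] that by blast
  obtain j1 where j1: "j1 \<in> P" "m j1 = 1" using down_invD(7)[OF inv] by blast
  \<comment> \<open>If neither of two colliding trekkers has played here before, both have just
    arrived, so \<open>(m j - 1) * b\<close> equals the elapsed time for both and their back-off
    times agree.\<close>
  have X: "\<exists>l\<in>P. d l = None \<and> m l = m j" if j: "j \<in> P" "d j = Some c" "2 \<le> m j" "col P j" for j c
  proof (cases c)
    case (Suc c')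
    thus ?thesis using stay j by blast
  next
    case 0
    obtain l where l: "l \<in> P" "l \<noteq> j" "m l = m j" using j unfolding col_def by blast
    show ?thesis
    proof (cases "d l")
      case None
      thus ?thesis using l by blast
    next
      case (Some c')
      show ?thesis
      proof (cases c')
        case (Suc c'')
        thus ?thesis using stay[OF l(1)] Some l j by simp
      next
        case z: 0
        have "(m j - 1) * b j = (m j - 1) * b l"
          using bnd(3)[OF j(1,2)] bnd(3)[OF l(1) Some] 0 z l by simp
        hence "b j = b l" using j by simp
        thus ?thesis using injb[OF j(1) l(1)] j Some l by auto
      qed
    qed
  qed
  \<comment> \<open>The players other than \<open>j\<close> already cover the indices
    \<open>1, ..., m j\<close>, so \<open>m j\<close> is below the number of players. Hence the
    wrap-around in \<open>m j mod K + 1\<close> is never met.\<close>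
  have lt: "m j < K" if j: "j \<in> P" "d j = Some c" "col P j" for j c
  proof (cases "2 \<le> m j")
    case True
    then obtain l where l: "l \<in> P" "d l = None" "m l = m j" using X j by blast
    have "{1..m j} \<subseteq> m ` (P - {j})"
    proof
      fix k assume "k \<in> {1..m j}"
      then consider "k = 1" | "2 \<le> k" "k < m j" | "k = m j" by fastforce
      thus "k \<in> m ` (P - {j})"
      proof cases
        case 1
        thus ?thesis using j1 True by (intro image_eqI[of _ _ j1]) auto
      next
        case 2
        then obtain l' where "l' \<in> P" "d l' = None" "m l' = k" using down j by blast
        thus ?thesis using j by (intro image_eqI[of _ _ l']) auto
      next
        case 3
        thus ?thesis using j l by (intro image_eqI[of _ _ l]) auto
      qed
    qed
    hence "card {1..m j} \<le> card (m ` (P - {j}))" using P by (intro card_mono) auto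
    also have "\<dots> \<le> card (P - {j})" using P by (intro card_image_le) auto
    also have "\<dots> < card P" using j P by (intro psubset_card_mono) auto
    finally show ?thesis using P by simp
  qed (use K in auto)
  define mv where "mv = (\<lambda>j. \<exists>c. d j = Some c \<and> col P j \<and> \<not> Suc c < b j)"
  have mm: "m' j = (if mv j then Suc (m j) else m j)" if "j \<in> P" for j
    using lt[OF that] unfolding m' mv_def down_next_def by (auto split: option.splits)
  have None': "d' j = None" "m' j = m j" if "d j = None" for j
    using that unfolding m' d' down_next_def by auto
  have Some': "\<exists>c0. d j = Some c0 \<and> col P j \<and> (if mv j then c = 0 \<and> Suc c0 = b j else c = Suc c0 \<and> Suc c0 < b j)"
    if "j \<in> P" "d' j = Some c" for j c
    using bnd(1)[OF that(1)] that(2) unfolding d' mv_def down_next_def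
    by (auto split: option.splits if_splits)
  have newlock: "\<not> col P j" if "d' j = None" "d j \<noteq> None" for j
    using that unfolding d' down_next_def by (auto split: option.splits if_splits)
  have lockpos: "m' j = m j" if "j \<in> P" "d' j = None" for j
    using that unfolding d' m' down_next_def by (auto split: option.splits if_splits)
  have persist: "\<exists>l\<in>P. d' l = None \<and> m' l = k" if "\<exists>l\<in>P. d l = None \<and> m l = k" for k
    using that None' by metis
  have "1 \<le> m' j" if "j \<in> P" for j using mm[OF that] pos[OF that] by auto
  moreover have "c < b j \<and> b j \<le> K \<and> (m' j - 1) * b j + c = Suc s" if j: "j \<in> P" "d' j = Some c" for j c
  proof -
    obtain c0 where c0: "d j = Some c0"
      "if mv j then c = 0 \<and> Suc c0 = b j else c = Suc c0 \<and> Suc c0 < b j"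
      using Some'[OF j] by blast
    obtain n where n: "m j = Suc n" using pos[OF j(1)] by (cases "m j") auto
    show ?thesis using c0 bnd[OF j(1) c0(1)] mm[OF j(1)] n by (cases "mv j") auto
  qed
  moreover have "j = l" if jl: "j \<in> P" "l \<in> P" "d' j \<noteq> None" "d' l \<noteq> None" "b j = b l" for j l
    using injb[OF jl(1,2)] jl None' by metis
  moreover have "j = l" if jl: "j \<in> P" "l \<in> P" "d' j = None" "d' l = None" "m' j = m' l" for j l
  proof (rule ccontr)
    assume ne: "j \<noteq> l"
    have e: "m j = m l" using jl lockpos by metis
    hence "col P j" "col P l" using jl ne unfolding col_def by auto
    hence "d j = None" "d l = None" using newlock jl by blast+
    thus False using injm e ne jl by blast
  qed
  moreover have "\<exists>l\<in>P. d' l = None \<and> m' l = k" if j: "j \<in> P" "2 \<le> k" "k < m' j" for j k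
  proof (rule persist)
    show "\<exists>l\<in>P. d l = None \<and> m l = k"
    proof (cases "k < m j")
      case True
      thus ?thesis using down j by blast
    next
      case False
      hence "mv j" "k = m j" using mm[OF j(1)] j by (auto split: if_splits)
      thus ?thesis using X[OF j(1)] j unfolding mv_def by blast
    qed
  qed
  moreover have "\<exists>l\<in>P. d' l = None \<and> m' l = m' j" if j: "j \<in> P" "d' j = Some (Suc c)" "2 \<le> m' j" for j c
  proof (rule persist)
    obtain c0 where c0: "d j = Some c0" "col P j" "\<not> mv j" using Some'[OF j(1,2)] by (auto split: if_splits)
    thus "\<exists>l\<in>P. d l = None \<and> m l = m' j" using X[OF j(1)] j mm[OF j(1)] by simp
  qed
  \<comment> \<open>If index 1 were deserted in this round, everybody on it would have exhausted a
    back-off time of exactly \<open>Suc s\<close>; since leaving requires a collision there are at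
    least two such players, against distinctness.\<close>
  moreover have "\<exists>j\<in>P. m' j = 1"
  proof (rule ccontr)
    assume no: "\<not> ?thesis"
    have all: "\<exists>c. d j = Some c \<and> col P j \<and> b j = Suc s" if j: "j \<in> P" "m j = 1" for j
    proof -
      have "mv j" using no j mm[OF j(1)] by (cases "mv j") auto
      then obtain c where c: "d j = Some c" "col P j" "\<not> Suc c < b j" unfolding mv_def by blast
      thus ?thesis using bnd[OF j(1) c(1)] j by simp
    qed
    obtain l where l: "l \<in> P" "l \<noteq> j1" "m l = 1" using all[OF j1] j1 unfolding col_def by auto
    thus False using all[OF j1] all[OF l(1,3)] injb[OF j1(1) l(1)] by auto
  qed
  ultimately show ?thesis by (rule down_invI)
qed

section \<open>Both variants settle within \<open>K * K\<close> rounds\<close>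

lemma start_trek_nth:
  assumes "distinct r" "length r = K" "i \<in> {1..K}"
  shows "start_trek K V r (r ! (i - 1)) =
    (if i = 1 then Locked (r ! 0) else case V of TrekU \<Rightarrow> Trek_Up r i 0 | TrekD \<Rightarrow> Trek_Down r (K - i + 1) 1 0)"
proof -
  have "(THE i'. i' \<in> {1..K} \<and> r ! (i' - 1) = r ! (i - 1)) = i"
  proof (rule the_equality)
    fix i' assume "i' \<in> {1..K} \<and> r ! (i' - 1) = r ! (i - 1)"
    moreover have "i' - 1 < length r" "i - 1 < length r" using calculation assms by auto
    ultimately show "i' = i" using assms by (auto simp: nth_eq_iff_index_eq)
  qed (use assms in simp)
  thus ?thesis unfolding start_trek_def by simp
qed

text \<open>Trekking states ignore the draws, the waiting choices, the round and the arm handed to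
  \<open>observe\<close>, so \<open>u\<close>, \<open>w\<close>, \<open>t\<close> and
  \<open>f\<close> may be arbitrary here. The initial arms only have to be distinct; the invariants
  then determine the outcome.\<close>

lemma trek_settles:
  fixes Q :: "nat \<Rightarrow> nat \<Rightarrow> local_state"
  assumes P: "finite P" "card P \<le> K" and K: "K > 1" and r: "distinct r" "length r = K"
    and a: "inj_on a P" "\<And>j. j \<in> P \<Longrightarrow> a j \<in> set r"
    and init: "\<And>j. j \<in> P \<Longrightarrow> Q 0 j = start_trek K V r (a j)"
    and step: "\<And>s j. s < n \<Longrightarrow> j \<in> P \<Longrightarrow> Q (Suc s) j =
        observe K (t s) (f s j) (dynamic_trekking.collides (plays K P (u s) (w s) (Q s)) j) (Q s j)"
    and n: "n \<ge> K * K"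
  shows "settled P r (Q n)"
proof (cases "P = {}")
  case True
  thus ?thesis unfolding settled_def by (auto simp: bij_betw_def)
next
  case ne: False
  have "\<exists>i. i \<in> {1..K} \<and> r ! (i - 1) = a j" if j: "j \<in> P" for j
  proof -
    obtain k where "k < K" "r ! k = a j" using a(2)[OF j] r by (auto simp: in_set_conv_nth)
    thus ?thesis by (intro exI[of _ "Suc k"]) auto
  qed
  then obtain i0 where i0: "\<And>j. j \<in> P \<Longrightarrow> i0 j \<in> {1..K} \<and> r ! (i0 j - 1) = a j" by metis
  have i0inj: "inj_on i0 P" using a(1) i0 unfolding inj_on_def by metis
  have Q0: "Q 0 j = (if i0 j = 1 then Locked (r ! 0) else case V of TrekU \<Rightarrow> Trek_Up r (i0 j) 0 | TrekD \<Rightarrow> Trek_Down r (K - i0 j + 1) 1 0)"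
    if "j \<in> P" for j using init[OF that] start_trek_nth[OF r, of "i0 j" V] i0[OF that] by simp
  show ?thesis
  proof (cases V)
    case TrekU
    have "\<exists>i d. up_inv P K s i d \<and> (\<forall>j\<in>P. Q s j = up_state r (i j) (d j))" if "s \<le> n" for s
      using that
    proof (induction s)
      case 0
      let ?d = "\<lambda>j. if i0 j = 1 then None else Some 0"
      have "i0 j * (i0 j - 1) \<le> K * (K - 1)" if "j \<in> P" for j
        using i0[OF that] by (intro mult_le_mono) auto
      hence "up_inv P K 0 i0 ?d"
        using i0inj i0 by (intro up_invI) (fastforce split: if_splits)+
      moreover have "\<forall>j\<in>P. Q 0 j = up_state r (i0 j) (?d j)"
        using Q0 TrekU by (auto simp: up_state_def)
      ultimately show ?case by blast
    next
      case (Suc s)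
      then obtain i d where inv: "up_inv P K s i d" and q: "\<And>j. j \<in> P \<Longrightarrow> Q s j = up_state r (i j) (d j)" by auto
      let ?col = "\<lambda>j. \<exists>l\<in>P. l \<noteq> j \<and> up_pos (i l) (d l) = up_pos (i j) (d j)"
      let ?i = "\<lambda>j. fst (up_next (?col j) (i j) (d j))" and ?d = "\<lambda>j. snd (up_next (?col j) (i j) (d j))"
      have "up_inv P K (Suc s) ?i ?d" by (rule up_inv_step[OF inv]) simp_all
      moreover have "Q (Suc s) j = up_state r (?i j) (?d j)" if j: "j \<in> P" for j
      proof -
        have pos: "up_pos (i j) (d j) \<in> {1..length r}" if "j \<in> P" for j
          using up_invD(2)[OF inv that] up_invD(3)[OF inv that] r(2) by (auto simp: up_pos_def split: option.splits)
        have pl: "plays K P (u s) (w s) (Q s) l = (if l \<in> P then Some (r ! (up_pos (i l) (d l) - 1)) else None)" for l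
          using q by (auto simp: plays_def up_state_def up_pos_def numeral_2_eq_2 split: option.splits)
        have "dynamic_trekking.collides (plays K P (u s) (w s) (Q s)) j \<longleftrightarrow> ?col j"
          by (rule collides_nth_iff[OF pl pos r(1) j])
        thus ?thesis using step[of s j] Suc.prems j by (simp only: q[OF j] observe_up_state)
      qed
      ultimately show ?case by blast
    qed
    then obtain i d where inv: "up_inv P K n i d" and q: "\<And>j. j \<in> P \<Longrightarrow> Q n j = up_state r (i j) (d j)" by blast
    \<comment> \<open>For a trekking player \<open>2 * c\<close> is at most
      \<open>i (i - 1)\<close>, so the time budget would force
      \<open>2 * n \<le> K (K - 1)\<close>.\<close>
    have dN: "d j = None" if j: "j \<in> P" for j
    proof (rule ccontr)
      assume "d j \<noteq> None"
      then obtain c where c: "d j = Some c" by auto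
      have b: "c < i j - 1" "2 * n + i j * (i j - 1) \<le> K * (K - 1) + 2 * c" "1 \<le> i j"
        using up_invD(3)[OF inv j c] by auto
      have "Suc (Suc 0) \<le> i j" using b(1) by simp
      then obtain e where e: "i j = Suc (Suc e)" by (metis Suc_le_D Suc_le_mono)
      have "2 * c \<le> i j * (i j - 1)" using b(1) unfolding e by simp
      moreover have "K * (K - 1) < K * K" using K by simp
      ultimately show False using b n by linarith
    qed
    have "bij_betw i P {1..card P}"
    proof (rule inj_on_downward_closed)
      show "finite P" by fact
      show "inj_on i P" "\<And>j. j \<in> P \<Longrightarrow> 1 \<le> i j" using up_invD(1,2)[OF inv] by auto
      show "k \<in> i ` P" if "j \<in> P" "1 \<le> k" "k < i j" for j k
        using up_invD(5)[OF inv that(1) dN[OF that(1)] that(2,3)] by blast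
    qed
    thus ?thesis unfolding settled_def using q dN by (auto simp: up_state_def)
  next
    case TrekD
    define b where "b = (\<lambda>j. K - i0 j + 1)"
    have "\<exists>m d. down_inv P K b s m d \<and> (\<forall>j\<in>P. Q s j = down_state r (b j) (m j) (d j))" if "s \<le> n" for s
      using that
    proof (induction s)
      case 0
      let ?d = "\<lambda>j. if i0 j = 1 then None else Some 0"
      have binj: "j = l" if "j \<in> P" "l \<in> P" "b j = b l" for j l
      proof -
        have "i0 j = i0 l" using i0[OF that(1)] i0[OF that(2)] that(3) unfolding b_def by auto
        thus ?thesis using i0inj that(1,2) by (auto dest: inj_onD)
      qed
      have brng: "1 \<le> b j" "i0 j \<noteq> 1 \<Longrightarrow> b j \<le> K" if "j \<in> P" for j using i0[OF that] unfolding b_def by auto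
      have "down_inv P K b 0 (\<lambda>j. 1) ?d"
      proof (rule down_invI)
        show "c < b j \<and> b j \<le> K \<and> (1 - 1) * b j + c = 0" if "j \<in> P" "?d j = Some c" for j c
          using brng[OF that(1)] that(2) by (auto split: if_splits)
        show "j = l" if "j \<in> P" "l \<in> P" "?d j = None" "?d l = None" "(1 :: nat) = 1" for j l
        proof -
          have "i0 j = i0 l" using that(3,4) by (auto split: if_splits)
          thus ?thesis using i0inj that(1,2) by (auto dest: inj_onD)
        qed
        show "\<exists>j\<in>P. (1 :: nat) = 1" using ne by auto
      qed (use binj in auto)
      moreover have "\<forall>j\<in>P. Q 0 j = down_state r (b j) 1 (?d j)"
        using Q0 TrekD by (auto simp: down_state_def b_def)
      ultimately show ?case by blast
    next
      case (Suc s)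
      then obtain m d where inv: "down_inv P K b s m d" and q: "\<And>j. j \<in> P \<Longrightarrow> Q s j = down_state r (b j) (m j) (d j)" by auto
      let ?col = "\<lambda>j. \<exists>l\<in>P. l \<noteq> j \<and> m l = m j"
      let ?m = "\<lambda>j. fst (down_next K (?col j) (b j) (m j) (d j))" and ?d = "\<lambda>j. snd (down_next K (?col j) (b j) (m j) (d j))"
      have "down_inv P K b (Suc s) ?m ?d" by (rule down_inv_step[OF inv P K]) simp_all
      moreover have "Q (Suc s) j = down_state r (b j) (?m j) (?d j)" if j: "j \<in> P" for j
      proof -
        have pos: "m j \<in> {1..length r}" if "j \<in> P" for j
          using down_inv_le_card[OF inv P(1) that] down_invD(1)[OF inv that] r P by auto
        have pl: "plays K P (u s) (w s) (Q s) l = (if l \<in> P then Some (r ! (m l - 1)) else None)" for l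
          using q by (auto simp: plays_def down_state_def split: option.splits)
        have "dynamic_trekking.collides (plays K P (u s) (w s) (Q s)) j \<longleftrightarrow> ?col j"
          by (rule collides_nth_iff[OF pl pos r(1) j])
        thus ?thesis using step[of s j] Suc.prems j by (simp only: q[OF j] observe_down_state)
      qed
      ultimately show ?case by blast
    qed
    then obtain m d where inv: "down_inv P K b n m d" and q: "\<And>j. j \<in> P \<Longrightarrow> Q n j = down_state r (b j) (m j) (d j)" by blast
    \<comment> \<open>The clock of a trekking player gives
      \<open>n = (m - 1) * b + c < m * b\<close>, and both \<open>m\<close> and \<open>b\<close> are
      at most \<open>K\<close>.\<close>
    have dN: "d j = None" if j: "j \<in> P" for j
    proof (rule ccontr)
      assume "d j \<noteq> None"
      then obtain c where c: "d j = Some c" by auto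
      have b: "c < b j" "b j \<le> K" "(m j - 1) * b j + c = n" "1 \<le> m j"
        using down_invD(1)[OF inv j] down_invD(2)[OF inv j c] by blast+
      obtain e where e: "m j = Suc e" using b by (cases "m j") auto
      have "n < m j * b j" using b unfolding e by simp
      also have "\<dots> \<le> K * K" using down_inv_le_card[OF inv P(1) j] P b by (intro mult_le_mono) auto
      finally show False using n by simp
    qed
    have "bij_betw m P {1..card P}"
    proof (rule inj_on_downward_closed)
      show "finite P" by fact
      show "inj_on m P" "\<And>j. j \<in> P \<Longrightarrow> 1 \<le> m j" using down_invD(1,4)[OF inv] dN unfolding inj_on_def by blast+
      show "k \<in> m ` P" if "j \<in> P" "1 \<le> k" "k < m j" for j k
      proof (cases "k = 1")
        case True
        thus ?thesis using down_invD(7)[OF inv] by (metis imageI)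
      next
        case False
        hence "2 \<le> k" using that by simp
        thus ?thesis using down_invD(5)[OF inv that(1)] that by blast
      qed
    qed
    thus ?thesis unfolding settled_def using q dN by (auto simp: down_state_def)
  qed
qed

subsection \<open>Undisturbed epochs\<close>

text \<open>Errors below \<open>\<epsilon> / 2\<close> cannot reverse neighbouring means more than
  \<open>\<epsilon>\<close> apart, so the empirical means strictly decrease along
  \<open>\<sigma>\<close>. Strictness also removes ties, so that sorting leaves no choice.\<close>

lemma empirical_order_eq:
  assumes \<sigma>: "bij_betw \<sigma> {1..K} {1..K}"
    and gap: "\<And>i. i \<in> {1..K - 1} \<Longrightarrow> \<epsilon> < \<mu> (\<sigma> i) - \<mu> (\<sigma> (i + 1))"
    and close: "\<And>k. k \<in> {1..K} \<Longrightarrow> \<bar>m k - \<mu> k\<bar> < \<epsilon> / 2"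
  shows "empirical_order K m = map \<sigma> [1..<Suc K]"
proof -
  let ?f = "\<lambda>k. - m k"
  have step: "?f (\<sigma> i) < ?f (\<sigma> (Suc i))" if i: "1 \<le> i" "Suc i \<le> K" for i
  proof -
    have "\<sigma> i \<in> {1..K}" "\<sigma> (Suc i) \<in> {1..K}" using bij_betw_apply[OF \<sigma>, of i] bij_betw_apply[OF \<sigma>, of "Suc i"] i by auto
    note close[OF this(1)] close[OF this(2)]
    moreover have "\<epsilon> < \<mu> (\<sigma> i) - \<mu> (\<sigma> (Suc i))" using gap[of i] i by simp
    ultimately show ?thesis by linarith
  qed
  have mono: "?f (\<sigma> i) < ?f (\<sigma> (i + Suc d))" if "1 \<le> i" "i + Suc d \<le> K" for i d
    using that
  proof (induction d)
    case 0
    thus ?case using step[of i] by simp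
  next
    case (Suc d)
    hence "?f (\<sigma> i) < ?f (\<sigma> (i + Suc d))" by simp
    also have "\<dots> < ?f (\<sigma> (Suc (i + Suc d)))" using Suc.prems by (intro step) auto
    finally show ?case by simp
  qed
  have "sorted_wrt (<) (map ?f (map \<sigma> [1..<Suc K]))"
    unfolding map_map
  proof (rule sorted_wrt_map_mono[OF sorted_wrt_upt])
    fix i i' assume "i \<in> set [1..<Suc K]" "i' \<in> set [1..<Suc K]" "i < i'"
    moreover from this obtain d where d: "i' = i + Suc d" by (metis add_Suc_right less_imp_Suc_add)
    ultimately have "1 \<le> i" "i + Suc d \<le> K" unfolding set_upt by auto
    thus "(?f \<circ> \<sigma>) i < (?f \<circ> \<sigma>) i'" using mono[of i d] d by simp
  qed
  hence ys: "sorted (map ?f (map \<sigma> [1..<Suc K]))" "distinct (map ?f (map \<sigma> [1..<Suc K]))"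
    by (auto simp only: strict_sorted_iff)
  have set: "set (map \<sigma> [1..<Suc K]) = {1..K}"
  proof -
    have "set [1..<Suc K] = {1..K}" by auto
    thus ?thesis using \<sigma> by (simp only: set_map bij_betw_def)
  qed
  have eo: "set (empirical_order K m) = {1..K}" "distinct (empirical_order K m)"
    unfolding empirical_order_def by auto
  have inj: "inj_on ?f {1..K}" using ys(2) set by (metis distinct_map)
  \<comment> \<open>Uniqueness of sorted distinct lists is applied to the keys and pulled back along
    their injectivity.\<close>
  have "map ?f (empirical_order K m) = map ?f (map \<sigma> [1..<Suc K])"
  proof (rule sorted_distinct_set_unique[OF _ _ ys])
    show "sorted (map ?f (empirical_order K m))" unfolding empirical_order_def by (rule sorted_sort_key)
    show "distinct (map ?f (empirical_order K m))" using eo inj by (simp only: distinct_map)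
    show "set (map ?f (empirical_order K m)) = set (map ?f (map \<sigma> [1..<Suc K]))"
      using eo set by (metis set_map)
  qed
  thus ?thesis by (rule map_inj_on) (use eo set inj in auto)
qed

text \<open>An invariant for all rounds, including those of disturbed epochs: the bound on the
  regret of an arbitrary round uses that the mean of the played arm is nonnegative, which is known
  for the arms \<open>1, ..., K\<close> only.\<close>

fun valid_state :: "nat \<Rightarrow> local_state \<Rightarrow> bool" where
  "valid_state K (Trek_Up r i c) \<longleftrightarrow> set r = {1..K} \<and> length r = K \<and> 2 \<le> i \<and> i \<le> K"
| "valid_state K (Trek_Down r b m c) \<longleftrightarrow> set r = {1..K} \<and> length r = K \<and> 1 \<le> m \<and> m \<le> K"
| "valid_state K (Locked a) \<longleftrightarrow> a \<in> {1..K}"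
| "valid_state K _ \<longleftrightarrow> True"

lemma nth_in_arms: "set r = {1..K} \<Longrightarrow> length r = K \<Longrightarrow> n < K \<Longrightarrow> r ! n \<in> {1..K}"
  using nth_mem by metis

lemma select_arm_valid:
  assumes K: "K > 0" and "valid_state K q" "u \<in> {1..K}" "w \<in> insert None (Some ` {1..K})"
    and "select_arm K u w q = Some a"
  shows "a \<in> {1..K}"
proof (cases q)
  case (Hop_Seq b h)
  thus ?thesis using assms by (auto simp: Suc_le_eq)
next
  case (Trek_Up r i c)
  hence "i - 2 < K" "a = r ! (i - 2)" using assms by auto
  thus ?thesis using nth_in_arms[of r K "i - 2"] Trek_Up assms(2) by simp
next
  case (Trek_Down r b m c)
  hence "m - 1 < K" "a = r ! (m - 1)" using assms by auto
  thus ?thesis using nth_in_arms[of r K "m - 1"] Trek_Down assms(2) by simp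
qed (use assms in auto)

lemma observe_valid:
  assumes K: "K > 0" and q: "valid_state K q"
  shows "valid_state K (observe K t a col q)"
proof (cases q)
  case (Trek_Up r i c)
  hence "i - 1 < K" "0 < K" using q by auto
  thus ?thesis using nth_in_arms[of r K "i - 1"] nth_in_arms[of r K 0] Trek_Up q by auto
next
  case (Trek_Down r b m c)
  hence "m - 1 < K" using q by auto
  moreover have "m mod K + 1 \<le> K" using K by (simp add: Suc_le_eq)
  ultimately show ?thesis using nth_in_arms[of r K "m - 1"] Trek_Down q by auto
qed (use assms in auto)

lemma start_trek_valid:
  assumes K: "K > 0" and a: "a \<in> {1..K}"
  shows "valid_state K (start_trek K V (empirical_order K m) a)"
proof -
  let ?r = "empirical_order K m"
  have r: "set ?r = {1..K}" "length ?r = K" "distinct ?r" unfolding empirical_order_def by auto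
  obtain i where i: "i < K" "?r ! i = a" using a r by (metis in_set_conv_nth)
  have "Suc i \<in> {1..K}" "?r ! (Suc i - 1) = a" using i by auto
  hence s: "start_trek K V ?r a = (if Suc i = 1 then Locked (?r ! 0) else case V of TrekU \<Rightarrow> Trek_Up ?r (Suc i) 0 | TrekD \<Rightarrow> Trek_Down ?r (K - Suc i + 1) 1 0)"
    using start_trek_nth[OF r(3,2), of "Suc i" V] by simp
  show ?thesis
  proof (cases i)
    case 0
    thus ?thesis unfolding s using nth_in_arms[OF r(1,2) K] by simp
  next
    case (Suc n)
    hence c: "(Suc i = 1) = False" by simp
    show ?thesis unfolding s c if_False using Suc i r K by (cases V) auto
  qed
qed

lemma finish_learning_valid:
  assumes "K > 0" "a \<in> {1..K}" "valid_state K q"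
  shows "valid_state K (finish_learning K V X a q)"
  using start_trek_valid[OF assms(1,2)] assms(3) by (cases q) auto

context dynamic_trekking
begin

lemma play_eq_plays: "play \<omega> t q = plays K (present t) (\<lambda>j. fst \<omega> (j, t)) (\<lambda>j. W j t \<omega>) q"
  by (auto simp: play_def plays_def)

lemma states_valid:
  assumes K: "K > 0" and u: "\<And>jt. fst \<omega> jt \<in> {1..K}" and w: "\<And>j t. W j t \<omega> \<in> insert None (Some ` {1..K})"
  shows "valid_state K (states \<omega> t j)"
proof (induction t arbitrary: j)
  case (Suc t)
  have "valid_state K (step \<omega> t (states \<omega> t) j)"
  proof (cases "play \<omega> t (states \<omega> t) j")
    case None
    thus ?thesis using Suc by (simp add: step_def)
  next
    case (Some a)
    hence "a \<in> {1..K}"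
      using select_arm_valid[OF K Suc u w] by (auto simp: play_def split: if_splits)
    thus ?thesis using Some observe_valid[OF K Suc] finish_learning_valid[OF K]
      by (simp add: step_def Let_def)
  qed
  thus ?case by simp
qed simp

lemma arm_played_valid:
  assumes K: "K > 0" and u: "\<And>jt. fst \<omega> jt \<in> {1..K}" and w: "\<And>j t. W j t \<omega> \<in> insert None (Some ` {1..K})"
    and "arm_played \<omega> t j = Some a"
  shows "a \<in> {1..K}"
  using assms(4) select_arm_valid[OF K states_valid[OF K u w] u w]
  unfolding arm_played_def play_def by (auto split: if_splits)

lemma states_Suc_epoch:
  assumes e: "e \<notin> changing_epochs T" "e * E + Suc s < T" "Suc s < E" and j: "j \<in> present (e * E)"
  shows "states \<omega> (e * E + Suc s) j = step \<omega> (e * E + s) (states \<omega> (e * E + s)) j"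
proof -
  have "present (Suc (e * E + s)) = present (e * E)" using present_const[OF e] by simp
  moreover have "\<not> E dvd Suc (e * E + s)"
  proof
    assume "E dvd Suc (e * E + s)"
    hence "E dvd e * E + Suc s" by simp
    hence "E dvd Suc s" by (metis dvd_add_right_iff dvd_triv_right)
    thus False using e(3) by (auto dest: dvd_imp_le)
  qed
  ultimately show ?thesis using j by simp
qed

text \<open>Everybody present in an undisturbed epoch restarted at its first round, so no waiting
  choice enters and the plays are those of \<open>hop_states\<close>. The restriction
  \<open>s < L\<close> stops before \<open>finish_learning\<close> acts, which happens in round
  \<open>L - 1\<close> of the epoch.\<close>

lemma states_learning:
  assumes e: "e \<notin> changing_epochs T" "e * E + s < T" and s: "s < L" "L \<le> E" and j: "j \<in> present (e * E)"
  shows "states \<omega> (e * E + s) j = hop_states K (present (e * E)) (e * E) (fst \<omega>) s j"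
  using assms
proof (induction s arbitrary: j)
  case 0
  show ?case
  proof (cases "e * E")
    case (Suc m)
    have "E dvd Suc m" by (metis Suc dvd_triv_right)
    thus ?thesis using 0 Suc by simp
  qed (use 0 in simp)
next
  case (Suc s)
  let ?P = "present (e * E)"
  have pres: "present (e * E + s) = ?P" using present_const[OF e(1), of s] Suc.prems by simp
  have IH: "states \<omega> (e * E + s) l = hop_states K ?P (e * E) (fst \<omega>) s l" if "l \<in> ?P" for l
    using Suc.IH[of l] Suc.prems that by simp
  have pl: "play \<omega> (e * E + s) (states \<omega> (e * E + s)) = hop_plays K ?P (e * E) (fst \<omega>) s"
  proof
    fix l
    show "play \<omega> (e * E + s) (states \<omega> (e * E + s)) l = hop_plays K ?P (e * E) (fst \<omega>) s l"
      using IH[of l] by (cases K ?P "e * E" "fst \<omega>" s l rule: hop_states_cases)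
        (auto simp: play_def hop_plays_def plays_def pres)
  qed
  have "(e * E + s) mod E \<noteq> L - 1" using Suc.prems by simp
  hence "step \<omega> (e * E + s) (states \<omega> (e * E + s)) j = hop_states K ?P (e * E) (fst \<omega>) (Suc s) j"
    using hop_plays_eq[OF Suc.prems(5), of K "e * E" "fst \<omega>" s] IH[OF Suc.prems(5)]
    unfolding step_def pl hop_states_Suc by (simp add: Let_def)
  thus ?case using states_Suc_epoch[of e T s j \<omega>] Suc.prems by simp
qed

text \<open>The interface between probability and dynamics: given this event in every epoch, the
  rest of the argument is deterministic. Random hopping must be over after \<open>n\<close> rounds,
  while accuracy is required after all \<open>L\<close>.\<close>

definition good_learning :: "(nat \<Rightarrow> real) \<Rightarrow> real \<Rightarrow> nat \<Rightarrow> nat \<Rightarrow> sample \<Rightarrow> bool" where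
  "good_learning \<mu> \<epsilon> n e \<omega> \<longleftrightarrow>
     (\<forall>jt. fst \<omega> jt \<in> {1..K}) \<and>
     (\<forall>j\<in>present (e * E). hop_states K (present (e * E)) (e * E) (fst \<omega>) n j \<noteq> Hop_Random) \<and>
     (\<forall>j\<in>present (e * E). \<forall>k\<in>{1..K}.
        \<bar>empirical_mean (\<lambda>t k. snd \<omega> (j, t, k))
           (hop_history (hop_states K (present (e * E)) (e * E) (fst \<omega>) L j)) k - \<mu> k\<bar> < \<epsilon> / 2)"

text \<open>The last learning round is replayed separately because there \<open>observe\<close> is
  followed by \<open>finish_learning\<close>. Players leave it on distinct arms and, by the accuracy
  of their estimates, with the same order.\<close>

lemma states_after_learning:
  assumes K: "K > 0" and \<sigma>: "bij_betw \<sigma> {1..K} {1..K}"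
    and gap: "\<And>i. i \<in> {1..K - 1} \<Longrightarrow> \<epsilon> < \<mu> (\<sigma> i) - \<mu> (\<sigma> (i + 1))"
    and good: "good_learning \<mu> \<epsilon> n e \<omega>"
    and n: "n \<le> L" and L: "0 < L" "L < E" and e: "e \<notin> changing_epochs T" "e * E + L < T"
  shows "\<exists>a. inj_on a (present (e * E)) \<and> (\<forall>j\<in>present (e * E). a j \<in> {1..K} \<and>
    states \<omega> (e * E + L) j = start_trek K V (map \<sigma> [1..<Suc K]) (a j))"
proof -
  let ?P = "present (e * E)" and ?h = "hop_states K (present (e * E)) (e * E) (fst \<omega>)"
  let ?I = "hop_plays K (present (e * E)) (e * E) (fst \<omega>) (L - 1)"
  have u: "\<And>jt. fst \<omega> jt \<in> {1..K}" and hn: "\<forall>j\<in>?P. ?h n j \<noteq> Hop_Random"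
    and close: "\<And>j k. j \<in> ?P \<Longrightarrow> k \<in> {1..K} \<Longrightarrow> \<bar>empirical_mean (\<lambda>t k. snd \<omega> (j, t, k)) (hop_history (?h L j)) k - \<mu> k\<bar> < \<epsilon> / 2"
    using good unfolding good_learning_def by blast+
  have "\<exists>a h. ?h L j = Hop_Seq a h" if "j \<in> ?P" for j
    using hop_states_cyclic[OF K u hn that, of "L - n"] n by auto
  then obtain a h where ah: "\<And>j. j \<in> ?P \<Longrightarrow> ?h L j = Hop_Seq (a j) (h j)" by metis
  have "inj_on a ?P"
    using hop_arms_distinct[OF K u _ _ _ ah ah] by (auto simp: inj_on_def)
  moreover have "a j \<in> {1..K} \<and> states \<omega> (e * E + L) j = start_trek K V (map \<sigma> [1..<Suc K]) (a j)" if j: "j \<in> ?P" for j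
  proof
    show "a j \<in> {1..K}" by (rule hop_arm_range[OF K u j ah[OF j]])
    have L1: "Suc (L - 1) = L" using L by simp
    let ?t = "e * E + (L - 1)"
    have pres: "present ?t = ?P" using present_const[OF e(1), of "L - 1"] L e by simp
    have st: "states \<omega> ?t l = ?h (L - 1) l" if "l \<in> ?P" for l
      using states_learning[OF e(1), of "L - 1" l] that L e by simp
    have pl: "play \<omega> ?t (states \<omega> ?t) = ?I"
    proof
      fix l
      show "play \<omega> ?t (states \<omega> ?t) l = ?I l"
        using st[of l] by (cases K ?P "e * E" "fst \<omega>" "L - 1" l rule: hop_states_cases)
          (auto simp: play_def hop_plays_def plays_def pres simp del: One_nat_def)
    qed
    have I: "?I j = Some (a j)" using hop_states_last_arm[OF j, of K "e * E" "fst \<omega>" "L - 1"] ah[OF j] L1 by simp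
    have obs: "observe K ?t (a j) (collides ?I j) (states \<omega> ?t j) = Hop_Seq (a j) (h j)"
      using hop_states_Suc[of K ?P "e * E" "fst \<omega>" "L - 1" j] I ah[OF j] L1 st[OF j] by simp
    have "?t mod E = (L - 1) mod E" by (rule mod_mult_self3)
    hence "?t mod E = L - 1" using L by simp
    hence "step \<omega> ?t (states \<omega> ?t) j =
      start_trek K V (empirical_order K (empirical_mean (\<lambda>t k. snd \<omega> (j, t, k)) (h j))) (a j)"
      unfolding step_def pl I using obs by (simp add: Let_def)
    also have "empirical_order K (empirical_mean (\<lambda>t k. snd \<omega> (j, t, k)) (h j)) = map \<sigma> [1..<Suc K]"
      using empirical_order_eq[OF \<sigma> gap] close[OF j] ah[OF j] by (simp add: hop_history_def)
    finally show "states \<omega> (e * E + L) j = start_trek K V (map \<sigma> [1..<Suc K]) (a j)"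
      using states_Suc_epoch[of e T "L - 1" j \<omega>] e L L1 j by simp
  qed
  ultimately show ?thesis by blast
qed

lemma states_settled:
  assumes K: "K > 1" and \<sigma>: "bij_betw \<sigma> {1..K} {1..K}"
    and gap: "\<And>i. i \<in> {1..K - 1} \<Longrightarrow> \<epsilon> < \<mu> (\<sigma> i) - \<mu> (\<sigma> (i + 1))"
    and good: "good_learning \<mu> \<epsilon> n e \<omega>"
    and n: "n \<le> L" and L: "0 < L" "L + s < E" and e: "e \<notin> changing_epochs T" "e * E + (L + s) < T"
    and P: "finite (present (e * E))" "card (present (e * E)) \<le> K" and s: "K * K \<le> s"
  shows "settled (present (e * E)) (map \<sigma> [1..<Suc K]) (states \<omega> (e * E + (L + s)))"
proof -
  let ?P = "present (e * E)" and ?r = "map \<sigma> [1..<Suc K]"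
  have K0: "K > 0" and LE: "L < E" and eT: "e * E + L < T" using K L e by auto
  obtain a where a: "inj_on a ?P" "\<And>j. j \<in> ?P \<Longrightarrow> a j \<in> {1..K}"
    "\<And>j. j \<in> ?P \<Longrightarrow> states \<omega> (e * E + L) j = start_trek K V ?r (a j)"
    using states_after_learning[OF K0 \<sigma> gap good n L(1) LE e(1) eT] by blast
  have set: "set [1..<Suc K] = {1..K}" by auto
  have r: "distinct ?r" "length ?r = K" "set ?r = {1..K}"
    using \<sigma> set by (simp_all only: distinct_map bij_betw_def set_map distinct_upt simp_thms length_map length_upt diff_Suc_1)
  define Q where "Q = (\<lambda>i. states \<omega> (e * E + (L + i)))"
  have "settled ?P ?r (Q s)"
  proof (rule trek_settles[OF P K r(1,2) a(1), where V = V and t = "\<lambda>i. e * E + (L + i)"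
        and f = "\<lambda>i j. the (play \<omega> (e * E + (L + i)) (Q i) j)"
        and u = "\<lambda>i j. fst \<omega> (j, e * E + (L + i))" and w = "\<lambda>i j. W j (e * E + (L + i)) \<omega>"])
    show "a j \<in> set ?r" if "j \<in> ?P" for j using a(2)[OF that] r(3) by simp
    show "Q 0 j = start_trek K V ?r (a j)" if "j \<in> ?P" for j using a(3)[OF that] by (simp add: Q_def)
    show "K * K \<le> s" by fact
    show "Q (Suc i) j = observe K (e * E + (L + i)) (the (play \<omega> (e * E + (L + i)) (Q i) j))
        (collides (plays K ?P (\<lambda>j. fst \<omega> (j, e * E + (L + i))) (\<lambda>j. W j (e * E + (L + i)) \<omega>) (Q i)) j) (Q i j)"
      if i: "i < s" and j: "j \<in> ?P" for i j
    proof -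
      let ?t = "e * E + (L + i)"
      have pres: "present ?t = ?P" using present_const[OF e(1), of "L + i"] e L i by simp
      have "?t mod E = L + i" using L i by simp
      hence nf: "?t mod E \<noteq> L - 1" using L by simp
      have "Q (Suc i) j = step \<omega> ?t (Q i) j"
        using states_Suc_epoch[OF e(1), of "L + i" j \<omega>] e L i j by (simp add: Q_def)
      also have "\<dots> = observe K ?t (the (play \<omega> ?t (Q i) j)) (collides (play \<omega> ?t (Q i)) j) (Q i j)"
      proof (cases "play \<omega> ?t (Q i) j")
        case None
        \<comment> \<open>A present player makes no play only while waiting, and both
          \<open>step\<close> and \<open>observe\<close> then leave her state unchanged.\<close>
        hence "Q i j = Waiting" using j pres by (cases "Q i j") (auto simp: play_def)
        thus ?thesis using None by (simp add: step_def)
      next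
        case (Some b)
        thus ?thesis using nf by (simp add: step_def Let_def)
      qed
      also have "play \<omega> ?t (Q i) = plays K ?P (\<lambda>j. fst \<omega> (j, ?t)) (\<lambda>j. W j ?t \<omega>) (Q i)"
        using play_eq_plays[of \<omega> ?t "Q i"] pres by simp
      finally show ?thesis using play_eq_plays[of \<omega> ?t "Q i"] pres by simp
    qed
  qed
  thus ?thesis by (simp add: Q_def)
qed

section \<open>Regret and collisions round by round\<close>

definition round_regret :: "(nat \<Rightarrow> real) \<Rightarrow> (nat \<Rightarrow> nat) \<Rightarrow> nat \<Rightarrow> sample \<Rightarrow> real" where
  "round_regret \<mu> \<sigma> t \<omega> = (\<Sum>k\<in>\<sigma> ` {1..card (present t)}. \<mu> k) -
     (\<Sum>j\<in>present t. case arm_played \<omega> t j of None \<Rightarrow> 0 | Some a \<Rightarrow> \<mu> a * (1 - real (collision \<omega> t j)))"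

lemma regret_eq_sum: "regret \<mu> \<sigma> T \<omega> = (\<Sum>t<T. round_regret \<mu> \<sigma> t \<omega>)"
  by (simp add: regret_def round_regret_def sum_subtractf)

text \<open>Reindexing the collected means along the bijection in \<open>settled\<close> gives
  exactly the sum over the best arms.\<close>

lemma settled_round:
  assumes st: "settled (present t) (map \<sigma> [1..<Suc K]) (states \<omega> t)" and \<sigma>: "bij_betw \<sigma> {1..K} {1..K}"
    and P: "card (present t) \<le> K"
  shows "\<forall>j\<in>present t. collision \<omega> t j = 0" "round_regret \<mu> \<sigma> t \<omega> = 0"
proof -
  let ?P = "present t" and ?r = "map \<sigma> [1..<Suc K]"
  obtain i where i: "bij_betw i ?P {1..card ?P}" "\<And>j. j \<in> ?P \<Longrightarrow> states \<omega> t j = Locked (?r ! (i j - 1))"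
    using st unfolding settled_def by blast
  have ir: "i j \<in> {1..K}" if "j \<in> ?P" for j using i(1) P that by (fastforce dest: bij_betw_apply)
  have "set [1..<Suc K] = {1..K}" by auto
  hence r: "distinct ?r" "length ?r = K"
    using \<sigma> by (simp_all only: distinct_map bij_betw_def distinct_upt simp_thms length_map length_upt diff_Suc_1)
  have ap: "arm_played \<omega> t j = (if j \<in> ?P then Some (?r ! (i j - 1)) else None)" for j
    using i(2)[of j] by (simp add: arm_played_def play_def)
  have nc: "\<not> collides (arm_played \<omega> t) j" if "j \<in> ?P" for j
  proof -
    have "collides (arm_played \<omega> t) j \<longleftrightarrow> (\<exists>l\<in>?P. l \<noteq> j \<and> i l = i j)"
      by (rule collides_nth_iff[OF ap _ r(1) that]) (use ir r(2) in simp)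
    thus ?thesis using i(1) that by (auto simp: bij_betw_def inj_on_def)
  qed
  thus c0: "\<forall>j\<in>?P. collision \<omega> t j = 0" by (simp add: collision_def)
  have nth: "?r ! (k - 1) = \<sigma> k" if "k \<in> {1..K}" for k
  proof -
    have "k - 1 < length [1..<Suc K]" "1 + (k - 1) = k" using that by auto
    thus ?thesis by (simp only: nth_map nth_upt length_upt less_diff_conv add.commute)
  qed
  have "(\<Sum>j\<in>?P. case arm_played \<omega> t j of None \<Rightarrow> 0 | Some a \<Rightarrow> \<mu> a * (1 - real (collision \<omega> t j)))
    = (\<Sum>j\<in>?P. \<mu> (\<sigma> (i j)))"
    by (intro sum.cong refl) (use ap c0 nth ir in \<open>simp del: upt_Suc\<close>)
  also have "\<dots> = (\<Sum>k\<in>{1..card ?P}. \<mu> (\<sigma> k))" by (rule sum.reindex_bij_betw[OF i(1)])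
  also have "\<dots> = (\<Sum>k\<in>\<sigma> ` {1..card ?P}. \<mu> k)"
  proof -
    have "inj_on \<sigma> {1..card ?P}" using \<sigma> P by (auto simp: bij_betw_def intro: inj_on_subset)
    thus ?thesis by (simp add: sum.reindex)
  qed
  finally show "round_regret \<mu> \<sigma> t \<omega> = 0" by (simp add: round_regret_def)
qed

text \<open>The collected means are nonnegative and may be dropped; at most \<open>K\<close> means,
  each at most 1, remain.\<close>

lemma round_regret_le:
  assumes K: "K > 0" and u: "\<And>jt. fst \<omega> jt \<in> {1..K}" and w: "\<And>j t. W j t \<omega> \<in> insert None (Some ` {1..K})"
    and \<mu>: "\<And>k. k \<in> {1..K} \<Longrightarrow> 0 \<le> \<mu> k \<and> \<mu> k \<le> 1" and \<sigma>: "bij_betw \<sigma> {1..K} {1..K}"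
    and P: "card (present t) \<le> K"
  shows "round_regret \<mu> \<sigma> t \<omega> \<le> real K"
proof -
  have "\<sigma> ` {1..card (present t)} \<subseteq> {1..K}" using P \<sigma> by (auto dest!: bij_betw_apply)
  hence "(\<Sum>k\<in>\<sigma> ` {1..card (present t)}. \<mu> k) \<le> real (card (\<sigma> ` {1..card (present t)})) * 1"
    using \<mu> by (intro sum_bounded_above) blast
  also have "\<dots> \<le> real K" using card_image_le[of "{1..card (present t)}" \<sigma>] P by simp
  finally have "(\<Sum>k\<in>\<sigma> ` {1..card (present t)}. \<mu> k) \<le> real K" .
  moreover have "0 \<le> (\<Sum>j\<in>present t. case arm_played \<omega> t j of None \<Rightarrow> 0 | Some a \<Rightarrow> \<mu> a * (1 - real (collision \<omega> t j)))"
  proof (intro sum_nonneg)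
    fix j
    show "0 \<le> (case arm_played \<omega> t j of None \<Rightarrow> 0 | Some a \<Rightarrow> \<mu> a * (1 - real (collision \<omega> t j)))"
    proof (cases "arm_played \<omega> t j")
      case (Some a)
      hence "0 \<le> \<mu> a" using arm_played_valid[OF K u w Some] \<mu> by blast
      thus ?thesis using Some by (simp add: collision_def)
    qed simp
  qed
  ultimately show ?thesis by (simp add: round_regret_def)
qed

lemma regret_and_collisions_le:
  assumes K: "K > 1" and u: "\<And>jt. fst \<omega> jt \<in> {1..K}" and w: "\<And>j t. W j t \<omega> \<in> insert None (Some ` {1..K})"
    and \<mu>: "\<And>k. k \<in> {1..K} \<Longrightarrow> 0 \<le> \<mu> k \<and> \<mu> k \<le> 1" and \<sigma>: "bij_betw \<sigma> {1..K} {1..K}"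
    and gap: "\<And>i. i \<in> {1..K - 1} \<Longrightarrow> \<epsilon> < \<mu> (\<sigma> i) - \<mu> (\<sigma> (i + 1))"
    and P: "\<And>t. t < T \<Longrightarrow> finite (present t) \<and> card (present t) \<le> K"
    and n: "n \<le> L" and L: "0 < L" "L \<le> E"
    and good: "\<And>e. e * E < T \<Longrightarrow> good_learning \<mu> \<epsilon> n e \<omega>"
  shows "regret \<mu> \<sigma> T \<omega> \<le> real K * real (card (unsettled_rounds (K * K) T))"
    and "collisions T \<omega> \<le> K * card (unsettled_rounds (K * K) T)"
proof -
  let ?U = "unsettled_rounds (K * K) T"
  have U: "finite ?U" "?U \<subseteq> {..<T}" unfolding unsettled_rounds_def by auto
  have settled: "settled (present t) (map \<sigma> [1..<Suc K]) (states \<omega> t)" if t: "t < T" "t \<notin> ?U" for t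
  proof -
    define e s where "e = t div E" and "s = t mod E - L"
    have m: "L + K * K \<le> t mod E" and e: "e \<notin> changing_epochs T"
      using t unfolding unsettled_rounds_def e_def by auto
    have E: "t mod E < E" using L by simp
    have teq: "e * E + (L + s) = t" using m unfolding e_def s_def by simp
    have tl: "e * E < T" using teq t m by linarith
    have pres: "present t = present (e * E)"
      using present_const[OF e, of "L + s"] teq t m E unfolding s_def by simp
    show ?thesis
      using states_settled[OF K \<sigma> gap good[OF tl] n L(1) _ e _ _ _, of s] P[OF tl] teq t m E
      unfolding s_def pres by simp
  qed
  have "regret \<mu> \<sigma> T \<omega> = (\<Sum>t<T. round_regret \<mu> \<sigma> t \<omega>)" by (rule regret_eq_sum)
  also have "\<dots> = (\<Sum>t\<in>?U. round_regret \<mu> \<sigma> t \<omega>)"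
    using U settled settled_round(2)[OF settled \<sigma>] P by (intro sum.mono_neutral_right) auto
  also have "\<dots> \<le> real (card ?U) * real K"
  proof (rule sum_bounded_above)
    fix t assume "t \<in> ?U"
    hence "card (present t) \<le> K" using U P by blast
    thus "round_regret \<mu> \<sigma> t \<omega> \<le> real K" using K by (intro round_regret_le[OF _ u w \<mu> \<sigma>]) auto
  qed
  finally show "regret \<mu> \<sigma> T \<omega> \<le> real K * real (card ?U)" by (simp add: mult.commute)
  have "collisions T \<omega> = (\<Sum>t\<in>?U. \<Sum>j\<in>present t. collision \<omega> t j)"
    unfolding collisions_def
    using U settled_round(1)[OF settled \<sigma>] P by (intro sum.mono_neutral_right) auto
  also have "\<dots> \<le> of_nat (card ?U) * K"
  proof (rule sum_bounded_above)
    fix t assume "t \<in> ?U"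
    hence "card (present t) \<le> K" using U P by blast
    moreover have "(\<Sum>j\<in>present t. collision \<omega> t j) \<le> of_nat (card (present t)) * 1"
      by (intro sum_bounded_above) (simp add: collision_def)
    ultimately show "(\<Sum>j\<in>present t. collision \<omega> t j) \<le> K" by simp
  qed
  finally show "collisions T \<omega> \<le> K * card ?U" by (simp add: mult.commute)
qed

end

subsection \<open>The high-probability bound\<close>

lemma arm_mean_bounds:
  assumes "reward_laws K D" "k \<in> {1..K}"
  shows "0 \<le> arm_mean D k \<and> arm_mean D k \<le> 1"
proof -
  have p: "prob_space (D k)" "sets (D k) = sets borel" "AE y in D k. 0 \<le> y \<and> y \<le> 1"
    using assms unfolding reward_laws_def by auto
  interpret prob_space "D k" by fact
  have "(\<lambda>y. y) \<in> borel_measurable (D k)" using p(2) by (simp cong: measurable_cong_sets)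
  hence int: "integrable (D k) (\<lambda>y. y)"
    by (intro integrable_const_bound[of _ 1]) (use p(3) in auto)
  have "0 \<le> (\<integral>y. y \<partial>D k)" using p(3) by (intro integral_nonneg_AE) auto
  moreover have "(\<integral>y. y \<partial>D k) \<le> 1" using p(3) by (intro integral_le_const int) auto
  ultimately show ?thesis by (simp add: arm_mean_def)
qed

definition settling_rounds :: "nat \<Rightarrow> real \<Rightarrow> nat" where
  "settling_rounds K \<delta> = nat \<lceil>ln (\<delta> / (2 * real K)) / ln (1 - 1 / (4 * real K))\<rceil>"

definition sampling_rounds :: "nat \<Rightarrow> real \<Rightarrow> real \<Rightarrow> nat" where
  "sampling_rounds K \<epsilon> \<delta> = nat \<lceil>2 * real K / \<epsilon>\<^sup>2 * ln (4 * (real K)\<^sup>2 / \<delta>)\<rceil>"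

text \<open>The first summand of \<open>T0\<close> is already an integer, so rounding up the sum
  rounds only the second one. Nonnegativity of both lets \<open>nat\<close> distribute.\<close>

lemma learning_length_eq:
  assumes K: "K > 1" and \<delta>: "0 < \<delta>" "\<delta> < 1" and \<epsilon>: "0 < \<epsilon>" and T: "T \<ge> 1"
  shows "learning_length K \<epsilon> \<delta> T = settling_rounds K (\<delta> / real T) + sampling_rounds K \<epsilon> (\<delta> / real T)"
proof -
  define d where "d = \<delta> / real T"
  have d: "0 < d" "d < 1" using assms unfolding d_def by (auto simp: divide_less_eq)
  have "ln (d / (2 * real K)) \<le> 0" using K d by (simp add: divide_le_eq)
  moreover have "ln (1 - 1 / (4 * real K)) \<le> 0" using K by (simp add: field_simps)
  ultimately have a: "0 \<le> ln (d / (2 * real K)) / ln (1 - 1 / (4 * real K))" by (rule divide_nonpos_nonpos)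
  have "1 * 1 \<le> real K * real K" using K by (intro mult_mono) auto
  hence "1 \<le> 4 * (real K)\<^sup>2 / d" using d by (simp add: le_divide_eq power2_eq_square)
  hence b: "0 \<le> 2 * real K / \<epsilon>\<^sup>2 * ln (4 * (real K)\<^sup>2 / d)" by simp
  have "nat \<lceil>real_of_int \<lceil>x\<rceil> + y\<rceil> = nat \<lceil>x\<rceil> + nat \<lceil>y\<rceil>" if "0 \<le> x" "0 \<le> y" for x y :: real
  proof -
    have "\<lceil>real_of_int \<lceil>x\<rceil> + y\<rceil> = \<lceil>x\<rceil> + \<lceil>y\<rceil>" "0 \<le> \<lceil>x\<rceil>" "0 \<le> \<lceil>y\<rceil>" using that by linarith+
    thus ?thesis by (simp only: nat_add_distrib)
  qed
  thus ?thesis using a b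
    unfolding learning_length_def T0_def settling_rounds_def sampling_rounds_def d_def[symmetric] by blast
qed

text \<open>Random hopping takes \<open>\<delta> / 16\<close> of the budget and the estimates take
  \<open>7 \<delta> / 8\<close>. Bounding \<open>\<delta>\<close> by \<open>1 / 2\<close> and
  \<open>\<epsilon>\<close> by 1 is what makes both shares small enough.\<close>

lemma learning_failure_le:
  assumes K: "K > 1" and \<delta>: "0 < \<delta>" "\<delta> \<le> 1 / 2" and \<epsilon>: "0 < \<epsilon>" "\<epsilon> \<le> 1"
  shows "real K * ((1 - 1 / real K) ^ settling_rounds K \<delta> +
    real K * (2 * exp (- 2 * real (sampling_rounds K \<epsilon> \<delta> div K) * (\<epsilon> / 2)\<^sup>2))) \<le> \<delta>"
proof -
  let ?n = "settling_rounds K \<delta>" and ?m = "sampling_rounds K \<epsilon> \<delta>"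
  define b where "b = 1 - 1 / (4 * real K)"
  define a where "a = \<delta> / (2 * real K)"
  have K2: "real K \<ge> 2" using K by simp
  have b: "0 < b" "b < 1" unfolding b_def using K2 by (auto simp: field_simps)
  have a: "0 < a" "a \<le> 1 / 8" unfolding a_def using K2 \<delta> by (auto simp: field_simps)
  have "ln a / ln b \<le> real ?n" unfolding settling_rounds_def a_def b_def by linarith
  hence "real ?n * ln b \<le> ln a" using b by (simp add: neg_divide_le_eq)
  moreover have "b ^ ?n = exp (real ?n * ln b)" using b by (simp add: exp_of_nat_mult)
  ultimately have bn: "b ^ ?n \<le> a" using a by (metis exp_le_cancel_iff exp_ln)
  \<comment> \<open>The true survival rate per round lies below the square of the rate
    \<open>b\<close> in \<open>T0\<close>. The survival bound thus improves from \<open>a\<close> to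
    its square, and one factor \<open>a \<le> 1 / 8\<close> is slack.\<close>
  have "1 - 1 / real K \<le> b\<^sup>2" unfolding b_def using K2 by (simp add: power2_eq_square field_simps)
  hence "(1 - 1 / real K) ^ ?n \<le> (b\<^sup>2) ^ ?n" using K2 by (intro power_mono) auto
  also have "\<dots> = (b ^ ?n)\<^sup>2" by (simp add: power_mult[symmetric] mult.commute)
  also have "\<dots> \<le> a\<^sup>2" using bn b by (intro power_mono) auto
  also have "\<dots> \<le> a * (1 / 8)" unfolding power2_eq_square using a by (intro mult_left_mono) auto
  finally have "real K * (1 - 1 / real K) ^ ?n \<le> real K * (a * (1 / 8))" by (intro mult_left_mono) auto
  also have "\<dots> = \<delta> / 16" unfolding a_def using K2 by simp
  finally have settle: "real K * (1 - 1 / real K) ^ ?n \<le> \<delta> / 16" .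

  let ?s = "?m div K"
  define l where "l = ln (4 * (real K)\<^sup>2 / \<delta>)"
  have "?m = ?s * K + ?m mod K" "?m mod K \<le> K" using K by (auto intro: less_imp_le)
  hence "?m \<le> ?s * K + K" by linarith
  \<comment> \<open>Counting only complete sweeps loses at most one sample per arm, which costs a
    factor \<open>exp (\<epsilon>\<^sup>2 / 2) \<le> exp (1 / 2)\<close> in the Hoeffding
    bound.\<close>
  hence "real ?m \<le> (real ?s + 1) * real K"
    by (metis add.commute mult_Suc of_nat_Suc of_nat_le_iff of_nat_mult)
  moreover have "2 * real K / \<epsilon>\<^sup>2 * l \<le> real ?m" unfolding sampling_rounds_def l_def by linarith
  ultimately have "real K * (2 / \<epsilon>\<^sup>2 * l) \<le> real K * (real ?s + 1)" by (simp add: mult_ac)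
  hence "2 / \<epsilon>\<^sup>2 * l \<le> real ?s + 1" by (rule mult_left_le_imp_le) (use K2 in simp)
  hence "(\<epsilon>\<^sup>2 / 2) * (2 / \<epsilon>\<^sup>2 * l) \<le> (\<epsilon>\<^sup>2 / 2) * (real ?s + 1)" by (intro mult_left_mono) auto
  hence "l \<le> \<epsilon>\<^sup>2 / 2 * real ?s + \<epsilon>\<^sup>2 / 2" using \<epsilon> by (simp add: distrib_left)
  moreover have "\<epsilon>\<^sup>2 \<le> 1" using \<epsilon> by (simp add: power_le_one)
  ultimately have "- 2 * real ?s * (\<epsilon> / 2)\<^sup>2 \<le> - l + 1 / 2" by (simp add: power2_eq_square)
  hence "exp (- 2 * real ?s * (\<epsilon> / 2)\<^sup>2) \<le> exp (- l + 1 / 2)" by simp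
  also have "exp (- l + 1 / 2) = exp (- l) * exp (1 / 2)" by (rule exp_add)
  also have "exp (- l) = \<delta> / (4 * (real K)\<^sup>2)"
    unfolding l_def using K2 \<delta> by (simp add: exp_minus)
  also have "\<delta> / (4 * (real K)\<^sup>2) * exp (1 / 2) \<le> \<delta> / (4 * (real K)\<^sup>2) * (7 / 4)"
  proof (intro mult_left_mono)
    \<comment> \<open>The value \<open>7 / 4\<close> works because its square \<open>49 / 16\<close>
      exceeds 3, which bounds \<open>exp 1\<close>; two times \<open>K\<close> squared times
      \<open>\<delta> / (4 K\<^sup>2)\<close> times \<open>7 / 4\<close> is
      \<open>7 \<delta> / 8\<close>.\<close>
    have "(exp (1 / 2 :: real))\<^sup>2 = exp 1" by (simp add: power2_eq_square exp_add[symmetric])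
    also have "\<dots> \<le> (7 / 4)\<^sup>2" using exp_le by (simp add: power2_eq_square)
    finally show "exp (1 / 2 :: real) \<le> 7 / 4" by (rule power2_le_imp_le) simp
  qed (use \<delta> in simp)
  finally have "(real K * real K * 2) * exp (- 2 * real ?s * (\<epsilon> / 2)\<^sup>2) \<le> (real K * real K * 2) * (\<delta> / (4 * (real K)\<^sup>2) * (7 / 4))"
    by (intro mult_left_mono) auto
  also have "\<dots> = 7 / 8 * \<delta>" using K2 by (simp add: power2_eq_square)
  finally have "real K * (real K * (2 * exp (- 2 * real ?s * (\<epsilon> / 2)\<^sup>2))) \<le> 7 / 8 * \<delta>"
    by (simp only: mult.assoc)
  thus ?thesis using settle \<delta> unfolding distrib_left by linarith
qed

context dynamic_trekking
begin

text \<open>A union bound over epochs, players and arms. The exceptional set consists of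
  out-of-range draws (\<open>B0\<close>), players still hopping at random after \<open>n\<close>
  rounds (\<open>B1\<close>) and inaccurate estimates despite enough samples
  (\<open>B2\<close>).\<close>

lemma good_learning_prob:
  assumes K: "K > 1" and D: "reward_laws K D" and E: "E > 0" and \<epsilon>: "\<epsilon> > 0"
    and P: "\<And>t. t < T \<Longrightarrow> finite (present t) \<and> card (present t) \<le> K"
    and L: "L = n + m" and T: "T > 0"
    and fail: "real K * ((1 - 1 / real K) ^ n + real K * (2 * exp (- 2 * real (m div K) * (\<epsilon> / 2)\<^sup>2))) \<le> \<delta> / real T"
  shows "\<exists>B\<in>sets (sample_space K D). measure (sample_space K D) B \<le> \<delta> \<and>
    (\<forall>\<omega>\<in>space (sample_space K D) - B. (\<forall>jt. fst \<omega> jt \<in> {1..K}) \<and>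
      (\<forall>e. e * E < T \<longrightarrow> good_learning (arm_mean D) \<epsilon> n e \<omega>))"
proof -
  let ?M = "sample_space K D"
  interpret prob_space ?M using D by (rule prob_space_sample_space)
  define P0 where "P0 = (\<lambda>e. present (e * E))"
  define h where "h = (\<lambda>e u s. hop_states K (P0 e) (e * E) u s)"
  \<comment> \<open>This event concerns the draws only and guarantees \<open>m div K\<close> samples
    of every arm; restricting \<open>B2\<close> to it is what makes
    \<open>adaptive_concentration\<close> applicable.\<close>
  define G where "G = (\<lambda>e u. (\<forall>jt. u jt \<in> {1..K}) \<and> (\<forall>l\<in>P0 e. h e u n l \<noteq> Hop_Random))"
  define B0 where "B0 = {\<omega> \<in> space ?M. fst \<omega> \<in> {u. \<exists>jt. u jt \<notin> {1..K}}}"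
  define B1 where "B1 = (\<lambda>e j. {\<omega> \<in> space ?M. fst \<omega> \<in> {u. h e u n j = Hop_Random}})"
  define B2 where "B2 = (\<lambda>e j k. {\<omega> \<in> space ?M. G e (fst \<omega>) \<and>
      \<epsilon> / 2 \<le> \<bar>empirical_mean (\<lambda>t k. snd \<omega> (j, t, k)) (hop_history (h e (fst \<omega>) L j)) k - arm_mean D k\<bar>})"
  \<comment> \<open>Epochs that start before the horizon; as \<open>E \<ge> 1\<close>, there are at
    most \<open>T\<close>.\<close>
  define J where "J = {e. e * E < T}"
  have "e < T" if "e * E < T" for e
  proof -
    have "e * 1 \<le> e * E" using E by (intro mult_le_mono2) simp
    thus ?thesis using that by linarith
  qed
  hence Jsub: "J \<subseteq> {..<T}" unfolding J_def by auto
  hence J: "finite J" "card J \<le> T" using finite_subset card_mono[of "{..<T}" J] by auto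
  have PJ: "finite (P0 e)" "card (P0 e) \<le> K" if "e \<in> J" for e
    using P that unfolding J_def P0_def by auto
  have draws: "{u. \<exists>jt. u jt \<notin> {1..K}} \<in> null_sets (draw_space K)" using K by (intro draws_in_range) simp
  have B0: "B0 \<in> sets ?M" "measure ?M B0 = 0"
    using measure_sample_space_fst[OF D, of "{u. \<exists>jt. u jt \<notin> {1..K}}"] draws
    unfolding B0_def by (auto simp: null_sets_def measure_def)
  have h1: "{u. h e u n j = Hop_Random} \<in> sets (draw_space K)" for e j
    unfolding h_def by (rule hop_random_sets)
  have B1: "B1 e j \<in> sets ?M" for e j
    using measure_sample_space_fst(1)[OF D h1] unfolding B1_def .
  have mB1: "measure ?M (B1 e j) \<le> (1 - 1 / real K) ^ n" if "e \<in> J" "j \<in> P0 e" for e j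
    using measure_sample_space_fst(2)[OF D h1, of e j] hop_random_decay[of K "P0 e" j "e * E" n] K PJ[OF that(1)] that(2)
    unfolding B1_def h_def by simp
  have G: "Measurable.pred (draw_space K) (G e)" if "e \<in> J" for e
  proof -
    have 1: "Measurable.pred (draw_space K) (\<lambda>u. u jt \<in> {1..K})" for jt
      by (rule measurable_compose[OF measurable_draw]) simp
    have 2: "Measurable.pred (draw_space K) (\<lambda>u. h e u n l \<noteq> Hop_Random)" for l
      unfolding h_def by (rule measurable_compose[OF measurable_hop_states]) simp
    have 3: "Measurable.pred (draw_space K) (\<lambda>u. \<forall>jt. u jt \<in> {1..K})"
      using 1 by (rule pred_intros_countable)
    have "Measurable.pred (draw_space K) (\<lambda>u. \<forall>l\<in>P0 e. h e u n l \<noteq> Hop_Random)"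
      using 2 PJ[OF that] by (intro pred_intros_finite) auto
    with 3 show ?thesis unfolding G_def by (rule pred_intros_logic)
  qed
  have H: "(\<lambda>u. hop_history (h e u L j)) \<in> draw_space K \<rightarrow>\<^sub>M count_space UNIV" for e j
    unfolding h_def by (rule measurable_compose[OF measurable_hop_states]) simp
  have GH: "distinct (sample_times (hop_history (h e u L j)) k) \<and> m div K \<le> length (sample_times (hop_history (h e u L j)) k)"
    if "j \<in> P0 e" "k \<in> {1..K}" "G e u" for e j k u
  proof
    show "distinct (sample_times (hop_history (h e u L j)) k)"
      unfolding h_def using hop_history_times by (intro distinct_sample_times) blast
    show "m div K \<le> length (sample_times (hop_history (h e u L j)) k)"
    proof -
      have "0 < K" "\<And>jt. u jt \<in> {1..K}" "\<forall>l\<in>P0 e. hop_states K (P0 e) (e * E) u n l \<noteq> Hop_Random"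
        using K that(3) unfolding G_def h_def by auto
      from hop_samples[OF this that(1,2)] show ?thesis unfolding h_def L .
    qed
  qed
  have e2: "\<epsilon> / 2 \<ge> 0" using \<epsilon> by simp
  have B2: "B2 e j k \<in> sets ?M" "measure ?M (B2 e j k) \<le> 2 * exp (- 2 * real (m div K) * (\<epsilon> / 2)\<^sup>2)"
    if "e \<in> J" "j \<in> P0 e" "k \<in> {1..K}" for e j k
    using adaptive_concentration[OF D that(3) e2 H[of e j] G[OF that(1)] GH[OF that(2,3)], of j]
    unfolding B2_def by simp_all
  define C where "C = (\<lambda>e j. B1 e j \<union> (\<Union>k\<in>{1..K}. B2 e j k))"
  have C: "C e j \<in> sets ?M" if "e \<in> J" "j \<in> P0 e" for e j
    unfolding C_def using B1 B2(1)[OF that] by (intro sets.Un sets.finite_UN) auto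
  define q where "q = (1 - 1 / real K) ^ n + real K * (2 * exp (- 2 * real (m div K) * (\<epsilon> / 2)\<^sup>2))"
  have mC: "measure ?M (C e j) \<le> q" if "e \<in> J" "j \<in> P0 e" for e j
  proof -
    have "measure ?M (C e j) \<le> measure ?M (B1 e j) + measure ?M (\<Union>k\<in>{1..K}. B2 e j k)"
      unfolding C_def using B1 B2(1)[OF that] by (intro measure_Un_le sets.finite_UN) auto
    also have "measure ?M (\<Union>k\<in>{1..K}. B2 e j k) \<le> (\<Sum>k\<in>{1..K}. measure ?M (B2 e j k))"
      using B2(1)[OF that] by (intro measure_UNION_le) auto
    also have "\<dots> \<le> real (card {1..K}) * (2 * exp (- 2 * real (m div K) * (\<epsilon> / 2)\<^sup>2))"
      using B2(2)[OF that] by (intro sum_bounded_above) auto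
    finally show ?thesis using mB1[OF that] unfolding q_def by simp
  qed
  have q0: "0 \<le> q" unfolding q_def using K by simp
  define F where "F = (\<lambda>e. \<Union>j\<in>P0 e. C e j)"
  have F: "F e \<in> sets ?M" if "e \<in> J" for e
    unfolding F_def using C[OF that] PJ[OF that] by (intro sets.finite_UN) auto
  have mF: "measure ?M (F e) \<le> \<delta> / real T" if "e \<in> J" for e
  proof -
    have "measure ?M (F e) \<le> (\<Sum>j\<in>P0 e. measure ?M (C e j))"
      unfolding F_def using C[OF that] PJ[OF that] by (intro measure_UNION_le) auto
    also have "\<dots> \<le> real (card (P0 e)) * q"
      using mC[OF that] by (intro sum_bounded_above) auto
    also have "\<dots> \<le> real K * q" using PJ[OF that] q0 by (intro mult_right_mono) auto
    also have "\<dots> \<le> \<delta> / real T" using fail unfolding q_def .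
    finally show ?thesis .
  qed
  define B where "B = B0 \<union> (\<Union>e\<in>J. F e)"
  have B: "B \<in> sets ?M" unfolding B_def using B0 F J by (intro sets.Un sets.finite_UN) auto
  have "0 \<le> real K * q" using q0 by simp
  hence d0: "0 \<le> \<delta> / real T" using fail unfolding q_def by linarith
  have "measure ?M B \<le> measure ?M B0 + measure ?M (\<Union>e\<in>J. F e)"
    unfolding B_def using B0 F J by (intro measure_Un_le sets.finite_UN) auto
  also have "\<dots> \<le> 0 + (\<Sum>e\<in>J. measure ?M (F e))"
    using B0 F J by (intro add_mono measure_UNION_le) auto
  also have "\<dots> \<le> 0 + real (card J) * (\<delta> / real T)"
    using mF by (intro add_mono sum_bounded_above) auto
  also have "\<dots> \<le> 0 + real T * (\<delta> / real T)" using J d0 by (intro add_mono mult_right_mono) auto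
  finally have mB: "measure ?M B \<le> \<delta>" using T by simp
  have "(\<forall>jt. fst \<omega> jt \<in> {1..K}) \<and> (\<forall>e. e * E < T \<longrightarrow> good_learning (arm_mean D) \<epsilon> n e \<omega>)"
    if \<omega>: "\<omega> \<in> space ?M - B" for \<omega>
  proof -
    have u: "\<forall>jt. fst \<omega> jt \<in> {1..K}" using \<omega> unfolding B_def B0_def by auto
    have "good_learning (arm_mean D) \<epsilon> n e \<omega>" if "e * E < T" for e
    proof -
      have e: "e \<in> J" using that unfolding J_def by simp
      have C': "\<omega> \<notin> C e j" if "j \<in> P0 e" for j using \<omega> e that unfolding B_def F_def by auto
      have st: "\<forall>j\<in>P0 e. h e (fst \<omega>) n j \<noteq> Hop_Random" using C' \<omega> unfolding C_def B1_def by auto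
      hence "G e (fst \<omega>)" using u unfolding G_def by simp
      hence "\<bar>empirical_mean (\<lambda>t k. snd \<omega> (j, t, k)) (hop_history (h e (fst \<omega>) L j)) k - arm_mean D k\<bar> < \<epsilon> / 2"
        if "j \<in> P0 e" "k \<in> {1..K}" for j k
        using C'[OF that(1)] \<omega> that(2) unfolding C_def B2_def by force
      thus ?thesis using u st unfolding good_learning_def h_def P0_def by blast
    qed
    thus ?thesis using u by blast
  qed
  thus ?thesis using B mB by blast
qed

end

text \<open>One power of the logarithm suffices: \<open>T0\<close> is linear in \<open>ln T\<close>,
  and so is the bound on the number of unsettled rounds. The factor \<open>K\<close> in the constant
  is the cost of a single round.\<close>

theorem theorem3:
  fixes K :: nat and V :: trek_variant and \<epsilon> \<delta> Ttr :: real
  assumes "K > 1"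
    and "0 < \<delta>" and "\<delta> < 1"
    and "0 < \<epsilon>"
    and "\<forall>N\<in>{1..K}. trek_bound V K N \<le> Ttr"
  shows "\<exists>(c::real) (p::nat). \<forall>(T::nat) (x::nat) (D :: nat \<Rightarrow> real measure) (\<sigma> :: nat \<Rightarrow> nat)
      (arr :: nat \<Rightarrow> nat) (dep :: nat \<Rightarrow> nat) (W :: nat \<Rightarrow> nat \<Rightarrow> sample \<Rightarrow> nat option).
      let L = learning_length K \<epsilon> \<delta> T;
          E = epoch_length K \<epsilon> \<delta> Ttr T x;
          \<mu> = arm_mean D
      in T \<ge> 2 \<longrightarrow> x \<ge> 1 \<longrightarrow>
         reward_laws K D \<longrightarrow>
         bij_betw \<sigma> {1..K} {1..K} \<longrightarrow>
         (\<forall>i\<in>{1..K - 1}. \<mu> (\<sigma> (i + 1)) \<le> \<mu> (\<sigma> i)) \<longrightarrow>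
         \<epsilon> < Min ((\<lambda>i. \<mu> (\<sigma> i) - \<mu> (\<sigma> (i + 1))) ` {1..K - 1}) \<longrightarrow>
         dynamic_trekking.admissible_schedule K L E arr dep Ttr T x \<longrightarrow>
         dynamic_trekking.admissible_waiting K W D \<longrightarrow>
         measure (sample_space K D)
           {\<omega> \<in> space (sample_space K D).
              dynamic_trekking.regret K V L E arr dep W \<mu> \<sigma> T \<omega>
                \<le> c * sqrt (real x * real T) * (ln (real T)) ^ p \<and>
              real (dynamic_trekking.collisions K V L E arr dep W T \<omega>)
                \<le> c * sqrt (real x * real T) * (ln (real T)) ^ p}
         \<ge> 1 - \<delta>"
proof -
  \<comment> \<open>The case of a single player gives \<open>0 \<le> Ttr\<close>, which keeps the
    epoch length real and at least of the required order.\<close>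
  have "trek_bound V K 1 \<le> Ttr" using assms(1,5) by auto
  moreover have "0 \<le> trek_bound V K 1" by (cases V) (auto simp: trek_bound_def)
  ultimately have Ttr: "0 \<le> Ttr" by linarith
  obtain c where c: "c \<ge> 0" "\<And>(T::nat) (x::nat) (B::real). T \<ge> 2 \<Longrightarrow> x \<ge> 1 \<Longrightarrow> B \<le> real T \<Longrightarrow>
     B \<le> (real T / real (epoch_length K \<epsilon> \<delta> Ttr T x) + 1) * (real (learning_length K \<epsilon> \<delta> T) + real (K * K))
         + real x * real (epoch_length K \<epsilon> \<delta> Ttr T x) \<Longrightarrow>
     B \<le> c * sqrt (real x * real T) * ln (real T)"
    using epoch_length_tradeoff[OF assms(1-4) Ttr, of "K * K"] by blast
  have main: "measure (sample_space K D)
           {\<omega> \<in> space (sample_space K D).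
              dynamic_trekking.regret K V L E arr dep W \<mu> \<sigma> T \<omega>
                \<le> real K * c * sqrt (real x * real T) * (ln (real T)) ^ 1 \<and>
              real (dynamic_trekking.collisions K V L E arr dep W T \<omega>)
                \<le> real K * c * sqrt (real x * real T) * (ln (real T)) ^ 1}
         \<ge> 1 - \<delta>"
    if L: "L = learning_length K \<epsilon> \<delta> T" and E: "E = epoch_length K \<epsilon> \<delta> Ttr T x" and \<mu>: "\<mu> = arm_mean D"
      and T: "T \<ge> 2" and x: "x \<ge> 1" and D: "reward_laws K D" and \<sigma>: "bij_betw \<sigma> {1..K} {1..K}"
      and gap: "\<epsilon> < Min ((\<lambda>i. \<mu> (\<sigma> i) - \<mu> (\<sigma> (i + 1))) ` {1..K - 1})"
      and sched: "dynamic_trekking.admissible_schedule K L E arr dep Ttr T x"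
      and W: "dynamic_trekking.admissible_waiting K W D"
    for T x L E :: nat and D :: "nat \<Rightarrow> real measure" and \<sigma> arr dep :: "nat \<Rightarrow> nat" and \<mu> :: "nat \<Rightarrow> real"
      and W :: "nat \<Rightarrow> nat \<Rightarrow> sample \<Rightarrow> nat option"
  proof -
    interpret DT: dynamic_trekking K V L E arr dep W .
    let ?M = "sample_space K D"
    interpret prob_space ?M using D by (rule prob_space_sample_space)
    let ?n = "settling_rounds K (\<delta> / real T)" and ?m = "sampling_rounds K \<epsilon> (\<delta> / real T)"
    have \<mu>01: "0 \<le> \<mu> k \<and> \<mu> k \<le> 1" if "k \<in> {1..K}" for k unfolding \<mu> by (rule arm_mean_bounds[OF D that])
    have gap': "\<epsilon> < \<mu> (\<sigma> i) - \<mu> (\<sigma> (i + 1))" if "i \<in> {1..K - 1}" for i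
      using gap that assms(1) by (subst (asm) Min_gr_iff) auto
    \<comment> \<open>As all means lie in \<open>[0, 1]\<close>, no gap exceeds 1, and
      \<open>\<epsilon>\<close> lies below the first one.\<close>
    have \<epsilon>1: "\<epsilon> \<le> 1"
    proof -
      have "1 \<in> {1..K - 1}" "1 \<in> {1..K}" "1 + 1 \<in> {1..K}" using assms(1) by auto
      from gap'[OF this(1)] \<mu>01[OF bij_betw_apply[OF \<sigma> this(2)]] \<mu>01[OF bij_betw_apply[OF \<sigma> this(3)]]
      show ?thesis by linarith
    qed
    have Lnm: "L = ?n + ?m" using learning_length_eq[OF assms(1-4)] T unfolding L by simp
    obtain \<tau> where \<tau>: "\<tau> = T0 K \<epsilon> (\<delta> / real T)" by blast
    have "1 \<le> \<tau>" using T0_bounds[OF assms(1-4)] T unfolding \<tau> by blast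
    hence L0: "0 < L" unfolding L learning_length_def \<tau>[symmetric] by linarith
    have LE: "L \<le> E" unfolding L E learning_length_def epoch_length_def Let_def by (intro nat_mono ceiling_mono) simp
    have P: "finite (DT.present t) \<and> card (DT.present t) \<le> K" if "t < T" for t
      using sched that unfolding DT.admissible_schedule_def by blast
    have w: "W j t \<omega> \<in> insert None (Some ` {1..K})" for j t \<omega>
      using W unfolding DT.admissible_waiting_def by blast
    have ce: "finite (DT.changing_epochs T)" "card (DT.changing_epochs T) \<le> x"
      using DT.card_changing_epochs[of T x] P sched unfolding DT.admissible_schedule_def by blast+
    let ?U = "real (card (DT.unsettled_rounds (K * K) T))"
    have "?U \<le> c * sqrt (real x * real T) * ln (real T)"
    proof (rule c(2)[OF T x])
      have "card (DT.unsettled_rounds (K * K) T) \<le> card {..<T}"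
        by (intro card_mono) (auto simp: DT.unsettled_rounds_def)
      thus "?U \<le> real T" by simp
      show "?U \<le> (real T / real (epoch_length K \<epsilon> \<delta> Ttr T x) + 1) * (real (learning_length K \<epsilon> \<delta> T) + real (K * K))
         + real x * real (epoch_length K \<epsilon> \<delta> Ttr T x)"
        using DT.card_unsettled_rounds[OF _ ce, of "K * K"] L0 LE unfolding L E by simp
    qed
    hence U: "real K * ?U \<le> real K * c * sqrt (real x * real T) * (ln (real T)) ^ 1"
      using mult_left_mono[of ?U _ "real K"] by (simp add: mult.assoc)
    \<comment> \<open>Here \<open>T \<ge> 2\<close> yields the confidence of at most
      \<open>1 / 2\<close> that the failure estimate asks for.\<close>
    have "\<delta> / real T \<le> 1 / 2" "0 < \<delta> / real T" using assms(2,3) T by (auto simp: field_simps)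
    from learning_failure_le[OF assms(1) this(2,1) assms(4) \<epsilon>1]
    obtain B where B: "B \<in> sets ?M" "measure ?M B \<le> \<delta>"
      "\<And>\<omega>. \<omega> \<in> space ?M - B \<Longrightarrow> (\<forall>jt. fst \<omega> jt \<in> {1..K}) \<and> (\<forall>e. e * E < T \<longrightarrow> DT.good_learning \<mu> \<epsilon> ?n e \<omega>)"
      using DT.good_learning_prob[OF assms(1) D _ assms(4) P Lnm, of T \<delta>] L0 LE T unfolding \<mu> by force
    let ?G = "{\<omega> \<in> space ?M. DT.regret \<mu> \<sigma> T \<omega> \<le> real K * c * sqrt (real x * real T) * (ln (real T)) ^ 1 \<and>
        real (DT.collisions T \<omega>) \<le> real K * c * sqrt (real x * real T) * (ln (real T)) ^ 1}"
    \<comment> \<open>Measurability is essential: \<open>measure\<close> is 0 on sets that are not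
      measurable, so the inclusion below would not bound it.\<close>
    have "?G \<in> sets ?M"
      using DT.measurable_regret[OF D W, of \<mu> \<sigma> T] DT.measurable_collisions[OF D W, of T] by measurable
    moreover have "space ?M - B \<subseteq> ?G"
    proof
      fix \<omega> assume \<omega>: "\<omega> \<in> space ?M - B"
      have u: "fst \<omega> jt \<in> {1..K}" and good: "e * E < T \<Longrightarrow> DT.good_learning \<mu> \<epsilon> ?n e \<omega>" for jt e
        using B(3)[OF \<omega>] by blast+
      have n: "?n \<le> L" using Lnm by simp
      note R = DT.regret_and_collisions_le[where T = T, OF assms(1) u w \<mu>01 \<sigma> gap' P n L0 LE good]
      have "real (DT.collisions T \<omega>) \<le> real K * ?U"
        using R(2) by (metis of_nat_le_iff of_nat_mult)
      thus "\<omega> \<in> ?G" using R(1) U \<omega> by auto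
    qed
    ultimately have "measure ?M (space ?M - B) \<le> measure ?M ?G" by (intro finite_measure_mono)
    moreover have "measure ?M (space ?M - B) = 1 - measure ?M B" using B(1) by (rule prob_compl)
    ultimately show ?thesis using B(2) by linarith
  qed
  show ?thesis
    unfolding Let_def by (intro exI[of _ "real K * c"] exI[of _ 1] allI impI main) simp_all
qed

end
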